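(* Let $\Delta$ be a $d$-dimensional pure tree with $m$ facets, connected in codimension $1$, with vertices $x_1,\dots,x_n$, and let $I\subset R=K[x_1,\dots,x_n]$ be its facet ideal. For each adjacent face $G\in\Delta$ let $m(G)=|\{F\in\mathcal F(\Delta) : G\subset F\}|$. Then $$b_{i,i+d}(R/I)=\begin{cases} m, & \text{if } i=1,\\ \sum_{G}\binom{m(G)}{i}, & \text{if } i\ge 2,\end{cases}$$ where the sum runs over all adjacent faces $G$ of $\Delta$.
   Context: A simplicial complex $\Delta$ on a finite vertex set is a collection of subsets containing all singletons and closed under taking subsets; $\dim F=|F|-1$ for a face $F$ (so $\dim\emptyset=-1$). Facets are the maximal faces, $\mathcal F(\Delta)$ is the set of facets. $\dim\Delta$ is the maximal dimension of a facet; $\Delta$ is pure if all facets have the same dimension. A subcomplex of $\Delta$ is a simplicial complex $\Gamma$ with $\mathcal F(\Gamma)\subseteq\mathcal F(\Delta)$. A chain between facets $F,G$ is a sequence of facets $F=F_0,\dots,F_q=G$ with $F_i\cap F_{i+1}\ne\emptyset$ for all $i$; it is proper if moreover $\dim(F_i\cap F_{i+1})=\dim(F_{i+1})-1$ for all $i$. $\Delta$ is connected if any two facets are joined by a chain, and connected in codimension $1$ if for any two facets $F,G$ with $\dim F\ge\dim G$ there is a proper chain between $F$ and $G$. A facet $F$ is a leaf if it is the only facet of $\Delta$, or there is a facet $G\ne F$ with $F\cap H\subseteq F\cap G$ for every facet $H\ne F$. A tree is a connected simplicial complex every nonempty subcomplex of which has a leaf. An adjacent face of a $d$-dimensional pure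 tree connected in codimension $1$ is a face of dimension $d-1$ contained in at least two facets. $K$ is a field, the vertices of $\Delta$ are identified with the variables of $R$, and the facet ideal is generated by the monomials $x_{i_1}\cdots x_{i_s}$ with $\{x_{i_1},\dots,x_{i_s}\}$ a facet. $b_{i,j}(M)=\dim_K\operatorname{Tor}_i^R(K,M)_j$ are the graded Betti numbers. *)

theory Defs
  imports Complex_Main "HOL-Library.Poly_Mapping" "HOL-Library.Function_Algebras"
begin

section \<open>Simplicial complexes, facets and trees\<close>

definition simplicial_complex :: "'v set \<Rightarrow> 'v set set \<Rightarrow> bool" where
  "simplicial_complex V \<Delta> \<longleftrightarrow>
     finite V \<and> \<Delta> \<subseteq> Pow V \<and> (\<forall>v\<in>V. {v} \<in> \<Delta>) \<and> (\<forall>F\<in>\<Delta>. \<forall>G. G \<subseteq> F \<longrightarrow> G \<in> \<Delta>)"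

definition face_dim :: "'v set \<Rightarrow> int" where
  "face_dim F = int (card F) - 1"

definition facets :: "'v set set \<Rightarrow> 'v set set" where
  "facets \<Delta> = {F \<in> \<Delta>. \<forall>G\<in>\<Delta>. F \<subseteq> G \<longrightarrow> G = F}"

definition complex_dim :: "'v set set \<Rightarrow> int" where
  "complex_dim \<Delta> = Max (face_dim ` facets \<Delta>)"

definition pure :: "'v set set \<Rightarrow> bool" where
  "pure \<Delta> \<longleftrightarrow> (\<forall>F\<in>facets \<Delta>. \<forall>G\<in>facets \<Delta>. face_dim F = face_dim G)"

text \<open>The vertex set of a subcomplex may be smaller than that of the ambient complex.\<close>

definition subcomplex :: "'v set set \<Rightarrow> 'v set set \<Rightarrow> bool" where
  "subcomplex \<Gamma> \<Delta> \<longleftrightarrow> (\<exists>W. simplicial_complex W \<Gamma>) \<and> facets \<Gamma> \<subseteq> facets \<Delta>"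

definition facet_chain :: "'v set set \<Rightarrow> 'v set \<Rightarrow> 'v set \<Rightarrow> 'v set list \<Rightarrow> bool" where
  "facet_chain \<Delta> F G Fs \<longleftrightarrow>
     Fs \<noteq> [] \<and> hd Fs = F \<and> last Fs = G \<and> set Fs \<subseteq> facets \<Delta> \<and>
     (\<forall>i. Suc i < length Fs \<longrightarrow> Fs ! i \<inter> Fs ! Suc i \<noteq> {})"

definition proper_chain :: "'v set set \<Rightarrow> 'v set \<Rightarrow> 'v set \<Rightarrow> 'v set list \<Rightarrow> bool" where
  "proper_chain \<Delta> F G Fs \<longleftrightarrow>
     facet_chain \<Delta> F G Fs \<and>
     (\<forall>i. Suc i < length Fs \<longrightarrow>
        face_dim (Fs ! i \<inter> Fs ! Suc i) = face_dim (Fs ! Suc i) - 1)"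

definition connected_complex :: "'v set set \<Rightarrow> bool" where
  "connected_complex \<Delta> \<longleftrightarrow> (\<forall>F\<in>facets \<Delta>. \<forall>G\<in>facets \<Delta>. \<exists>Fs. facet_chain \<Delta> F G Fs)"

definition connected_in_codim_1 :: "'v set set \<Rightarrow> bool" where
  "connected_in_codim_1 \<Delta> \<longleftrightarrow>
     (\<forall>F\<in>facets \<Delta>. \<forall>G\<in>facets \<Delta>. face_dim F \<ge> face_dim G \<longrightarrow> (\<exists>Fs. proper_chain \<Delta> F G Fs))"

definition leaf :: "'v set set \<Rightarrow> 'v set \<Rightarrow> bool" where
  "leaf \<Delta> F \<longleftrightarrow>
     F \<in> facets \<Delta> \<and>
     (facets \<Delta> = {F} \<or>
      (\<exists>G\<in>facets \<Delta>. G \<noteq> F \<and> (\<forall>H\<in>facets \<Delta>. H \<noteq> F \<longrightarrow> F \<inter> H \<subseteq> F \<inter> G)))"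

definition tree :: "'v set set \<Rightarrow> bool" where
  "tree \<Delta> \<longleftrightarrow>
     connected_complex \<Delta> \<and> (\<forall>\<Gamma>. subcomplex \<Gamma> \<Delta> \<and> \<Gamma> \<noteq> {} \<longrightarrow> (\<exists>F. leaf \<Gamma> F))"

definition facet_mult :: "'v set set \<Rightarrow> 'v set \<Rightarrow> nat" where
  "facet_mult \<Delta> G = card {F \<in> facets \<Delta>. G \<subseteq> F}"

definition adjacent_faces :: "'v set set \<Rightarrow> 'v set set" where
  "adjacent_faces \<Delta> = {G \<in> \<Delta>. face_dim G = complex_dim \<Delta> - 1 \<and> facet_mult \<Delta> G \<ge> 2}"


section \<open>The polynomial ring and the facet ideal\<close>

text \<open>
  For a finite type \<open>'v\<close> this is the polynomial ring over \<open>'k\<close> with one variable for each element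
  of \<open>'v\<close>.
\<close>

type_synonym ('v, 'k) polynomial = "('v \<Rightarrow>\<^sub>0 nat) \<Rightarrow>\<^sub>0 'k"

definition const_poly :: "'k::zero \<Rightarrow> ('v, 'k) polynomial" where
  "const_poly c = Poly_Mapping.single 0 c"

definition var :: "'v \<Rightarrow> ('v, 'k::zero_neq_one) polynomial" where
  "var v = Poly_Mapping.single (Poly_Mapping.single v 1) 1"

definition homogeneous :: "int \<Rightarrow> ('v, 'k::zero) polynomial set" where
  "homogeneous j = {p. \<forall>t\<in>Poly_Mapping.keys p.
     int (\<Sum>v\<in>Poly_Mapping.keys t. Poly_Mapping.lookup t v) = j}"

definition ideal_generated :: "'r::comm_ring_1 set \<Rightarrow> 'r set" where
  "ideal_generated = module.span (*)"

definition facet_ideal :: "'v set set \<Rightarrow> ('v, 'k::comm_ring_1) polynomial set" where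
  "facet_ideal \<Delta> = ideal_generated ((\<lambda>F. \<Prod>v\<in>F. var v) ` facets \<Delta>)"


section \<open>Graded modules and graded Tor\<close>

text \<open>
  A graded module is given as a quotient \<open>N / U\<close>: the graded module \<open>N\<close> has the type \<open>'m\<close> as its
  underlying set, scalar multiplication \<open>smult\<close> and homogeneous components \<open>piece j\<close>, and
  \<open>U = rel\<close> is a graded submodule of \<open>N\<close>. The quotient is never formed as a set of cosets (it would
  have to be a type depending on \<open>U\<close>): its elements are represented in \<open>N\<close>, and two of them are
  identified if they differ by an element of \<open>U\<close>.
\<close>

record (overloaded) ('v, 'k, 'm) graded_module =
  smult :: "('v, 'k) polynomial \<Rightarrow> 'm \<Rightarrow> 'm"
  piece :: "int \<Rightarrow> 'm set"
  rel :: "'m set"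

definition residue_field :: "('v, 'k::field, 'k) graded_module" where
  "residue_field =
     \<lparr>smult = (\<lambda>p c. Poly_Mapping.lookup p 0 * c),
      piece = (\<lambda>j. if j = 0 then UNIV else {0}),
      rel = {0}\<rparr>"

definition quotient_ring ::
    "('v, 'k::field) polynomial set \<Rightarrow> ('v, 'k, ('v, 'k) polynomial) graded_module" where
  "quotient_ring I = \<lparr>smult = (*), piece = homogeneous, rel = I\<rparr>"

text \<open>
  A complex of graded free modules of finite rank with an augmentation:
  \<open>P i = (\<Oplus>a < rank i. R(- gdeg i a))\<close>, i.e. \<open>P i\<close> has basis elements \<open>e i a\<close> of degree
  \<open>gdeg i a\<close> for \<open>a < rank i\<close>. The differential \<open>P (i + 1) \<rightarrow> P i\<close> maps \<open>e (i + 1) b\<close> to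
  \<open>\<Sum>a < rank i. mat i a b * e i a\<close>, and the augmentation maps \<open>e 0 a\<close> to \<open>aug a\<close>.
  An element of \<open>P i\<close> is given by its coordinates, a function on \<open>nat\<close> of which only the values
  below \<open>rank i\<close> matter.
\<close>

record (overloaded) ('v, 'k, 'm) augmented_complex =
  rank :: "nat \<Rightarrow> nat"
  gdeg :: "nat \<Rightarrow> nat \<Rightarrow> int"
  mat :: "nat \<Rightarrow> nat \<Rightarrow> nat \<Rightarrow> ('v, 'k) polynomial"
  aug :: "nat \<Rightarrow> 'm"

definition graded_free_resolution ::
    "('v, 'k::field, 'm::ab_group_add) graded_module \<Rightarrow> ('v, 'k, 'm) augmented_complex \<Rightarrow> bool"
where
  "graded_free_resolution M P \<longleftrightarrow>
     \<comment> \<open>all maps are homogeneous of degree 0\<close>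
     (\<forall>i. \<forall>a < rank P i. \<forall>b < rank P (Suc i).
        mat P i a b \<in> homogeneous (gdeg P (Suc i) b - gdeg P i a)) \<and>
     (\<forall>a < rank P 0. aug P a \<in> piece M (gdeg P 0 a)) \<and>
     \<comment> \<open>exactness at \<open>M\<close>, at \<open>P 0\<close> and at \<open>P (i + 1)\<close>\<close>
     (\<forall>x. \<exists>f. x - (\<Sum>a < rank P 0. smult M (f a) (aug P a)) \<in> rel M) \<and>
     (\<forall>f. (\<Sum>a < rank P 0. smult M (f a) (aug P a)) \<in> rel M \<longleftrightarrow>
        (\<exists>g. \<forall>a < rank P 0. f a = (\<Sum>b < rank P 1. mat P 0 a b * g b))) \<and>
     (\<forall>i f. (\<forall>a < rank P i. (\<Sum>b < rank P (Suc i). mat P i a b * f b) = 0) \<longleftrightarrow>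
        (\<exists>g. \<forall>b < rank P (Suc i).
           f b = (\<Sum>c < rank P (Suc (Suc i)). mat P (Suc i) b c * g c)))"

text \<open>
  For \<open>M = N / U\<close> we have \<open>P i \<otimes> M = (\<Oplus>a < rank i. M(- gdeg i a))\<close>. Its component of degree \<open>j\<close> is
  represented by tuples of elements of \<open>N\<close>, extended by 0, and the differential of \<open>P \<otimes> M\<close> is given
  by the matrices of \<open>P\<close>.
\<close>

definition tensor_chains ::
    "('v, 'k, 'l) augmented_complex \<Rightarrow> ('v, 'k, 'm::zero) graded_module \<Rightarrow> nat \<Rightarrow> int
      \<Rightarrow> (nat \<Rightarrow> 'm) set" where
  "tensor_chains P M i j =
     {z. \<forall>a. if a < rank P i then z a \<in> piece M (j - gdeg P i a) else z a = 0}"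

definition tensor_diff ::
    "('v, 'k, 'l) augmented_complex \<Rightarrow> ('v, 'k, 'm::comm_monoid_add) graded_module \<Rightarrow> nat
      \<Rightarrow> (nat \<Rightarrow> 'm) \<Rightarrow> nat \<Rightarrow> 'm" where
  "tensor_diff P M i z a =
     (if a < rank P i then \<Sum>b < rank P (Suc i). smult M (mat P i a b) (z b) else 0)"

text \<open>
  Cycles and boundaries of \<open>P \<otimes> M\<close> in homological degree \<open>i\<close> and internal degree \<open>j\<close>. Equality in
  \<open>M = N / U\<close> is congruence modulo \<open>U\<close>, so both are the full preimages in \<open>N\<close>.
\<close>

definition tensor_cycles ::
    "('v, 'k, 'l) augmented_complex \<Rightarrow> ('v, 'k, 'm::ab_group_add) graded_module \<Rightarrow> nat \<Rightarrow> int
      \<Rightarrow> (nat \<Rightarrow> 'm) set" where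
  "tensor_cycles P M i j =
     {z \<in> tensor_chains P M i j. \<forall>i'. i = Suc i' \<longrightarrow> (\<forall>a. tensor_diff P M i' z a \<in> rel M)}"

definition tensor_boundaries ::
    "('v, 'k, 'l) augmented_complex \<Rightarrow> ('v, 'k, 'm::ab_group_add) graded_module \<Rightarrow> nat \<Rightarrow> int
      \<Rightarrow> (nat \<Rightarrow> 'm) set" where
  "tensor_boundaries P M i j =
     {z \<in> tensor_chains P M i j.
        \<exists>w \<in> tensor_chains P M (Suc i) j. \<forall>a. z a - tensor_diff P M i w a \<in> rel M}"

text \<open>
  The dimension of \<open>Z / B\<close> for subspaces \<open>B \<subseteq> Z\<close>: the cardinality of a set \<open>S \<subseteq> Z\<close> whose elements
  represent, without repetition, a basis of \<open>Z / B\<close>. As for \<^const>\<open>vector_space.dim\<close>, the value is 0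
  if \<open>Z / B\<close> has infinite dimension.
\<close>

definition quotient_basis ::
    "('k::field \<Rightarrow> 'b::ab_group_add \<Rightarrow> 'b) \<Rightarrow> 'b set \<Rightarrow> 'b set \<Rightarrow> 'b set \<Rightarrow> bool" where
  "quotient_basis scale Z B S \<longleftrightarrow>
     S \<subseteq> Z \<and>
     (\<forall>T u. finite T \<and> T \<subseteq> S \<and> (\<Sum>s\<in>T. scale (u s) s) \<in> B \<longrightarrow> (\<forall>s\<in>T. u s = 0)) \<and>
     (\<forall>z\<in>Z. \<exists>T u. finite T \<and> T \<subseteq> S \<and> z - (\<Sum>s\<in>T. scale (u s) s) \<in> B)"

definition quotient_dim ::
    "('k::field \<Rightarrow> 'b::ab_group_add \<Rightarrow> 'b) \<Rightarrow> 'b set \<Rightarrow> 'b set \<Rightarrow> nat" where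
  "quotient_dim scale Z B = card (SOME S. quotient_basis scale Z B S)"

text \<open>
  \<open>tor_dim A M i j\<close> is the dimension over \<open>'k\<close> of the degree \<open>j\<close> component of \<open>Tor i A M\<close>, where
  \<open>Tor i A M\<close> is the \<open>i\<close>-th homology of \<open>P \<otimes> M\<close> for a chosen graded free resolution \<open>P\<close> of \<open>A\<close>.
  Resolutions of finite rank in each degree exist if \<open>A\<close> is finitely generated, which covers the
  case \<open>A = K\<close> used for the Betti numbers. For other \<open>A\<close> the definition should not be used.
\<close>

definition tor_dim ::
    "('v, 'k::field, 'l::ab_group_add) graded_module \<Rightarrow>
     ('v, 'k, 'm::ab_group_add) graded_module \<Rightarrow> nat \<Rightarrow> int \<Rightarrow> nat" where
  "tor_dim A M i j =
     (let P = (SOME P. graded_free_resolution A P)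
      in quotient_dim (\<lambda>c z a. smult M (const_poly c) (z a))
           (tensor_cycles P M i j) (tensor_boundaries P M i j))"

definition graded_betti ::
    "('v, 'k::field, 'm::ab_group_add) graded_module \<Rightarrow> nat \<Rightarrow> int \<Rightarrow> nat" where
  "graded_betti M i j = tor_dim residue_field M i j"

end

theory Submission
  imports Defs "HOL-Library.Countable"
begin

text \<open>
  Any two graded free resolutions of \<open>K\<close> are homotopy equivalent, so the Betti numbers can be computed
  from the Koszul complex. Since \<open>I\<close> is generated in degree \<open>d + 1\<close>, it does not meet \<open>R\<close> in degree \<open>d\<close>,
  and \<open>Tor\<close> in the bidegree \<open>(i, i + d)\<close> is the space of Koszul cycles in \<open>\<Lambda>\<^sup>i V \<otimes> R\<^sub>d\<close> modulo \<open>I\<close>, divided by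
  the kernel of the Koszul differential. For \<open>i \<ge> 2\<close> it has as basis the classes of \<open>x\<^sub>G e\<^sub>A\<close>, where \<open>G\<close> is
  an adjacent face and \<open>A\<close> a set of \<open>i\<close> vertices \<open>w\<close> such that each \<open>G \<union> {w}\<close> is a facet. Independence
  holds because a set of \<open>d + 2\<close> vertices contains at most two facets of a tree. For spanning, subtract
  basis elements from a cycle until its image under the differential vanishes at one chosen \<open>w \<in> A\<close> for
  each pair \<open>(G, A)\<close>. If the image were nonzero, the facets occurring in it in some multidegree would
  form a subcomplex, and a leaf of this subcomplex would produce a pair \<open>(G, A)\<close> such that the image
  vanishes at no \<open>w \<in> A\<close>.
\<close>

section \<open>Dimension of quotients of vector spaces\<close>

text \<open>Two choices are hidden in \<open>tor_dim\<close>: an arbitrary resolution and an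
  arbitrary basis of cycles modulo boundaries. One explicit finite basis over one explicit
  resolution must determine the number. This takes invariance of dimension for quotients that are
  never formed as sets, and maps that are mutually inverse up to boundaries.

  The basis elements and the binomial coefficients arise together. The differential of x_G e_A is
  the signed sum of x_(G \<union> {w}) e_(A - {w}) over w in A, which lies in I if every G \<union>
  {w} is a facet, and A chooses i of the m(G) vertices completing G. The case i = 1 differs because
  A - {w} is then empty: the differential remembers only the facet, so all G in one facet yield the
  same class, and one pair per facet is kept, which gives m. For i \<ge> 2 any one term of the
  differential determines the pair. Both cases are instances of one lemma about a set
  \<open>X\<close> of pairs with a uniqueness and a detection property.\<close>

lemma quotient_basis_independentD:
  assumes "quotient_basis scale Z B S" "finite T" "T \<subseteq> S" "(\<Sum>s\<in>T. scale (u s) s) \<in> B" "s \<in> T"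
  shows "u s = 0"
proof -
  have "\<forall>T u. finite T \<and> T \<subseteq> S \<and> (\<Sum>s\<in>T. scale (u s) s) \<in> B \<longrightarrow> (\<forall>s\<in>T. u s = 0)"
    using assms(1) unfolding quotient_basis_def by (elim conjE)
  from this[rule_format, of T u s] assms show ?thesis by simp
qed

lemma quotient_basis_spanD:
  assumes "quotient_basis scale Z B S" "z \<in> Z"
  shows "\<exists>T u. finite T \<and> T \<subseteq> S \<and> z - (\<Sum>s\<in>T. scale (u s) s) \<in> B"
proof -
  have "\<forall>z\<in>Z. \<exists>T u. finite T \<and> T \<subseteq> S \<and> z - (\<Sum>s\<in>T. scale (u s) s) \<in> B"
    using assms(1) unfolding quotient_basis_def by (elim conjE)
  then show ?thesis using assms(2) by (rule bspec)
qed

context vector_space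
begin

text \<open>Terms outside \<open>S\<close> come from \<open>B0\<close> and sum to an element of
  \<open>B\<close>. So the part over \<open>S\<close> lies in \<open>B\<close> and its coefficients
  vanish by independence modulo \<open>B\<close>; independence of \<open>B0\<close> settles the
  rest.\<close>

lemma quotient_basis_independent_Un:
  assumes B: "subspace B" and B0: "independent B0" "B0 \<subseteq> B"
    and S: "quotient_basis scale Z B S"
  shows "independent (B0 \<union> S)"
  unfolding independent_explicit_module
proof (intro allI impI)
  fix T u v
  assume T: "finite T" "T \<subseteq> B0 \<union> S" "(\<Sum>v\<in>T. scale (u v) v) = 0" "v \<in> T"
  have split: "(\<Sum>v\<in>T. scale (u v) v) = (\<Sum>v\<in>T \<inter> S. scale (u v) v) + (\<Sum>v\<in>T - S. scale (u v) v)"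
    using T(1) by (rule sum.Int_Diff)
  have "(\<Sum>v\<in>T - S. scale (u v) v) \<in> B"
    using B0(2) T(2) by (intro subspace_sum[OF B] subspace_scale[OF B]) auto
  then have "- (\<Sum>v\<in>T - S. scale (u v) v) \<in> B" by (rule subspace_neg[OF B])
  moreover have "(\<Sum>v\<in>T \<inter> S. scale (u v) v) = - (\<Sum>v\<in>T - S. scale (u v) v)"
    using split T(3) by (simp add: eq_neg_iff_add_eq_0)
  ultimately have "(\<Sum>v\<in>T \<inter> S. scale (u v) v) \<in> B" by simp
  then have 1: "\<forall>s\<in>T \<inter> S. u s = 0"
    using quotient_basis_independentD[OF S, of "T \<inter> S"] T(1) by simp
  then have "(\<Sum>v\<in>T - S. scale (u v) v) = 0"
    using split T(3) by simp
  then have "\<forall>s\<in>T - S. u s = 0"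
    using B0(1) T(1,2) unfolding independent_explicit_module by blast
  with 1 T(4) show "u v = 0" by blast
qed

text \<open>The linear map \<open>p\<close> that kills a basis of \<open>B\<close> and fixes
  \<open>S\<close> realises Z/B as the span of \<open>S\<close>: an element of \<open>Z\<close>
  killed by \<open>p\<close> lies in \<open>B\<close>. As \<open>T\<close> is independent modulo
  \<open>B\<close>, \<open>p\<close> is injective on the span of \<open>T\<close>, and the exchange
  bound applies to the image of \<open>T\<close>.\<close>

lemma quotient_basis_card_le:
  assumes B: "subspace B" and Z: "subspace Z"
    and S: "quotient_basis scale Z B S" "finite S"
    and T: "quotient_basis scale Z B T"
  shows "finite T \<and> card T \<le> card S"
proof -
  obtain B0 where B0: "B0 \<subseteq> B" "independent B0" "B \<subseteq> span B0"
    using maximal_independent_subset[of B] by blast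
  have ind: "independent (B0 \<union> S)"
    using quotient_basis_independent_Un[OF B B0(2,1) S(1)] .
  interpret vp: vector_space_pair scale scale ..
  obtain p where p: "\<forall>x\<in>B0 \<union> S. p x = (if x \<in> S then x else 0)" and lin: "Vector_Spaces.linear scale scale p"
    using vp.linear_independent_extend[OF ind, of "\<lambda>x. if x \<in> S then x else 0"] by blast
  interpret p: Vector_Spaces.linear scale scale p by fact
  have disj: "x \<notin> S" if "x \<in> B" for x
  proof
    assume "x \<in> S"
    then show False
      using quotient_basis_independentD[OF S(1), of "{x}" "\<lambda>_. 1" x] that by simp
  qed
  have pB: "p b = 0" if "b \<in> B" for b
  proof (rule p.eq_0_on_span[of B0])
    show "b \<in> span B0" using that B0(3) by blast
    show "p x = 0" if "x \<in> B0" for x using that p disj B0(1) by auto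
  qed
  have pS: "p s = s" if "s \<in> S" for s using p that by auto
  have coord: "\<exists>U u. finite U \<and> U \<subseteq> S \<and> z - (\<Sum>s\<in>U. scale (u s) s) \<in> B \<and> p z = (\<Sum>s\<in>U. scale (u s) s)"
    if z: "z \<in> Z" for z
  proof -
    obtain U u where U: "finite U" "U \<subseteq> S" "z - (\<Sum>s\<in>U. scale (u s) s) \<in> B"
      using quotient_basis_spanD[OF S(1) z] by blast
    have "0 = p (z - (\<Sum>s\<in>U. scale (u s) s))" using pB[OF U(3)] by simp
    also have "\<dots> = p z - (\<Sum>s\<in>U. scale (u s) (p s))" by (simp add: p.diff p.sum p.scale)
    also have "(\<Sum>s\<in>U. scale (u s) (p s)) = (\<Sum>s\<in>U. scale (u s) s)"
      using U(2) pS by (intro sum.cong) auto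
    finally show ?thesis using U by auto
  qed
  have TZ: "T \<subseteq> Z" using T unfolding quotient_basis_def by blast
  have indT: "independent T"
    using quotient_basis_independent_Un[OF B, of "{}" Z T] T independent_empty by simp
  have inj: "inj_on p (span T)"
  proof (rule p.inj_on_iff_eq_0[THEN iffD2])
    show "\<forall>x\<in>span T. p x = 0 \<longrightarrow> x = 0"
    proof (intro ballI impI)
      fix z assume z: "z \<in> span T" "p z = 0"
      then obtain C c where C: "finite C" "C \<subseteq> T" "z = (\<Sum>t\<in>C. scale (c t) t)"
        unfolding span_explicit by blast
      have "z \<in> Z" using span_minimal[OF TZ Z] z(1) by blast
      then obtain U u where U: "finite U" "U \<subseteq> S" "z - (\<Sum>s\<in>U. scale (u s) s) \<in> B"
          "p z = (\<Sum>s\<in>U. scale (u s) s)"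
        using coord by blast
      then have "z \<in> B" using z(2) by simp
      then have "\<forall>t\<in>C. c t = 0" using quotient_basis_independentD[OF T C(1,2)] C(3) by simp
      then show "z = 0" using C(3) by simp
    qed
  qed (rule subspace_span)
  have "independent (p ` T)"
    using vp.linear_independent_injective_image[OF lin indT inj] .
  moreover have "p ` T \<subseteq> span S"
  proof
    fix y assume "y \<in> p ` T"
    then obtain t where t: "t \<in> Z" "y = p t" using TZ by blast
    then obtain U u where "U \<subseteq> S" "y = (\<Sum>s\<in>U. scale (u s) s)"
      using coord by blast
    then show "y \<in> span S"
      using span_base by (auto intro!: span_sum span_scale)
  qed
  ultimately have *: "finite (p ` T) \<and> card (p ` T) \<le> card S"
    using independent_span_bound[OF S(2)] by blast
  have "inj_on p T" using inj span_superset inj_on_subset by blast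
  with * show ?thesis using finite_imageD[of p T] card_image[of p T] by simp
qed

lemma quotient_dim_eq_card:
  assumes "subspace B" "subspace Z" "quotient_basis scale Z B S" "finite S"
  shows "quotient_dim scale Z B = card S"
proof -
  define T where "T = (SOME S. quotient_basis scale Z B S)"
  have T: "quotient_basis scale Z B T" unfolding T_def by (rule someI) (fact assms(3))
  have "finite T \<and> card T \<le> card S"
    using quotient_basis_card_le[OF assms(1,2,3,4) T] .
  moreover from this have "card S \<le> card T"
    using quotient_basis_card_le[OF assms(1,2) T _ assms(3)] by blast
  ultimately show ?thesis unfolding quotient_dim_def T_def by simp
qed

text \<open>\<open>f\<close> and \<open>g\<close> induce mutually inverse isomorphisms between Z/B
  and Z'/B', so the image of \<open>S\<close> under \<open>f\<close> is a basis of the latter.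
  Homotopy equivalent complexes provide exactly such a pair of maps.\<close>

lemma quotient_dim_transport:
  assumes sub: "subspace B" "subspace B'" "subspace Z'"
    and S: "quotient_basis scale Z B S" "finite S"
    and lin: "Vector_Spaces.linear scale scale f" "Vector_Spaces.linear scale scale g"
    and f: "f ` Z \<subseteq> Z'" "f ` B \<subseteq> B'" and g: "g ` Z' \<subseteq> Z" "g ` B' \<subseteq> B"
    and gf: "\<And>z. z \<in> Z \<Longrightarrow> g (f z) - z \<in> B"
    and fg: "\<And>z. z \<in> Z' \<Longrightarrow> f (g z) - z \<in> B'"
  shows "quotient_dim scale Z' B' = card S"
proof -
  interpret f: Vector_Spaces.linear scale scale f by fact
  interpret g: Vector_Spaces.linear scale scale g by fact
  have SZ: "S \<subseteq> Z" using S unfolding quotient_basis_def by blast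
  have key: "\<forall>s\<in>C. c s = 0" if C: "finite C" "C \<subseteq> S" "(\<Sum>s\<in>C. scale (c s) (f s)) \<in> B'" for C c
  proof -
    have "g (\<Sum>s\<in>C. scale (c s) (f s)) \<in> B" using C g by blast
    moreover have "g (\<Sum>s\<in>C. scale (c s) (f s)) = (\<Sum>s\<in>C. scale (c s) (g (f s)))"
      by (simp add: g.sum g.scale)
    moreover have "(\<Sum>s\<in>C. scale (c s) (g (f s) - s)) \<in> B"
      using SZ C by (intro subspace_sum subspace_scale sub gf) auto
    moreover have "(\<Sum>s\<in>C. scale (c s) s)
        = (\<Sum>s\<in>C. scale (c s) (g (f s))) - (\<Sum>s\<in>C. scale (c s) (g (f s) - s))"
      by (simp add: scale_right_diff_distrib sum_subtractf)
    ultimately have "(\<Sum>s\<in>C. scale (c s) s) \<in> B" using subspace_diff[OF sub(1)] by simp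
    then show ?thesis using quotient_basis_independentD[OF S(1) C(1,2)] by simp
  qed
  have inj: "inj_on f S"
  proof (rule inj_onI)
    fix x y assume xy: "x \<in> S" "y \<in> S" "f x = f y"
    show "x = y"
    proof (rule ccontr)
      assume "x \<noteq> y"
      \<comment> \<open>Independence is tested on sums over sets, so two elements of
        \<open>S\<close> with a common image must be excluded separately. These coefficients encode
        f x - f y = 0.\<close>
      define c :: "'b \<Rightarrow> 'a" where "c s = (if s = x then 1 else -1)" for s
      have "(\<Sum>s\<in>{x, y}. scale (c s) (f s)) = 0"
        using \<open>x \<noteq> y\<close> xy by (simp add: c_def)
      then have "\<forall>s\<in>{x,y}. c s = 0"
        using xy subspace_0[OF sub(2)] by (intro key) auto
      then show False by (simp add: c_def)
    qed
  qed
  have "quotient_basis scale Z' B' (f ` S)"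
    unfolding quotient_basis_def
  proof (intro conjI allI impI ballI)
    show "f ` S \<subseteq> Z'" using SZ f by blast
  next
    fix T u s assume T: "finite T \<and> T \<subseteq> f ` S \<and> (\<Sum>s\<in>T. scale (u s) s) \<in> B'" "s \<in> T"
    then obtain C where C: "C \<subseteq> S" "T = f ` C" by (meson subset_imageE)
    have injC: "inj_on f C" using inj C(1) inj_on_subset by blast
    have "(\<Sum>s\<in>C. scale (u (f s)) (f s)) = (\<Sum>s\<in>T. scale (u s) s)"
      unfolding C(2) using injC by (simp add: sum.reindex)
    then have "\<forall>s\<in>C. u (f s) = 0"
      using T C S(2) finite_subset by (intro key) auto
    then show "u s = 0" using T(2) C(2) by blast
  next
    fix z assume z: "z \<in> Z'"
    then have "g z \<in> Z" using g by blast
    then obtain C u where C: "finite C" "C \<subseteq> S" "g z - (\<Sum>s\<in>C. scale (u s) s) \<in> B"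
      using quotient_basis_spanD[OF S(1)] by blast
    have injC: "inj_on f C" using inj C(2) inj_on_subset by blast
    have "f (g z - (\<Sum>s\<in>C. scale (u s) s)) \<in> B'" using C f by blast
    then have 1: "f (g z) - (\<Sum>s\<in>C. scale (u s) (f s)) \<in> B'"
      by (simp add: f.diff f.sum f.scale)
    have "f (g z) - (\<Sum>s\<in>C. scale (u s) (f s)) - (f (g z) - z) \<in> B'"
      using subspace_diff[OF sub(2) 1 fg[OF z]] .
    then have "z - (\<Sum>s\<in>C. scale (u s) (f s)) \<in> B'" by simp
    moreover have "(\<Sum>s\<in>f ` C. scale (u (the_inv_into C f s)) s) = (\<Sum>s\<in>C. scale (u s) (f s))"
      using injC by (simp add: sum.reindex the_inv_into_f_f)
    ultimately show "\<exists>T u. finite T \<and> T \<subseteq> f ` S \<and> z - (\<Sum>s\<in>T. scale (u s) s) \<in> B'"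
      using C by (intro exI[of _ "f ` C"] exI[of _ "\<lambda>s. u (the_inv_into C f s)"]) auto
  qed
  then have "quotient_dim scale Z' B' = card (f ` S)"
    using quotient_dim_eq_card[OF sub(2,3)] S(2) by blast
  then show ?thesis using card_image[OF inj] by simp
qed

end


section \<open>Graded polynomials and facet ideals\<close>

definition mdeg :: "('v \<Rightarrow>\<^sub>0 nat) \<Rightarrow> int" where
  "mdeg t = int (\<Sum>v\<in>Poly_Mapping.keys t. Poly_Mapping.lookup t v)"

lemma mdeg_alt: "mdeg t = int (\<Sum>v\<in>UNIV. Poly_Mapping.lookup t v)" for t :: "'v::finite \<Rightarrow>\<^sub>0 nat"
  unfolding mdeg_def
  by (intro arg_cong[of _ _ int] sum.mono_neutral_left) (auto simp: in_keys_iff)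

lemma mdeg_add: "mdeg (s + t) = mdeg s + mdeg t" for s :: "'v::finite \<Rightarrow>\<^sub>0 nat"
  by (simp add: mdeg_alt lookup_add sum.distrib)

lemma mdeg_0 [simp]: "mdeg 0 = 0"
  by (simp add: mdeg_def)

lemma mdeg_single [simp]: "mdeg (Poly_Mapping.single v n) = int n"
  by (cases "n = 0") (simp_all add: mdeg_def)

lemma homogeneous_iff: "p \<in> homogeneous j \<longleftrightarrow> (\<forall>t. Poly_Mapping.lookup p t \<noteq> 0 \<longrightarrow> mdeg t = j)"
  by (auto simp: homogeneous_def mdeg_def in_keys_iff)

lemma homogeneous_0 [simp]: "0 \<in> homogeneous j"
  by (simp add: homogeneous_iff)

lemma homogeneous_add:
  "p \<in> homogeneous j \<Longrightarrow> q \<in> homogeneous j \<Longrightarrow> p + q \<in> homogeneous j"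
  for p :: "('v, 'k::comm_ring_1) polynomial"
  unfolding homogeneous_iff lookup_add by (metis add.right_neutral)

lemma homogeneous_uminus:
  "p \<in> homogeneous j \<Longrightarrow> - p \<in> homogeneous j"
  for p :: "('v, 'k::comm_ring_1) polynomial"
  by (simp add: homogeneous_iff)

lemma homogeneous_diff:
  "p \<in> homogeneous j \<Longrightarrow> q \<in> homogeneous j \<Longrightarrow> p - q \<in> homogeneous j"
  for p :: "('v, 'k::comm_ring_1) polynomial"
  using homogeneous_add[of p j "- q"] homogeneous_uminus[of q j] by simp

lemma homogeneous_sum:
  "(\<And>x. x \<in> X \<Longrightarrow> p x \<in> homogeneous j) \<Longrightarrow> (\<Sum>x\<in>X. p x) \<in> homogeneous j"
  for p :: "'x \<Rightarrow> ('v, 'k::comm_ring_1) polynomial"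
  by (induction X rule: infinite_finite_induct) (auto intro: homogeneous_add)

lemma homogeneous_single: "mdeg t = j \<Longrightarrow> Poly_Mapping.single t c \<in> homogeneous j"
  by (auto simp: homogeneous_iff lookup_single when_def)

lemma homogeneous_mult:
  fixes p q :: "('v::finite, 'k::comm_ring_1) polynomial"
  assumes "p \<in> homogeneous i" "q \<in> homogeneous j"
  shows "p * q \<in> homogeneous (i + j)"
  unfolding homogeneous_iff
proof (intro allI impI)
  fix t assume "Poly_Mapping.lookup (p * q) t \<noteq> 0"
  then have "t \<in> Poly_Mapping.keys (p * q)" by (simp add: in_keys_iff)
  then obtain a b where "t = a + b" "a \<in> Poly_Mapping.keys p" "b \<in> Poly_Mapping.keys q"
    using keys_mult[of p q] by blast
  then show "mdeg t = i + j"
    using assms by (auto simp: mdeg_add homogeneous_iff in_keys_iff)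
qed

lemma homogeneous_mult_eq:
  fixes p q :: "('v::finite, 'k::comm_ring_1) polynomial"
  assumes "p \<in> homogeneous i" "q \<in> homogeneous j" "k = i + j"
  shows "p * q \<in> homogeneous k"
  using homogeneous_mult[OF assms(1,2)] assms(3) by simp

lemma poly_sum_monomials: "p = (\<Sum>t\<in>Poly_Mapping.keys p. Poly_Mapping.single t (Poly_Mapping.lookup p t))"
  by (rule poly_mapping_eqI) (auto simp: lookup_sum lookup_single when_def in_keys_iff)

text \<open>Projection to the homogeneous component of degree \<open>j\<close>. Exactness of a
  resolution supplies preimages without control of degrees, whereas chain maps and homotopies have
  to be graded; this projection repairs the degrees.\<close>

definition hcomp :: "int \<Rightarrow> ('v, 'k::zero) polynomial \<Rightarrow> ('v, 'k) polynomial" where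
  "hcomp j p = Poly_Mapping.Abs_poly_mapping (\<lambda>t. if mdeg t = j then Poly_Mapping.lookup p t else 0)"

lemma lookup_hcomp: "Poly_Mapping.lookup (hcomp j p) t = (if mdeg t = j then Poly_Mapping.lookup p t else 0)"
proof -
  have "finite {t. (if mdeg t = j then Poly_Mapping.lookup p t else 0) \<noteq> 0}"
    by (rule finite_subset[OF _ finite_lookup[of p]]) auto
  then show ?thesis by (simp add: hcomp_def)
qed

lemma hcomp_homogeneous [simp]: "hcomp j p \<in> homogeneous j"
  by (auto simp: homogeneous_iff lookup_hcomp)

lemma hcomp_of_homogeneous: "p \<in> homogeneous i \<Longrightarrow> hcomp j p = (if i = j then p else 0)"
  by (rule poly_mapping_eqI) (auto simp: homogeneous_iff lookup_hcomp)

lemma hcomp_sum: "hcomp j (\<Sum>x\<in>X. p x) = (\<Sum>x\<in>X. hcomp j (p x))"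
  for p :: "'x \<Rightarrow> ('v, 'k::comm_ring_1) polynomial"
  by (rule poly_mapping_eqI) (simp add: lookup_hcomp lookup_sum)

lemma sum_hcomp:
  fixes p :: "('v, 'k::comm_ring_1) polynomial"
  assumes "finite K" "mdeg ` Poly_Mapping.keys p \<subseteq> K"
  shows "p = (\<Sum>k\<in>K. hcomp k p)"
  using assms by (intro poly_mapping_eqI) (auto simp: lookup_sum lookup_hcomp in_keys_iff image_subset_iff)

lemma hcomp_mult:
  fixes p q :: "('v::finite, 'k::comm_ring_1) polynomial"
  assumes "p \<in> homogeneous e"
  shows "hcomp j (p * q) = p * hcomp (j - e) q"
proof -
  \<comment> \<open>The index j - e is added by hand so that the final sum contains it even if
    \<open>q\<close> has no component there.\<close>
  define K where "K = insert (j - e) (mdeg ` Poly_Mapping.keys q)"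
  have "q = (\<Sum>k\<in>K. hcomp k q)" by (rule sum_hcomp) (auto simp: K_def)
  then have "hcomp j (p * q) = hcomp j (p * (\<Sum>k\<in>K. hcomp k q))" by simp
  also have "\<dots> = (\<Sum>k\<in>K. hcomp j (p * hcomp k q))"
    by (simp add: sum_distrib_left hcomp_sum)
  also have "\<dots> = (\<Sum>k\<in>K. if k = j - e then p * hcomp k q else 0)"
    using hcomp_of_homogeneous[OF homogeneous_mult[OF assms hcomp_homogeneous]]
    by (intro sum.cong refl) auto
  also have "\<dots> = p * hcomp (j - e) q" by (simp add: K_def)
  finally show ?thesis .
qed

section \<open>Coefficients of products\<close>

lemma lookup_const_mult [simp]: "Poly_Mapping.lookup (const_poly c * p) t = c * Poly_Mapping.lookup p t"
  for p :: "('v, 'k::comm_ring_1) polynomial"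
  unfolding const_poly_def mult_map_scale_conv_mult[symmetric]
  by (simp add: Poly_Mapping.map.rep_eq when_def)

lemma const_poly_homogeneous: "const_poly c \<in> homogeneous 0"
  by (simp add: const_poly_def homogeneous_single)

lemma var_homogeneous: "var v \<in> homogeneous 1"
  by (simp add: var_def homogeneous_single)

text \<open>Exponents are natural numbers, so s + t = 0 only for s = t = 0. This is the
  multiplicativity of the projection R \<rightarrow> K through which R acts on
  \<open>residue_field\<close>.\<close>

lemma lookup_0_mult: "Poly_Mapping.lookup (p * q) 0 = Poly_Mapping.lookup p 0 * Poly_Mapping.lookup q 0"
  for p :: "('v, 'k::comm_ring_1) polynomial"
proof -
  have "p * q = (\<Sum>t\<in>Poly_Mapping.keys p. Poly_Mapping.single t (Poly_Mapping.lookup p t))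
     * (\<Sum>t\<in>Poly_Mapping.keys q. Poly_Mapping.single t (Poly_Mapping.lookup q t))"
    using poly_sum_monomials[of p] poly_sum_monomials[of q] by simp
  also have "\<dots> = (\<Sum>s\<in>Poly_Mapping.keys p. \<Sum>t\<in>Poly_Mapping.keys q.
      Poly_Mapping.single (s + t) (Poly_Mapping.lookup p s * Poly_Mapping.lookup q t))"
    by (simp add: sum_product mult_single)
  finally have "Poly_Mapping.lookup (p * q) 0 = (\<Sum>s\<in>Poly_Mapping.keys p. \<Sum>t\<in>Poly_Mapping.keys q.
      if s + t = 0 then Poly_Mapping.lookup p s * Poly_Mapping.lookup q t else 0)"
    by (simp add: lookup_sum lookup_single when_def)
  also have "\<dots> = (\<Sum>s\<in>Poly_Mapping.keys p. \<Sum>t\<in>Poly_Mapping.keys q.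
      (if s = 0 then Poly_Mapping.lookup p s else 0) * (if t = 0 then Poly_Mapping.lookup q t else 0))"
  proof (intro sum.cong refl)
    fix s t :: "'v \<Rightarrow>\<^sub>0 nat"
    have "s + t = 0 \<longleftrightarrow> s = 0 \<and> t = 0"
      by (auto simp: poly_mapping_eq_iff fun_eq_iff lookup_add)
    then show "(if s + t = 0 then Poly_Mapping.lookup p s * Poly_Mapping.lookup q t else 0)
      = (if s = 0 then Poly_Mapping.lookup p s else 0) * (if t = 0 then Poly_Mapping.lookup q t else 0)"
      by simp
  qed
  also have "\<dots> = Poly_Mapping.lookup p 0 * Poly_Mapping.lookup q 0"
    by (simp add: sum_product[symmetric] in_keys_iff)
  finally show ?thesis .
qed

text \<open>Subtraction of exponents is truncated, so monomials not divisible by the variable have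
  to be treated as a separate case.\<close>

lemma lookup_var_mult:
  fixes p :: "('v, 'k::comm_ring_1) polynomial"
  shows "Poly_Mapping.lookup (var v * p) b =
    (if Poly_Mapping.lookup b v = 0 then 0 else Poly_Mapping.lookup p (b - Poly_Mapping.single v 1))"
proof -
  have "var v * p = var v * (\<Sum>t\<in>Poly_Mapping.keys p. Poly_Mapping.single t (Poly_Mapping.lookup p t))"
    using poly_sum_monomials[of p] by simp
  then have "Poly_Mapping.lookup (var v * p) b = (\<Sum>t\<in>Poly_Mapping.keys p.
      if Poly_Mapping.single v 1 + t = b then Poly_Mapping.lookup p t else 0)"
    by (simp add: var_def sum_distrib_left mult_single lookup_sum lookup_single when_def)
  also have "\<dots> = (\<Sum>t\<in>Poly_Mapping.keys p.
      if t = b - Poly_Mapping.single v 1 then (if Poly_Mapping.lookup b v = 0 then 0 else Poly_Mapping.lookup p t) else 0)"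
  proof (intro sum.cong refl)
    fix t
    have "Poly_Mapping.single v 1 + t = b \<longleftrightarrow> Poly_Mapping.lookup b v \<noteq> 0 \<and> t = b - Poly_Mapping.single v 1"
      by (auto simp: poly_mapping_eq_iff fun_eq_iff lookup_add lookup_minus lookup_single when_def)
    then show "(if Poly_Mapping.single v 1 + t = b then Poly_Mapping.lookup p t else 0) =
       (if t = b - Poly_Mapping.single v 1 then (if Poly_Mapping.lookup b v = 0 then 0 else Poly_Mapping.lookup p t) else 0)"
      by auto
  qed
  finally show ?thesis by (simp add: in_keys_iff)
qed

text \<open>This scaling is the one that \<open>tor_dim\<close> uses when the module is a quotient
  ring.\<close>

lemma vector_space_const_poly:
  "vector_space (\<lambda>(c::'k::field) (z :: nat \<Rightarrow> ('v, 'k) polynomial) a. const_poly c * z a)"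
  by unfold_locales
    (simp_all add: fun_eq_iff const_poly_def single_add distrib_left distrib_right mult_single
      mult.assoc[symmetric])

section \<open>Squarefree monomials and the facet ideal\<close>

definition sqfree :: "'v::finite set \<Rightarrow> ('v \<Rightarrow>\<^sub>0 nat)" where
  "sqfree F = Poly_Mapping.Abs_poly_mapping (\<lambda>v. if v \<in> F then 1 else 0)"

lemma lookup_sqfree [simp]: "Poly_Mapping.lookup (sqfree F) v = (if v \<in> F then 1 else 0)"
  by (simp add: sqfree_def)

lemma mdeg_sqfree [simp]: "mdeg (sqfree F) = int (card F)"
  by (simp add: mdeg_alt sum.If_cases)

lemma prod_var: "(\<Prod>v\<in>F. var v) = (Poly_Mapping.single (sqfree F) 1 :: ('v::finite, 'k::comm_ring_1) polynomial)"
proof -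
  have "finite F" by simp
  then show ?thesis
  proof (induction F)
    case empty
    have "sqfree {} = (0 :: 'v \<Rightarrow>\<^sub>0 nat)" by (rule poly_mapping_eqI) simp
    then show ?case by simp
  next
    case (insert x F)
    have "sqfree (insert x F) = Poly_Mapping.single x 1 + sqfree F"
      using insert by (intro poly_mapping_eqI) (auto simp: lookup_add lookup_single when_def)
    with insert show ?case by (simp add: var_def mult_single)
  qed
qed

lemma module_mult: "module ((*) :: 'r::comm_ring_1 \<Rightarrow> 'r \<Rightarrow> 'r)"
  by unfold_locales (auto simp: algebra_simps)

lemma ideal_generated_0: "0 \<in> ideal_generated X"
  unfolding ideal_generated_def using module.span_zero[OF module_mult] .

lemma ideal_generated_add: "p \<in> ideal_generated X \<Longrightarrow> q \<in> ideal_generated X \<Longrightarrow> p + q \<in> ideal_generated X"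
  unfolding ideal_generated_def using module.span_add[OF module_mult] .

lemma ideal_generated_mult: "q \<in> ideal_generated X \<Longrightarrow> p * q \<in> ideal_generated X"
  unfolding ideal_generated_def using module.span_scale[OF module_mult] .

lemma ideal_generated_sum: "(\<And>a. a \<in> A \<Longrightarrow> f a \<in> ideal_generated X) \<Longrightarrow> sum f A \<in> ideal_generated X"
  unfolding ideal_generated_def using module.span_sum[OF module_mult] .

lemma facet_ideal_sqfree: "F \<in> facets \<Delta> \<Longrightarrow> Poly_Mapping.single (sqfree F) 1 \<in> facet_ideal \<Delta>"
  unfolding facet_ideal_def ideal_generated_def prod_var[symmetric]
  by (rule module.span_base[OF module_mult]) simp

text \<open>The facet ideal is a monomial ideal: the polynomials all of whose monomials are
  divisible by a facet monomial form a submodule \<open>N\<close> containing the generators.\<close>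

lemma facet_ideal_lookup:
  fixes p :: "('v::finite, 'k::comm_ring_1) polynomial"
  assumes "p \<in> facet_ideal \<Delta>" "Poly_Mapping.lookup p t \<noteq> 0"
  shows "\<exists>F\<in>facets \<Delta>. \<forall>v\<in>F. Poly_Mapping.lookup t v \<noteq> 0"
proof -
  define N where "N = {p :: ('v, 'k) polynomial. \<forall>t. Poly_Mapping.lookup p t \<noteq> 0 \<longrightarrow>
    (\<exists>F\<in>facets \<Delta>. \<forall>v\<in>F. Poly_Mapping.lookup t v \<noteq> 0)}"
  have "facet_ideal \<Delta> \<subseteq> N"
    unfolding facet_ideal_def ideal_generated_def
  proof (rule module.span_minimal[OF module_mult])
    show "(\<lambda>F. \<Prod>v\<in>F. var v) ` facets \<Delta> \<subseteq> N"
    proof (intro image_subsetI)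
      fix F assume F: "F \<in> facets \<Delta>"
      show "(\<Prod>v\<in>F. var v) \<in> N"
        unfolding N_def prod_var
      proof (intro CollectI allI impI)
        fix t assume "Poly_Mapping.lookup (Poly_Mapping.single (sqfree F) (1::'k)) t \<noteq> 0"
        then have "t = sqfree F" by (metis lookup_single_not_eq)
        then show "\<exists>F\<in>facets \<Delta>. \<forall>v\<in>F. Poly_Mapping.lookup t v \<noteq> 0"
          using F by (intro bexI[of _ F]) simp_all
      qed
    qed
    show "module.subspace (*) N"
      unfolding module.subspace_def[OF module_mult]
    proof (intro conjI ballI allI)
      show "0 \<in> N" by (simp add: N_def)
    next
      fix p q assume pq: "p \<in> N" "q \<in> N"
      show "p + q \<in> N"
        unfolding N_def
      proof (intro CollectI allI impI)
        fix t assume "Poly_Mapping.lookup (p + q) t \<noteq> 0"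
        then have "Poly_Mapping.lookup p t \<noteq> 0 \<or> Poly_Mapping.lookup q t \<noteq> 0"
          by (auto simp: lookup_add)
        then show "\<exists>F\<in>facets \<Delta>. \<forall>v\<in>F. Poly_Mapping.lookup t v \<noteq> 0"
          using pq unfolding N_def by blast
      qed
    next
      fix p q :: "('v, 'k) polynomial" assume q: "q \<in> N"
      show "p * q \<in> N"
        unfolding N_def
      proof (intro CollectI allI impI)
        fix t assume "Poly_Mapping.lookup (p * q) t \<noteq> 0"
        then have "t \<in> Poly_Mapping.keys (p * q)" by (simp add: in_keys_iff)
        then obtain a b where "t = a + b" "b \<in> Poly_Mapping.keys q"
          using keys_mult[of p q] by blast
        moreover from this obtain F where "F \<in> facets \<Delta>" "\<forall>v\<in>F. Poly_Mapping.lookup b v \<noteq> 0"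
          using q unfolding N_def in_keys_iff by blast
        ultimately show "\<exists>F\<in>facets \<Delta>. \<forall>v\<in>F. Poly_Mapping.lookup t v \<noteq> 0"
          by (intro bexI[of _ F]) (simp_all add: lookup_add)
      qed
    qed
  qed
  then show ?thesis using assms by (auto simp: N_def)
qed


section \<open>Comparison of resolutions of the residue field\<close>

text \<open>Matrices and vectors are total functions on \<open>nat\<close> of which only the entries
  below a rank are meaningful. Identities between them are therefore stated entrywise under index
  bounds.\<close>

definition mat_vec :: "nat \<Rightarrow> (nat \<Rightarrow> nat \<Rightarrow> 'r::comm_ring_1) \<Rightarrow> (nat \<Rightarrow> 'r) \<Rightarrow> nat \<Rightarrow> 'r" where
  "mat_vec r A f a = (\<Sum>b<r. A a b * f b)"

lemma mat_vec_cong: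
  "(\<And>b. b < r \<Longrightarrow> A a b = A' a b) \<Longrightarrow> (\<And>b. b < r \<Longrightarrow> f b = f' b) \<Longrightarrow> mat_vec r A f a = mat_vec r A' f' a"
  unfolding mat_vec_def by (intro sum.cong) auto

lemma mat_vec_assoc:
  "mat_vec r A (mat_vec s B f) a = mat_vec s (\<lambda>a c. mat_vec r A (\<lambda>b. B b c) a) f a"
  unfolding mat_vec_def sum_distrib_left sum_distrib_right
  by (subst sum.swap) (simp add: mult.assoc)

lemma mat_vec_diff: "mat_vec r A (\<lambda>b. f b - g b) a = mat_vec r A f a - mat_vec r A g a"
  by (simp add: mat_vec_def right_diff_distrib sum_subtractf)

lemma mat_vec_add: "mat_vec r A (\<lambda>b. f b + g b) a = mat_vec r A f a + mat_vec r A g a"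
  by (simp add: mat_vec_def distrib_left sum.distrib)

lemma mat_vec_diff_left: "mat_vec r (\<lambda>a b. A a b - B a b) f a = mat_vec r A f a - mat_vec r B f a"
  by (simp add: mat_vec_def left_diff_distrib sum_subtractf)

lemma mat_vec_add_left: "mat_vec r (\<lambda>a b. A a b + B a b) f a = mat_vec r A f a + mat_vec r B f a"
  by (simp add: mat_vec_def distrib_right sum.distrib)

lemma mat_vec_scale: "mat_vec r A (\<lambda>b. c * f b) a = c * mat_vec r A f a"
  by (simp add: mat_vec_def sum_distrib_left mult.left_commute)

lemma mat_vec_zero: "(\<And>b. b < r \<Longrightarrow> f b = 0) \<Longrightarrow> mat_vec r A f a = 0"
  by (simp add: mat_vec_def)

lemma mat_vec_unit: "b < r \<Longrightarrow> mat_vec r A (\<lambda>c. if c = b then 1 else 0) a = A a b"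
  by (simp add: mat_vec_def if_distrib[of "(*) _"] cong: if_cong)

lemma mat_vec_id: "a < r \<Longrightarrow> mat_vec r (\<lambda>a b. if a = b then 1 else 0) f a = f a"
  by (simp add: mat_vec_def if_distrib[of "\<lambda>x. x * _"] cong: if_cong)

abbreviation diff_map :: "('v, 'k::field, 'm) augmented_complex \<Rightarrow> nat \<Rightarrow> (nat \<Rightarrow> ('v, 'k) polynomial) \<Rightarrow>
    nat \<Rightarrow> ('v, 'k) polynomial" where
  "diff_map P n \<equiv> mat_vec (rank P (Suc n)) (mat P n)"

definition aug_map :: "('v, 'k::field, 'k) augmented_complex \<Rightarrow> (nat \<Rightarrow> ('v, 'k) polynomial) \<Rightarrow> 'k" where
  "aug_map P f = (\<Sum>a<rank P 0. Poly_Mapping.lookup (f a) 0 * aug P a)"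

text \<open>Kernel of the map leaving the n-th module, the augmentation taking the place of the
  differential for n = 0. Exactness at all stages thus becomes a single statement in
  \<open>n\<close>.\<close>

fun is_cycle :: "('v, 'k::field, 'k) augmented_complex \<Rightarrow> nat \<Rightarrow> (nat \<Rightarrow> ('v, 'k) polynomial) \<Rightarrow> bool" where
  "is_cycle P 0 f \<longleftrightarrow> aug_map P f = 0"
| "is_cycle P (Suc n) f \<longleftrightarrow> (\<forall>a<rank P n. diff_map P n f a = 0)"

definition hvec :: "('v, 'k::field, 'm) augmented_complex \<Rightarrow> nat \<Rightarrow> int \<Rightarrow> (nat \<Rightarrow> ('v, 'k) polynomial) \<Rightarrow> bool" where
  "hvec P n e f \<longleftrightarrow> (\<forall>a<rank P n. f a \<in> homogeneous (e - gdeg P n a))"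

text \<open>Column \<open>b\<close> is the image of the b-th basis element, so a graded map is one
  in which every column is homogeneous of the degree of its basis element.\<close>

definition hmap :: "('v, 'k::field, 'm) augmented_complex \<Rightarrow> ('v, 'k, 'm) augmented_complex \<Rightarrow> nat \<Rightarrow> nat \<Rightarrow>
    (nat \<Rightarrow> nat \<Rightarrow> ('v, 'k) polynomial) \<Rightarrow> bool" where
  "hmap P Q n k \<Phi> \<longleftrightarrow> (\<forall>b<rank P n. hvec Q k (gdeg P n b) (\<lambda>a. \<Phi> a b))"

lemma hvec_mat_vec:
  fixes P Q :: "('v::finite, 'k::field, 'm) augmented_complex"
  assumes "hmap P Q n k \<Phi>" "hvec P n e f"
  shows "hvec Q k e (mat_vec (rank P n) \<Phi> f)"
  unfolding hvec_def mat_vec_def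
proof (intro allI impI homogeneous_sum)
  fix a b assume "a < rank Q k" "b \<in> {..<rank P n}"
  then show "\<Phi> a b * f b \<in> homogeneous (e - gdeg Q k a)"
    using assms unfolding hmap_def hvec_def
    by (intro homogeneous_mult_eq[of _ "gdeg P n b - gdeg Q k a" _ "e - gdeg P n b"]) auto
qed

lemma hmap_comp:
  fixes P Q R :: "('v::finite, 'k::field, 'm) augmented_complex"
  assumes "hmap P Q n k \<Phi>" "hmap Q R k l \<Psi>"
  shows "hmap P R n l (\<lambda>a c. mat_vec (rank Q k) \<Psi> (\<lambda>b. \<Phi> b c) a)"
  using assms hvec_mat_vec[OF assms(2)] unfolding hmap_def by blast

lemma hvec_diff: "hvec P n e f \<Longrightarrow> hvec P n e g \<Longrightarrow> hvec P n e (\<lambda>a. f a - g a)"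
  unfolding hvec_def by (auto intro: homogeneous_diff)

abbreviation residue_resolution :: "('v, 'k::field, 'k) augmented_complex \<Rightarrow> bool" where
  "residue_resolution \<equiv> graded_free_resolution residue_field"

text \<open>The residue field lives in degree 0 only, so homogeneity of the augmentation means that
  it kills the basis elements of any other degree.\<close>

lemma residue_resolution_alt:
  "residue_resolution P \<longleftrightarrow>
    (\<forall>n. hmap P P (Suc n) n (mat P n)) \<and>
    (\<forall>a<rank P 0. gdeg P 0 a \<noteq> 0 \<longrightarrow> aug P a = 0) \<and>
    (\<forall>x. \<exists>f. aug_map P f = x) \<and>
    (\<forall>n f. is_cycle P n f \<longleftrightarrow> (\<exists>g. \<forall>a<rank P n. f a = diff_map P n g a))"
proof -
  have 1: "(\<forall>n. hmap P P (Suc n) n (mat P n)) \<longleftrightarrow>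
    (\<forall>i. \<forall>a < rank P i. \<forall>b < rank P (Suc i). mat P i a b \<in> homogeneous (gdeg P (Suc i) b - gdeg P i a))"
    unfolding hmap_def hvec_def by blast
  have 2: "(\<forall>n f. is_cycle P n f \<longleftrightarrow> (\<exists>g. \<forall>a<rank P n. f a = diff_map P n g a)) \<longleftrightarrow>
    (\<forall>f. is_cycle P 0 f \<longleftrightarrow> (\<exists>g. \<forall>a<rank P 0. f a = diff_map P 0 g a)) \<and>
    (\<forall>n f. is_cycle P (Suc n) f \<longleftrightarrow> (\<exists>g. \<forall>a<rank P (Suc n). f a = diff_map P (Suc n) g a))"
    (is "(\<forall>n f. ?Q n f) \<longleftrightarrow> ?R")
  proof
    assume "\<forall>n f. ?Q n f"
    then show ?R by blast
  next
    assume R: ?R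
    show "\<forall>n f. ?Q n f"
    proof (intro allI)
      fix n f show "?Q n f"
        using R by (cases n) blast+
    qed
  qed
  have aug: "(\<forall>a<rank P 0. aug P a \<in> piece residue_field (gdeg P 0 a)) \<longleftrightarrow>
      (\<forall>a<rank P 0. gdeg P 0 a \<noteq> 0 \<longrightarrow> aug P a = 0)"
    by (auto simp: residue_field_def)
  have surj: "x - (\<Sum>a<rank P 0. smult residue_field (f a) (aug P a)) \<in> rel residue_field \<longleftrightarrow> aug_map P f = x"
    for x f by (auto simp: residue_field_def aug_map_def)
  have cycle_0: "(\<Sum>a<rank P 0. smult residue_field (f a) (aug P a)) \<in> rel residue_field \<longleftrightarrow> is_cycle P 0 f"
    for f by (simp add: residue_field_def aug_map_def)
  have cycle_Suc: "(\<forall>a<rank P i. (\<Sum>b<rank P (Suc i). mat P i a b * f b) = 0) \<longleftrightarrow> is_cycle P (Suc i) f"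
    for i f by (simp add: mat_vec_def)
  show ?thesis
    unfolding graded_free_resolution_def aug surj cycle_0 cycle_Suc 1 2[unfolded mat_vec_def] mat_vec_def One_nat_def ..
qed

context
  fixes P :: "('v::finite, 'k::field, 'k) augmented_complex"
  assumes P: "residue_resolution P"
begin

lemma resolution_hmap: "hmap P P (Suc n) n (mat P n)"
  using P unfolding residue_resolution_alt by blast

lemma resolution_exact: "is_cycle P n f \<longleftrightarrow> (\<exists>g. \<forall>a<rank P n. f a = diff_map P n g a)"
  using P unfolding residue_resolution_alt by blast

text \<open>Any preimage can be replaced, coordinate by coordinate, by its component of the right
  degree: the differential is homogeneous, so it carries these components to the component of
  \<open>f\<close>, which is all of \<open>f\<close>.\<close>

lemma resolution_lift:
  assumes "is_cycle P n f" "hvec P n e f"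
  shows "\<exists>g. hvec P (Suc n) e g \<and> (\<forall>a<rank P n. f a = diff_map P n g a)"
proof -
  obtain g where g: "\<forall>a<rank P n. f a = diff_map P n g a"
    using assms(1) resolution_exact by blast
  define h where "h c = hcomp (e - gdeg P (Suc n) c) (g c)" for c
  have "f a = diff_map P n h a" if a: "a < rank P n" for a
  proof -
    have "f a = hcomp (e - gdeg P n a) (f a)"
      using assms(2) a hcomp_of_homogeneous unfolding hvec_def by metis
    also have "\<dots> = (\<Sum>c<rank P (Suc n). hcomp (e - gdeg P n a) (mat P n a c * g c))"
      using g a by (simp add: mat_vec_def hcomp_sum)
    also have "\<dots> = (\<Sum>c<rank P (Suc n). mat P n a c * h c)"
    proof (intro sum.cong refl)
      fix c assume "c \<in> {..<rank P (Suc n)}"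
      then have "mat P n a c \<in> homogeneous (gdeg P (Suc n) c - gdeg P n a)"
        using resolution_hmap a unfolding hmap_def hvec_def by blast
      then show "hcomp (e - gdeg P n a) (mat P n a c * g c) = mat P n a c * h c"
        by (simp add: hcomp_mult h_def)
    qed
    finally show ?thesis by (simp add: mat_vec_def)
  qed
  moreover have "hvec P (Suc n) e h" by (simp add: hvec_def h_def)
  ultimately show ?thesis by blast
qed

text \<open>A map out of a free module is determined by the images of the basis elements, so lifting
  a matrix amounts to lifting each column.\<close>

lemma resolution_lift_columns:
  assumes "\<And>b. b < s \<Longrightarrow> is_cycle P n (\<lambda>a. X a b)" "\<And>b. b < s \<Longrightarrow> hvec P n (e b) (\<lambda>a. X a b)"
  shows "\<exists>Y. \<forall>b<s. hvec P (Suc n) (e b) (\<lambda>c. Y c b) \<and> (\<forall>a<rank P n. X a b = diff_map P n (\<lambda>c. Y c b) a)"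
proof -
  have "\<forall>b. \<exists>g. b < s \<longrightarrow> hvec P (Suc n) (e b) g \<and> (\<forall>a<rank P n. X a b = diff_map P n g a)"
    using resolution_lift assms by meson
  then obtain G where "\<forall>b<s. hvec P (Suc n) (e b) (G b) \<and> (\<forall>a<rank P n. X a b = diff_map P n (G b) a)"
    by metis
  then show ?thesis by (intro exI[of _ "\<lambda>c b. G b c"])
qed

lemma is_cycle_column: "b < rank P (Suc n) \<Longrightarrow> is_cycle P n (\<lambda>a. mat P n a b)"
  unfolding resolution_exact using mat_vec_unit by metis

lemma diff_map_diff_map:
  assumes "a < rank P n"
  shows "diff_map P n (diff_map P (Suc n) f) a = 0"
proof -
  have "is_cycle P (Suc n) (diff_map P (Suc n) f)" unfolding resolution_exact by blast
  then show ?thesis using assms by simp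
qed

end

section \<open>Chain maps covering the identity of the residue field\<close>

definition chain_map :: "('v::finite, 'k::field, 'k) augmented_complex \<Rightarrow> ('v, 'k, 'k) augmented_complex \<Rightarrow>
    (nat \<Rightarrow> nat \<Rightarrow> nat \<Rightarrow> ('v, 'k) polynomial) \<Rightarrow> bool" where
  "chain_map P Q \<phi> \<longleftrightarrow> (\<forall>n. hmap P Q n n (\<phi> n)) \<and>
    (\<forall>n. \<forall>a<rank Q n. \<forall>b<rank P (Suc n).
      diff_map Q n (\<lambda>c. \<phi> (Suc n) c b) a = mat_vec (rank P n) (\<phi> n) (\<lambda>c. mat P n c b) a)"

lemma aug_map_mat_vec:
  assumes "\<And>b. b < rank P 0 \<Longrightarrow> aug_map Q (\<lambda>a. \<Phi> a b) = c * aug P b"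
  shows "aug_map Q (mat_vec (rank P 0) \<Phi> f) = c * aug_map P f"
proof -
  have "aug_map Q (mat_vec (rank P 0) \<Phi> f)
      = (\<Sum>a<rank Q 0. \<Sum>b<rank P 0. Poly_Mapping.lookup (\<Phi> a b) 0 * Poly_Mapping.lookup (f b) 0 * aug Q a)"
    by (simp add: aug_map_def mat_vec_def lookup_sum lookup_0_mult sum_distrib_right)
  also have "\<dots> = (\<Sum>b<rank P 0. Poly_Mapping.lookup (f b) 0 * aug_map Q (\<lambda>a. \<Phi> a b))"
    by (subst sum.swap) (simp add: aug_map_def sum_distrib_left algebra_simps)
  also have "\<dots> = (\<Sum>b<rank P 0. Poly_Mapping.lookup (f b) 0 * (c * aug P b))"
    using assms by (intro sum.cong refl) simp
  also have "\<dots> = c * aug_map P f" by (simp add: aug_map_def sum_distrib_left algebra_simps)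
  finally show ?thesis .
qed

text \<open>Surjectivity of the augmentation of \<open>Q\<close> gives preimages \<open>F b\<close>.
  The augmentation sees only their constant terms, at basis elements of degree 0; discarding
  everything else makes the columns homogeneous, since \<open>aug P b\<close> is nonzero only if
  \<open>b\<close> has degree 0.\<close>

lemma residue_chain_map_0:
  fixes P Q :: "('v::finite, 'k::field, 'k) augmented_complex"
  assumes P: "residue_resolution P" and Q: "residue_resolution Q"
  shows "\<exists>\<Phi>. hmap P Q 0 0 \<Phi> \<and> (\<forall>b<rank P 0. aug_map Q (\<lambda>a. \<Phi> a b) = aug P b)"
proof -
  have "\<forall>b. \<exists>f. aug_map Q f = aug P b" using Q unfolding residue_resolution_alt by blast
  then obtain F where F: "\<And>b. aug_map Q (F b) = aug P b" by metis
  define \<Phi> :: "nat \<Rightarrow> nat \<Rightarrow> ('v, 'k) polynomial" where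
    "\<Phi> a b = (if gdeg Q 0 a \<noteq> 0 \<or> aug P b = 0 then 0 else const_poly (Poly_Mapping.lookup (F b a) 0))" for a b
  have "hmap P Q 0 0 \<Phi>"
    unfolding hmap_def hvec_def
  proof (intro allI impI)
    fix a b assume "a < rank Q 0" "b < rank P 0"
    moreover from this have "gdeg P 0 b = 0" if "aug P b \<noteq> 0"
      using P that unfolding residue_resolution_alt by blast
    ultimately show "\<Phi> a b \<in> homogeneous (gdeg P 0 b - gdeg Q 0 a)"
      by (auto simp: \<Phi>_def const_poly_homogeneous)
  qed
  moreover have "aug_map Q (\<lambda>a. \<Phi> a b) = aug P b" for b
  proof (cases "aug P b = 0")
    case True
    then show ?thesis by (simp add: \<Phi>_def aug_map_def)
  next
    case False
    have "aug_map Q (\<lambda>a. \<Phi> a b) = aug_map Q (F b)"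
      unfolding aug_map_def
    proof (intro sum.cong refl)
      fix a assume "a \<in> {..<rank Q 0}"
      then have "aug Q a = 0" if "gdeg Q 0 a \<noteq> 0"
        using Q that unfolding residue_resolution_alt by blast
      then show "Poly_Mapping.lookup (\<Phi> a b) 0 * aug Q a = Poly_Mapping.lookup (F b a) 0 * aug Q a"
        using False by (auto simp: \<Phi>_def const_poly_def)
    qed
    with F show ?thesis by simp
  qed
  ultimately show ?thesis by blast
qed

lemma residue_chain_map_exists:
  fixes P Q :: "('v::finite, 'k::field, 'k) augmented_complex"
  assumes P: "residue_resolution P" and Q: "residue_resolution Q"
  shows "\<exists>\<phi>. chain_map P Q \<phi> \<and> (\<forall>b<rank P 0. aug_map Q (\<lambda>a. \<phi> 0 a b) = aug P b)"
proof -
  \<comment> \<open>The invariant contains what the next lift requires: the composite of \<Phi> with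
    the incoming differential has cycles as columns. The matrices are chosen dependently because
    each one lifts its predecessor.\<close>
  define good where "good n \<Phi> \<longleftrightarrow> hmap P Q n n \<Phi> \<and>
      (n = 0 \<longrightarrow> (\<forall>b<rank P 0. aug_map Q (\<lambda>a. \<Phi> a b) = aug P b)) \<and>
      (\<forall>b<rank P (Suc n). is_cycle Q n (mat_vec (rank P n) \<Phi> (\<lambda>c. mat P n c b)))" for n \<Phi>
  define comm where "comm n \<Phi> \<Psi> \<longleftrightarrow> (\<forall>a<rank Q n. \<forall>b<rank P (Suc n).
      diff_map Q n (\<lambda>c. \<Psi> c b) a = mat_vec (rank P n) \<Phi> (\<lambda>c. mat P n c b) a)" for n \<Phi> \<Psi>
  have "\<exists>\<phi>. \<forall>n. good n (\<phi> n) \<and> comm n (\<phi> n) (\<phi> (Suc n))"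
  proof (rule dependent_nat_choice)
    obtain \<Phi> where \<Phi>: "hmap P Q 0 0 \<Phi>" "\<And>b. b < rank P 0 \<Longrightarrow> aug_map Q (\<lambda>a. \<Phi> a b) = 1 * aug P b"
      using residue_chain_map_0[OF P Q] by auto
    have "is_cycle Q 0 (mat_vec (rank P 0) \<Phi> (\<lambda>c. mat P 0 c b))" if "b < rank P (Suc 0)" for b
      using aug_map_mat_vec[OF \<Phi>(2)] is_cycle_column[OF P that] by simp
    then show "\<exists>\<Phi>. good 0 \<Phi>" using \<Phi> unfolding good_def by auto
  next
    fix \<Phi> n assume g: "good n \<Phi>"
    have "\<exists>Y. \<forall>b<rank P (Suc n). hvec Q (Suc n) (gdeg P (Suc n) b) (\<lambda>c. Y c b) \<and>
       (\<forall>a<rank Q n. mat_vec (rank P n) \<Phi> (\<lambda>c. mat P n c b) a = diff_map Q n (\<lambda>c. Y c b) a)"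
    proof (rule resolution_lift_columns[OF Q])
      fix b assume b: "b < rank P (Suc n)"
      show "is_cycle Q n (mat_vec (rank P n) \<Phi> (\<lambda>c. mat P n c b))"
        using g b unfolding good_def by blast
      show "hvec Q n (gdeg P (Suc n) b) (mat_vec (rank P n) \<Phi> (\<lambda>c. mat P n c b))"
        using resolution_hmap[OF P, of n] g b hvec_mat_vec unfolding good_def hmap_def by blast
    qed
    then obtain Y where Y: "hmap P Q (Suc n) (Suc n) Y" "comm n \<Phi> Y"
      unfolding hmap_def comm_def by fastforce
    have cyc: "is_cycle Q (Suc n) (mat_vec (rank P (Suc n)) Y (\<lambda>c. mat P (Suc n) c b))"
      if b: "b < rank P (Suc (Suc n))" for b
      unfolding is_cycle.simps
    proof (intro allI impI)
      fix a assume a: "a < rank Q n"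
      have "diff_map Q n (mat_vec (rank P (Suc n)) Y (\<lambda>c. mat P (Suc n) c b)) a
        = mat_vec (rank P (Suc n)) (\<lambda>a c. diff_map Q n (\<lambda>b. Y b c) a) (\<lambda>c. mat P (Suc n) c b) a"
        by (rule mat_vec_assoc)
      also have "\<dots> = mat_vec (rank P (Suc n)) (\<lambda>a c. mat_vec (rank P n) \<Phi> (\<lambda>b. mat P n b c) a) (\<lambda>c. mat P (Suc n) c b) a"
        using Y(2) a unfolding comm_def by (intro mat_vec_cong) auto
      also have "\<dots> = mat_vec (rank P n) \<Phi> (diff_map P n (\<lambda>c. mat P (Suc n) c b)) a"
        by (rule mat_vec_assoc[symmetric])
      also have "\<dots> = 0"
        using is_cycle_column[OF P b] by - (rule mat_vec_zero, auto)
      finally show "diff_map Q n (mat_vec (rank P (Suc n)) Y (\<lambda>c. mat P (Suc n) c b)) a = 0" .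
    qed
    have "good (Suc n) Y"
      unfolding good_def using Y(1) cyc by (intro conjI allI impI) simp_all
    then show "\<exists>\<Psi>. good (Suc n) \<Psi> \<and> comm n \<Phi> \<Psi>"
      using Y(2) by (intro exI conjI)
  qed
  then obtain \<phi> where \<phi>: "\<And>n. good n (\<phi> n)" "\<And>n. comm n (\<phi> n) (\<phi> (Suc n))" by blast
  have "chain_map P Q \<phi>"
    unfolding chain_map_def
    using \<phi>(1)[unfolded good_def, THEN conjunct1] \<phi>(2)[unfolded comm_def] by (intro conjI allI) blast+
  moreover have "\<forall>b<rank P 0. aug_map Q (\<lambda>a. \<phi> 0 a b) = aug P b"
    using \<phi>(1)[of 0] unfolding good_def by (elim conjE) simp
  ultimately show ?thesis by blast
qed

text \<open>The homotopy identity is recorded in positive homological degrees, which are those in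
  which Betti numbers are computed below.\<close>

definition null_homotopy where
  "null_homotopy P Q \<phi> s \<longleftrightarrow> (\<forall>n. hmap P Q n (Suc n) (s n)) \<and>
    (\<forall>n. \<forall>a<rank Q (Suc n). \<forall>b<rank P (Suc n). \<phi> (Suc n) a b =
      diff_map Q (Suc n) (\<lambda>c. s (Suc n) c b) a + mat_vec (rank P n) (s n) (\<lambda>c. mat P n c b) a)"

lemma null_homotopy_exists:
  fixes P Q :: "('v::finite, 'k::field, 'k) augmented_complex"
  assumes P: "residue_resolution P" and Q: "residue_resolution Q"
    and \<phi>: "chain_map P Q \<phi>" and zero: "\<And>b. b < rank P 0 \<Longrightarrow> aug_map Q (\<lambda>a. \<phi> 0 a b) = 0"
  shows "\<exists>s. null_homotopy P Q \<phi> s"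
proof -
  \<comment> \<open>\<open>X\<close> is the defect \<phi> - s d in degree n + 1, and the next stage
    of the homotopy is a lift of it. It is a cycle: d \<phi> = \<phi> d, and \<phi> = d s + s d one
    degree lower (with only d s in degree 0), so only a term containing d d is left.\<close>
  define X where "X n s a b = \<phi> (Suc n) a b - mat_vec (rank P n) s (\<lambda>c. mat P n c b) a" for n s a b
  define good where "good n s \<longleftrightarrow> hmap P Q n (Suc n) s \<and>
      (\<forall>b<rank P (Suc n). is_cycle Q (Suc n) (\<lambda>a. X n s a b))" for n s
  define rel where "rel n s t \<longleftrightarrow> (\<forall>a<rank Q (Suc n). \<forall>b<rank P (Suc n).
      X n s a b = diff_map Q (Suc n) (\<lambda>c. t c b) a)" for n s t
  have \<phi>hom: "hmap P Q n n (\<phi> n)" for n using \<phi> unfolding chain_map_def by blast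
  have \<phi>comm: "diff_map Q n (\<lambda>c. \<phi> (Suc n) c b) a = mat_vec (rank P n) (\<phi> n) (\<lambda>c. mat P n c b) a"
    if "a < rank Q n" "b < rank P (Suc n)" for n a b using \<phi> that unfolding chain_map_def by blast
  have dX: "diff_map Q n (\<lambda>a. X n s a b) a
      = mat_vec (rank P n) (\<lambda>a c. \<phi> n a c - diff_map Q n (\<lambda>b. s b c) a) (\<lambda>c. mat P n c b) a"
    if "a < rank Q n" "b < rank P (Suc n)" for n s a b
    unfolding X_def mat_vec_diff mat_vec_diff_left \<phi>comm[OF that]
    by (simp add: mat_vec_assoc)
  have "\<exists>s. \<forall>n. good n (s n) \<and> rel n (s n) (s (Suc n))"
  proof (rule dependent_nat_choice)
    have "\<exists>Y. \<forall>b<rank P 0. hvec Q (Suc 0) (gdeg P 0 b) (\<lambda>c. Y c b) \<and>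
       (\<forall>a<rank Q 0. \<phi> 0 a b = diff_map Q 0 (\<lambda>c. Y c b) a)"
      using zero \<phi>hom[of 0] unfolding hmap_def
      by (intro resolution_lift_columns[OF Q]) auto
    then obtain Y where Y: "hmap P Q 0 (Suc 0) Y"
       "\<And>a b. b < rank P 0 \<Longrightarrow> a < rank Q 0 \<Longrightarrow> \<phi> 0 a b = diff_map Q 0 (\<lambda>c. Y c b) a"
      unfolding hmap_def by blast
    have "diff_map Q 0 (\<lambda>a. X 0 Y a b) a = 0" if "a < rank Q 0" "b < rank P (Suc 0)" for a b
      unfolding dX[OF that] using Y(2) that by (simp add: mat_vec_def)
    then show "\<exists>s. good 0 s" using Y(1) unfolding good_def by auto
  next
    fix s n assume g: "good n s"
    have "\<exists>Y. \<forall>b<rank P (Suc n). hvec Q (Suc (Suc n)) (gdeg P (Suc n) b) (\<lambda>c. Y c b) \<and>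
       (\<forall>a<rank Q (Suc n). X n s a b = diff_map Q (Suc n) (\<lambda>c. Y c b) a)"
    proof (rule resolution_lift_columns[OF Q])
      fix b assume b: "b < rank P (Suc n)"
      show "is_cycle Q (Suc n) (\<lambda>a. X n s a b)"
        using g b unfolding good_def by blast
      show "hvec Q (Suc n) (gdeg P (Suc n) b) (\<lambda>a. X n s a b)"
        unfolding X_def
        using \<phi>hom[of "Suc n"] resolution_hmap[OF P, of n] g b hvec_mat_vec
        unfolding good_def hmap_def by (intro hvec_diff) blast+
    qed
    then obtain Y where Y: "hmap P Q (Suc n) (Suc (Suc n)) Y" "rel n s Y"
      unfolding hmap_def rel_def by fastforce
    have "diff_map Q (Suc n) (\<lambda>a. X (Suc n) Y a b) a = 0"
      if ab: "a < rank Q (Suc n)" "b < rank P (Suc (Suc n))" for a b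
    proof -
      have "diff_map Q (Suc n) (\<lambda>a. X (Suc n) Y a b) a =
        mat_vec (rank P (Suc n)) (\<lambda>a c. mat_vec (rank P n) s (\<lambda>b. mat P n b c) a) (\<lambda>c. mat P (Suc n) c b) a"
        unfolding dX[OF ab]
      proof (intro mat_vec_cong refl)
        fix c assume "c < rank P (Suc n)"
        then have "X n s a c = diff_map Q (Suc n) (\<lambda>b. Y b c) a"
          using Y(2) ab(1) unfolding rel_def by blast
        then show "\<phi> (Suc n) a c - diff_map Q (Suc n) (\<lambda>b. Y b c) a = mat_vec (rank P n) s (\<lambda>b. mat P n b c) a"
          unfolding X_def by (simp add: algebra_simps)
      qed
      also have "\<dots> = mat_vec (rank P n) s (diff_map P n (\<lambda>c. mat P (Suc n) c b)) a"
        by (rule mat_vec_assoc[symmetric])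
      also have "\<dots> = 0"
        using is_cycle_column[OF P ab(2)] by - (rule mat_vec_zero, auto)
      finally show ?thesis .
    qed
    then have "good (Suc n) Y"
      unfolding good_def using Y(1) by (intro conjI allI impI) simp_all
    then show "\<exists>t. good (Suc n) t \<and> rel n s t"
      using Y(2) by (intro exI conjI)
  qed
  then obtain s where s: "\<And>n. good n (s n)" "\<And>n. rel n (s n) (s (Suc n))" by blast
  have "null_homotopy P Q \<phi> s"
    unfolding null_homotopy_def
  proof (intro conjI allI impI)
    show "hmap P Q n (Suc n) (s n)" for n using s(1) unfolding good_def by blast
    fix n a b assume "a < rank Q (Suc n)" "b < rank P (Suc n)"
    then have "X n (s n) a b = diff_map Q (Suc n) (\<lambda>c. s (Suc n) c b) a"
      using s(2) unfolding rel_def by blast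
    then show "\<phi> (Suc n) a b =
      diff_map Q (Suc n) (\<lambda>c. s (Suc n) c b) a + mat_vec (rank P n) (s n) (\<lambda>c. mat P n c b) a"
      unfolding X_def by (simp add: algebra_simps)
  qed
  then show ?thesis by blast
qed


section \<open>Betti numbers from an arbitrary resolution\<close>

lemma tensor_chains_quotient_ring:
  "z \<in> tensor_chains P (quotient_ring I) i j \<longleftrightarrow> hvec P i j z \<and> (\<forall>a\<ge>rank P i. z a = 0)"
  unfolding tensor_chains_def quotient_ring_def hvec_def by (auto simp: not_less)

lemma tensor_diff_quotient_ring:
  "tensor_diff P (quotient_ring I) i z a = (if a < rank P i then diff_map P i z a else 0)"
  by (simp add: tensor_diff_def quotient_ring_def mat_vec_def)

lemma rel_quotient_ring: "rel (quotient_ring I) = I"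
  by (simp add: quotient_ring_def)

abbreviation cscale :: "'k::field \<Rightarrow> (nat \<Rightarrow> ('v, 'k) polynomial) \<Rightarrow> nat \<Rightarrow> ('v, 'k) polynomial" where
  "cscale c z \<equiv> (\<lambda>a. const_poly c * z a)"

lemma hvec_add: "hvec P n j f \<Longrightarrow> hvec P n j g \<Longrightarrow> hvec P n j (f + g)"
  by (simp add: hvec_def homogeneous_add)

lemma hvec_cscale: "hvec P n j f \<Longrightarrow> hvec P n j (cscale c f)"
  for f :: "nat \<Rightarrow> ('v::finite, 'k::field) polynomial"
  using homogeneous_mult[OF const_poly_homogeneous] by (fastforce simp: hvec_def)

text \<open>The coordinates beyond the target rank are set to 0 because \<open>tensor_chains\<close>
  demands it.\<close>

definition tensor_map :: "nat \<Rightarrow> nat \<Rightarrow> (nat \<Rightarrow> nat \<Rightarrow> ('v, 'k::field) polynomial) \<Rightarrow> (nat \<Rightarrow> ('v, 'k) polynomial) \<Rightarrow>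
    nat \<Rightarrow> ('v, 'k) polynomial" where
  "tensor_map s r \<Phi> z a = (if a < s then mat_vec r \<Phi> z a else 0)"

context
  fixes I :: "('v::finite, 'k::field) polynomial set" and X
  assumes I: "I = ideal_generated X"
begin

lemma zero_in_ideal: "0 \<in> I"
  unfolding I by (rule ideal_generated_0)

lemma add_in_ideal: "p \<in> I \<Longrightarrow> q \<in> I \<Longrightarrow> p + q \<in> I"
  unfolding I by (rule ideal_generated_add)

lemma mult_in_ideal: "q \<in> I \<Longrightarrow> p * q \<in> I"
  unfolding I by (rule ideal_generated_mult)

lemma tensor_cycles_quotient_ring:
  "z \<in> tensor_cycles P (quotient_ring I) (Suc n) j \<longleftrightarrow>
    z \<in> tensor_chains P (quotient_ring I) (Suc n) j \<and> (\<forall>a<rank P n. diff_map P n z a \<in> I)"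
  by (auto simp: tensor_cycles_def tensor_diff_quotient_ring rel_quotient_ring zero_in_ideal)

lemma tensor_boundaries_quotient_ring:
  "z \<in> tensor_boundaries P (quotient_ring I) n j \<longleftrightarrow>
    z \<in> tensor_chains P (quotient_ring I) n j \<and>
    (\<exists>w\<in>tensor_chains P (quotient_ring I) (Suc n) j. \<forall>a<rank P n. z a - diff_map P n w a \<in> I)"
proof -
  have "(\<forall>a. z a - tensor_diff P (quotient_ring I) n w a \<in> rel (quotient_ring I)) \<longleftrightarrow>
      (\<forall>a<rank P n. z a - diff_map P n w a \<in> I)"
    if "z \<in> tensor_chains P (quotient_ring I) n j" for w
    using that
    by (auto simp: tensor_diff_quotient_ring rel_quotient_ring zero_in_ideal tensor_chains_quotient_ring)
  then show ?thesis by (auto simp: tensor_boundaries_def)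
qed

lemma mat_vec_ideal: "(\<And>b. b < r \<Longrightarrow> f b \<in> I) \<Longrightarrow> mat_vec r A f a \<in> I"
  unfolding mat_vec_def I by (intro ideal_generated_sum ideal_generated_mult) auto

interpretation cs: vector_space cscale by (rule vector_space_const_poly)

lemma subspace_chains: "cs.subspace (tensor_chains P (quotient_ring I) n j)"
proof (rule cs.subspaceI)
  show "0 \<in> tensor_chains P (quotient_ring I) n j"
    by (simp add: tensor_chains_quotient_ring hvec_def)
qed (simp_all add: tensor_chains_quotient_ring hvec_add hvec_cscale)

lemma subspace_cycles: "cs.subspace (tensor_cycles P (quotient_ring I) (Suc n) j)"
proof (rule cs.subspaceI)
  show "0 \<in> tensor_cycles P (quotient_ring I) (Suc n) j"
    using cs.subspace_0[OF subspace_chains]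
    by (simp add: tensor_cycles_quotient_ring mat_vec_def zero_in_ideal)
next
  fix x y assume "x \<in> tensor_cycles P (quotient_ring I) (Suc n) j" "y \<in> tensor_cycles P (quotient_ring I) (Suc n) j"
  then show "x + y \<in> tensor_cycles P (quotient_ring I) (Suc n) j"
    using cs.subspace_add[OF subspace_chains, of x P "Suc n" j y] add_in_ideal
    by (simp add: tensor_cycles_quotient_ring mat_vec_add plus_fun_def)
next
  fix c x assume "x \<in> tensor_cycles P (quotient_ring I) (Suc n) j"
  then show "cscale c x \<in> tensor_cycles P (quotient_ring I) (Suc n) j"
    using cs.subspace_scale[OF subspace_chains, of x P "Suc n" j c] mult_in_ideal
    by (simp add: tensor_cycles_quotient_ring mat_vec_scale)
qed

lemma subspace_boundaries: "cs.subspace (tensor_boundaries P (quotient_ring I) n j)"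
proof (rule cs.subspaceI)
  have "0 \<in> tensor_chains P (quotient_ring I) (Suc n) j"
    using cs.subspace_0[OF subspace_chains] .
  then show "0 \<in> tensor_boundaries P (quotient_ring I) n j"
    using cs.subspace_0[OF subspace_chains]
    unfolding tensor_boundaries_quotient_ring
    by (intro conjI bexI[of _ 0]) (simp_all add: mat_vec_def zero_in_ideal)
next
  fix x y assume "x \<in> tensor_boundaries P (quotient_ring I) n j" "y \<in> tensor_boundaries P (quotient_ring I) n j"
  then obtain v w where
    v: "x \<in> tensor_chains P (quotient_ring I) n j" "v \<in> tensor_chains P (quotient_ring I) (Suc n) j"
      "\<forall>a<rank P n. x a - diff_map P n v a \<in> I" and
    w: "y \<in> tensor_chains P (quotient_ring I) n j" "w \<in> tensor_chains P (quotient_ring I) (Suc n) j"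
      "\<forall>a<rank P n. y a - diff_map P n w a \<in> I"
    unfolding tensor_boundaries_quotient_ring by blast
  have "(x + y) a - diff_map P n (v + w) a \<in> I" if "a < rank P n" for a
  proof -
    have "(x a - diff_map P n v a) + (y a - diff_map P n w a) \<in> I"
      using v(3) w(3) that add_in_ideal by blast
    then show ?thesis by (simp add: plus_fun_def mat_vec_add algebra_simps)
  qed
  then show "x + y \<in> tensor_boundaries P (quotient_ring I) n j"
    unfolding tensor_boundaries_quotient_ring
    using cs.subspace_add[OF subspace_chains] v(1,2) w(1,2) by blast
next
  fix c x assume "x \<in> tensor_boundaries P (quotient_ring I) n j"
  then obtain v where
    v: "x \<in> tensor_chains P (quotient_ring I) n j" "v \<in> tensor_chains P (quotient_ring I) (Suc n) j"
      "\<forall>a<rank P n. x a - diff_map P n v a \<in> I"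
    unfolding tensor_boundaries_quotient_ring by blast
  have "cscale c x a - diff_map P n (cscale c v) a \<in> I" if "a < rank P n" for a
  proof -
    have "const_poly c * (x a - diff_map P n v a) \<in> I"
      using v(3) that mult_in_ideal by blast
    then show ?thesis by (simp add: mat_vec_scale right_diff_distrib)
  qed
  then show "cscale c x \<in> tensor_boundaries P (quotient_ring I) n j"
    unfolding tensor_boundaries_quotient_ring
    using cs.subspace_scale[OF subspace_chains] v(1,2) by blast
qed

lemma linear_tensor_map: "Vector_Spaces.linear cscale cscale (tensor_map s r \<Phi>)"
  unfolding Vector_Spaces.linear_def module_hom_def module_hom_axioms_def module_iff_vector_space
  using cs.vector_space_axioms
  by (auto simp: tensor_map_def fun_eq_iff mat_vec_add plus_fun_def mat_vec_scale)

lemma tensor_map_chains: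
  fixes P Q :: "('v, 'k, 'k) augmented_complex"
  assumes "hmap P Q n k \<Phi>" "z \<in> tensor_chains P (quotient_ring I) n j"
  shows "tensor_map (rank Q k) (rank P n) \<Phi> z \<in> tensor_chains Q (quotient_ring I) k j"
  using hvec_mat_vec[OF assms(1)] assms(2)
  unfolding tensor_chains_quotient_ring by (auto simp: tensor_map_def hvec_def)

lemma mat_vec_tensor_map: "mat_vec s A (tensor_map s r \<Phi> z) a = mat_vec s A (mat_vec r \<Phi> z) a"
  by (intro mat_vec_cong) (auto simp: tensor_map_def)

context
  fixes P Q :: "('v, 'k, 'k) augmented_complex" and \<phi>
  assumes \<phi>: "chain_map P Q \<phi>"
begin

lemma chain_map_commute:
  assumes "a < rank Q n"
  shows "diff_map Q n (mat_vec (rank P (Suc n)) (\<phi> (Suc n)) z) a = mat_vec (rank P n) (\<phi> n) (diff_map P n z) a"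
  unfolding mat_vec_assoc
  using \<phi> assms unfolding chain_map_def by (intro mat_vec_cong) auto

lemma chain_map_cycles:
  "tensor_map (rank Q (Suc n)) (rank P (Suc n)) (\<phi> (Suc n)) ` tensor_cycles P (quotient_ring I) (Suc n) j
    \<subseteq> tensor_cycles Q (quotient_ring I) (Suc n) j"
proof (intro image_subsetI)
  fix z assume z: "z \<in> tensor_cycles P (quotient_ring I) (Suc n) j"
  have "hmap P Q (Suc n) (Suc n) (\<phi> (Suc n))" using \<phi> unfolding chain_map_def by blast
  then show "tensor_map (rank Q (Suc n)) (rank P (Suc n)) (\<phi> (Suc n)) z \<in> tensor_cycles Q (quotient_ring I) (Suc n) j"
    using z unfolding tensor_cycles_quotient_ring
    by (auto intro: tensor_map_chains mat_vec_ideal simp: mat_vec_tensor_map chain_map_commute)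
qed

lemma chain_map_boundaries:
  "tensor_map (rank Q n) (rank P n) (\<phi> n) ` tensor_boundaries P (quotient_ring I) n j
    \<subseteq> tensor_boundaries Q (quotient_ring I) n j"
proof (intro image_subsetI)
  fix z assume "z \<in> tensor_boundaries P (quotient_ring I) n j"
  then obtain w where w: "z \<in> tensor_chains P (quotient_ring I) n j"
    "w \<in> tensor_chains P (quotient_ring I) (Suc n) j" "\<forall>a<rank P n. z a - diff_map P n w a \<in> I"
    unfolding tensor_boundaries_quotient_ring by blast
  have h: "hmap P Q n n (\<phi> n)" for n using \<phi> unfolding chain_map_def by blast
  let ?w = "tensor_map (rank Q (Suc n)) (rank P (Suc n)) (\<phi> (Suc n)) w"
  have "tensor_map (rank Q n) (rank P n) (\<phi> n) z a - diff_map Q n ?w a \<in> I" if a: "a < rank Q n" for a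
  proof -
    have "mat_vec (rank P n) (\<phi> n) (\<lambda>b. z b - diff_map P n w b) a \<in> I"
      using w(3) by (intro mat_vec_ideal) auto
    then show ?thesis
      using a by (simp add: mat_vec_tensor_map chain_map_commute mat_vec_diff tensor_map_def)
  qed
  then show "tensor_map (rank Q n) (rank P n) (\<phi> n) z \<in> tensor_boundaries Q (quotient_ring I) n j"
    unfolding tensor_boundaries_quotient_ring
    using tensor_map_chains[OF h w(1)] tensor_map_chains[OF h w(2)] by blast
qed

text \<open>In \<phi> z = d (s z) + s (d z) the last term vanishes modulo I: \<open>z\<close> is a
  cycle modulo I, so d z has entries in I, and I is closed under multiplication by the entries of
  \<open>s\<close>.\<close>

lemma null_homotopy_boundaries:
  assumes s: "null_homotopy P Q \<phi> s" and z: "z \<in> tensor_cycles P (quotient_ring I) (Suc n) j"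
  shows "tensor_map (rank Q (Suc n)) (rank P (Suc n)) (\<phi> (Suc n)) z \<in> tensor_boundaries Q (quotient_ring I) (Suc n) j"
proof -
  have zc: "z \<in> tensor_chains P (quotient_ring I) (Suc n) j" and zI: "\<forall>a<rank P n. diff_map P n z a \<in> I"
    using z unfolding tensor_cycles_quotient_ring by auto
  have h: "hmap P Q (Suc n) (Suc n) (\<phi> (Suc n))" using \<phi> unfolding chain_map_def by blast
  have hs: "hmap P Q (Suc n) (Suc (Suc n)) (s (Suc n))" using s unfolding null_homotopy_def by blast
  let ?w = "tensor_map (rank Q (Suc (Suc n))) (rank P (Suc n)) (s (Suc n)) z"
  have "tensor_map (rank Q (Suc n)) (rank P (Suc n)) (\<phi> (Suc n)) z a - diff_map Q (Suc n) ?w a \<in> I"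
    if a: "a < rank Q (Suc n)" for a
  proof -
    have "mat_vec (rank P (Suc n)) (\<phi> (Suc n)) z a = mat_vec (rank P (Suc n)) (\<lambda>a b.
        diff_map Q (Suc n) (\<lambda>c. s (Suc n) c b) a + mat_vec (rank P n) (s n) (\<lambda>c. mat P n c b) a) z a"
      using s a unfolding null_homotopy_def by (intro mat_vec_cong) auto
    also have "\<dots> = diff_map Q (Suc n) (mat_vec (rank P (Suc n)) (s (Suc n)) z) a
        + mat_vec (rank P n) (s n) (diff_map P n z) a"
      by (simp add: mat_vec_add_left mat_vec_assoc)
    finally have "tensor_map (rank Q (Suc n)) (rank P (Suc n)) (\<phi> (Suc n)) z a - diff_map Q (Suc n) ?w a
        = mat_vec (rank P n) (s n) (diff_map P n z) a"
      using a by (simp add: mat_vec_tensor_map) (simp add: tensor_map_def)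
    also have "\<dots> \<in> I" by (rule mat_vec_ideal) (use zI in blast)
    finally show ?thesis .
  qed
  then show ?thesis
    unfolding tensor_boundaries_quotient_ring
    using tensor_map_chains[OF h zc] tensor_map_chains[OF hs zc] by blast
qed

end

text \<open>If \<phi> and \<psi> respect the augmentations, then this chain map augments to zero and
  is null homotopic. That is how \<phi> and \<psi> become mutually inverse on homology.\<close>

lemma chain_map_comp_minus_id:
  fixes P Q :: "('v, 'k, 'k) augmented_complex"
  assumes \<phi>: "chain_map P Q \<phi>" and \<psi>: "chain_map Q P \<psi>"
  shows "chain_map P P (\<lambda>n a b. mat_vec (rank Q n) (\<psi> n) (\<lambda>c. \<phi> n c b) a - (if a = b then 1 else 0))"
    (is "chain_map P P ?\<chi>")
proof -
  have "hmap P P n n (\<lambda>a c. mat_vec (rank Q n) (\<psi> n) (\<lambda>b. \<phi> n b c) a)" for n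
    using \<phi> \<psi> hmap_comp unfolding chain_map_def by blast
  moreover have "hvec P n (gdeg P n b) (\<lambda>a. if a = b then 1 else 0)" for n b
    using homogeneous_single[OF mdeg_0, of "1 :: 'k"] by (auto simp: hvec_def)
  ultimately have 1: "hmap P P n n (?\<chi> n)" for n
    unfolding hmap_def by (auto intro: hvec_diff)
  have 2: "diff_map P n (\<lambda>c. ?\<chi> (Suc n) c b) a = mat_vec (rank P n) (?\<chi> n) (\<lambda>c. mat P n c b) a"
    if a: "a < rank P n" and b: "b < rank P (Suc n)" for n a b
  proof -
    have "diff_map P n (\<lambda>c. mat_vec (rank Q (Suc n)) (\<psi> (Suc n)) (\<lambda>d. \<phi> (Suc n) d b) c) a
      = mat_vec (rank Q n) (\<psi> n) (diff_map Q n (\<lambda>d. \<phi> (Suc n) d b)) a"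
      using chain_map_commute[OF \<psi> a] .
    also have "\<dots> = mat_vec (rank Q n) (\<psi> n) (mat_vec (rank P n) (\<phi> n) (\<lambda>c. mat P n c b)) a"
      using \<phi> b unfolding chain_map_def by (intro mat_vec_cong) auto
    finally show ?thesis
      using a b unfolding mat_vec_diff mat_vec_diff_left
      by (simp add: mat_vec_id mat_vec_unit mat_vec_assoc)
  qed
  show ?thesis unfolding chain_map_def using 1 2 by blast
qed

lemma chain_map_homotopy_inverse:
  fixes P Q :: "('v, 'k, 'k) augmented_complex"
  assumes P: "residue_resolution P"
    and \<phi>: "chain_map P Q \<phi>" "\<And>b. b < rank P 0 \<Longrightarrow> aug_map Q (\<lambda>a. \<phi> 0 a b) = aug P b"
    and \<psi>: "chain_map Q P \<psi>" "\<And>b. b < rank Q 0 \<Longrightarrow> aug_map P (\<lambda>a. \<psi> 0 a b) = aug Q b"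
    and z: "z \<in> tensor_cycles P (quotient_ring I) (Suc n) j"
  shows "tensor_map (rank P (Suc n)) (rank Q (Suc n)) (\<psi> (Suc n))
      (tensor_map (rank Q (Suc n)) (rank P (Suc n)) (\<phi> (Suc n)) z) - z
    \<in> tensor_boundaries P (quotient_ring I) (Suc n) j"
proof -
  let ?\<chi> = "\<lambda>n a b. mat_vec (rank Q n) (\<psi> n) (\<lambda>c. \<phi> n c b) a - (if a = b then 1 else 0)"
  have "aug_map P (\<lambda>a. ?\<chi> 0 a b) = 0" if b: "b < rank P 0" for b
  proof -
    have "aug_map P (\<lambda>a. ?\<chi> 0 a b) = aug_map P (mat_vec (rank Q 0) (\<psi> 0) (\<lambda>c. \<phi> 0 c b)) -
        aug_map P (\<lambda>a. if a = b then 1 else 0)"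
      by (simp add: aug_map_def lookup_minus left_diff_distrib sum_subtractf)
    also have "aug_map P (mat_vec (rank Q 0) (\<psi> 0) (\<lambda>c. \<phi> 0 c b)) = aug P b"
      using aug_map_mat_vec[where P=Q and Q=P and c=1 and \<Phi>="\<psi> 0"] \<psi>(2) \<phi>(2) b by simp
    also have "aug_map P (\<lambda>a. if a = b then 1 else 0) = (\<Sum>a<rank P 0. if a = b then aug P a else 0)"
      unfolding aug_map_def by (intro sum.cong) auto
    also have "\<dots> = aug P b" using b by simp
    finally show ?thesis by simp
  qed
  then obtain s where s: "null_homotopy P P ?\<chi> s"
    using null_homotopy_exists[OF P P chain_map_comp_minus_id[OF \<phi>(1) \<psi>(1)]] by blast
  \<comment> \<open>\<open>tensor_map\<close> truncates, so the identity matrix acts as the identity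
    only on vectors vanishing beyond the rank.\<close>
  have z0: "\<forall>a\<ge>rank P (Suc n). z a = 0"
    using z unfolding tensor_cycles_quotient_ring tensor_chains_quotient_ring by blast
  have "tensor_map (rank P (Suc n)) (rank P (Suc n)) (?\<chi> (Suc n)) z =
    tensor_map (rank P (Suc n)) (rank Q (Suc n)) (\<psi> (Suc n))
      (tensor_map (rank Q (Suc n)) (rank P (Suc n)) (\<phi> (Suc n)) z) - z"
  proof
    fix a
    show "tensor_map (rank P (Suc n)) (rank P (Suc n)) (?\<chi> (Suc n)) z a =
    (tensor_map (rank P (Suc n)) (rank Q (Suc n)) (\<psi> (Suc n))
      (tensor_map (rank Q (Suc n)) (rank P (Suc n)) (\<phi> (Suc n)) z) - z) a"
    proof (cases "a < rank P (Suc n)")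
      case True
      have "mat_vec (rank P (Suc n)) (?\<chi> (Suc n)) z a
        = mat_vec (rank Q (Suc n)) (\<psi> (Suc n)) (mat_vec (rank P (Suc n)) (\<phi> (Suc n)) z) a - z a"
        unfolding mat_vec_diff_left using True by (simp add: mat_vec_id mat_vec_assoc)
      then show ?thesis
        using True unfolding fun_diff_def tensor_map_def[of "rank P (Suc n)"] mat_vec_tensor_map by simp
    qed (use z0 in \<open>simp add: tensor_map_def not_less\<close>)
  qed
  then show ?thesis
    using null_homotopy_boundaries[OF chain_map_comp_minus_id[OF \<phi>(1) \<psi>(1)] s z] by simp
qed

text \<open>The resolution \<open>P\<close> selected in \<open>tor_dim\<close> is a resolution
  because \<open>Q\<close> witnesses that there is one. Comparison maps in both directions then
  carry the basis from \<open>Q\<close> to \<open>P\<close>.\<close>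

theorem graded_betti_eq_card:
  fixes Q :: "('v, 'k, 'k) augmented_complex"
  assumes Q: "residue_resolution Q" and S: "finite S"
    "quotient_basis cscale (tensor_cycles Q (quotient_ring I) (Suc n) j)
      (tensor_boundaries Q (quotient_ring I) (Suc n) j) S"
  shows "graded_betti (quotient_ring I) (Suc n) j = card S"
proof -
  define P where "P = (SOME P :: ('v, 'k, 'k) augmented_complex. residue_resolution P)"
  have P: "residue_resolution P" unfolding P_def using Q by (rule someI)
  obtain \<phi> where \<phi>: "chain_map P Q \<phi>" "\<And>b. b < rank P 0 \<Longrightarrow> aug_map Q (\<lambda>a. \<phi> 0 a b) = aug P b"
    using residue_chain_map_exists[OF P Q] by blast
  obtain \<psi> where \<psi>: "chain_map Q P \<psi>" "\<And>b. b < rank Q 0 \<Longrightarrow> aug_map P (\<lambda>a. \<psi> 0 a b) = aug Q b"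
    using residue_chain_map_exists[OF Q P] by blast
  have "quotient_dim cscale (tensor_cycles P (quotient_ring I) (Suc n) j)
      (tensor_boundaries P (quotient_ring I) (Suc n) j) = card S"
  proof (rule cs.quotient_dim_transport[OF subspace_boundaries subspace_boundaries subspace_cycles S(2,1)
        linear_tensor_map linear_tensor_map])
    show "tensor_map (rank P (Suc n)) (rank Q (Suc n)) (\<psi> (Suc n)) ` tensor_cycles Q (quotient_ring I) (Suc n) j
        \<subseteq> tensor_cycles P (quotient_ring I) (Suc n) j"
      by (rule chain_map_cycles[OF \<psi>(1)])
    show "tensor_map (rank P (Suc n)) (rank Q (Suc n)) (\<psi> (Suc n)) ` tensor_boundaries Q (quotient_ring I) (Suc n) j
        \<subseteq> tensor_boundaries P (quotient_ring I) (Suc n) j"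
      by (rule chain_map_boundaries[OF \<psi>(1)])
    show "tensor_map (rank Q (Suc n)) (rank P (Suc n)) (\<phi> (Suc n)) ` tensor_cycles P (quotient_ring I) (Suc n) j
        \<subseteq> tensor_cycles Q (quotient_ring I) (Suc n) j"
      by (rule chain_map_cycles[OF \<phi>(1)])
    show "tensor_map (rank Q (Suc n)) (rank P (Suc n)) (\<phi> (Suc n)) ` tensor_boundaries P (quotient_ring I) (Suc n) j
        \<subseteq> tensor_boundaries Q (quotient_ring I) (Suc n) j"
      by (rule chain_map_boundaries[OF \<phi>(1)])
  qed (use chain_map_homotopy_inverse[OF P \<phi> \<psi>] chain_map_homotopy_inverse[OF Q \<psi> \<phi>] in auto)
  then show ?thesis
    unfolding graded_betti_def tor_dim_def P_def by (simp add: quotient_ring_def)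
qed

end


section \<open>The Koszul complex\<close>

text \<open>The sign of moving e_v past the smaller factors of e_T in the exterior algebra. The
  vertex type carries no order of its own, so the order is pulled back along
  \<open>to_nat\<close>.\<close>

definition ksign :: "'v::finite \<Rightarrow> 'v set \<Rightarrow> 'k::field" where
  "ksign v T = (-1) ^ card {t \<in> T. to_nat t < to_nat v}"

lemma ksign_insert_less:
  assumes "v \<notin> T" "to_nat v < to_nat w"
  shows "ksign w (insert v T) = - ksign w T"
proof -
  have "{t \<in> insert v T. to_nat t < to_nat w} = insert v {t \<in> T. to_nat t < to_nat w}"
    using assms by auto
  then show ?thesis using assms by (simp add: ksign_def)
qed

lemma ksign_insert_greater:
  assumes "to_nat w < to_nat v"
  shows "ksign w (insert v T) = ksign w T"
proof -
  have "{t \<in> insert v T. to_nat t < to_nat w} = {t \<in> T. to_nat t < to_nat w}"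
    using assms by auto
  then show ?thesis by (simp add: ksign_def)
qed

lemma ksign_nonzero: "ksign v T \<noteq> 0"
  by (simp add: ksign_def)

text \<open>Inserting the smaller of the two vertices flips the sign of the greater one, while
  inserting the greater one changes nothing. Hence the two products are opposite.\<close>

lemma ksign_swap:
  assumes "v \<noteq> w" "v \<notin> T" "w \<notin> T"
  shows "ksign v T * ksign w (insert v T) + ksign w T * ksign v (insert w T) = (0 :: 'k::field)"
proof -
  have "to_nat v \<noteq> to_nat w" using assms(1) by simp
  then consider "to_nat v < to_nat w" | "to_nat w < to_nat v" by linarith
  then show ?thesis
    using assms by cases (simp_all add: ksign_insert_less ksign_insert_greater)
qed

text \<open>A chain is given by its coefficients at all e_S simultaneously, without fixing the
  cardinality of \<open>S\<close>. The value at \<open>T\<close> collects the faces having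
  \<open>T\<close> as a codimension one face.\<close>

definition koszul_diff :: "('v::finite set \<Rightarrow> ('v, 'k::field) polynomial) \<Rightarrow> 'v set \<Rightarrow> ('v, 'k) polynomial" where
  "koszul_diff f T = (\<Sum>v\<in>-T. const_poly (ksign v T) * (var v * f (insert v T)))"

lemma koszul_diff_cong:
  "(\<And>v. v \<notin> T \<Longrightarrow> f (insert v T) = g (insert v T)) \<Longrightarrow> koszul_diff f T = koszul_diff g T"
  unfolding koszul_diff_def by (intro sum.cong) auto

lemma koszul_diff_diff: "koszul_diff (\<lambda>S. f S - g S) T = koszul_diff f T - koszul_diff g T"
  by (simp add: koszul_diff_def right_diff_distrib sum_subtractf)

lemma koszul_diff_sum: "koszul_diff (\<lambda>S. \<Sum>x\<in>X. f x S) T = (\<Sum>x\<in>X. koszul_diff (f x) T)"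
  unfolding koszul_diff_def sum_distrib_left by (rule sum.swap)

lemma koszul_diff_scale: "koszul_diff (\<lambda>S. const_poly c * f S) T = const_poly c * koszul_diff f T"
  by (simp add: koszul_diff_def sum_distrib_left mult.left_commute)

lemma lookup_koszul_diff:
  "Poly_Mapping.lookup (koszul_diff f T) b = (\<Sum>v\<in>-T. ksign v T *
    (if Poly_Mapping.lookup b v = 0 then 0 else Poly_Mapping.lookup (f (insert v T)) (b - Poly_Mapping.single v 1)))"
  by (simp add: koszul_diff_def lookup_sum lookup_var_mult)

text \<open>Antisymmetry alone would only show that twice the sum vanishes. Splitting the pairs by
  the order of \<open>v\<close> and \<open>w\<close> gives the result in characteristic 2 as
  well.\<close>

lemma sum_pairs_cancel:
  fixes g :: "'v::finite \<Rightarrow> 'v \<Rightarrow> 'a::comm_ring_1"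
  assumes "\<And>v w. v \<in> A \<Longrightarrow> w \<in> A \<Longrightarrow> v \<noteq> w \<Longrightarrow> g v w + g w v = 0"
  shows "(\<Sum>v\<in>A. \<Sum>w\<in>A - {v}. g v w) = 0"
proof -
  have "(\<Sum>v\<in>A. \<Sum>w\<in>A - {v}. g v w) = (\<Sum>v\<in>A. \<Sum>w\<in>A. (if to_nat v < to_nat w then g v w else 0) +
      (if to_nat w < to_nat v then g v w else 0))"
  proof (rule sum.cong[OF refl])
    fix v assume "v \<in> A"
    have "(\<Sum>w\<in>A. (if to_nat v < to_nat w then g v w else 0) + (if to_nat w < to_nat v then g v w else 0))
        = (\<Sum>w\<in>A. if w = v then 0 else g v w)"
    proof (intro sum.cong refl)
      fix w
      have "v = w \<longleftrightarrow> to_nat v = to_nat w" by simp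
      then show "(if to_nat v < to_nat w then g v w else 0) + (if to_nat w < to_nat v then g v w else 0) =
         (if w = v then 0 else g v w)" by auto
    qed
    also have "\<dots> = (\<Sum>w\<in>A - {v}. g v w)"
      by (intro sum.mono_neutral_cong_right) auto
    finally show "(\<Sum>w\<in>A - {v}. g v w) = (\<Sum>w\<in>A. (if to_nat v < to_nat w then g v w else 0) +
      (if to_nat w < to_nat v then g v w else 0))" by (rule sym)
  qed
  also have "\<dots> = (\<Sum>v\<in>A. \<Sum>w\<in>A. if to_nat v < to_nat w then g v w else 0) +
      (\<Sum>v\<in>A. \<Sum>w\<in>A. if to_nat w < to_nat v then g v w else 0)"
    by (simp add: sum.distrib)
  also have "(\<Sum>v\<in>A. \<Sum>w\<in>A. if to_nat w < to_nat v then g v w else 0) =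
      (\<Sum>v\<in>A. \<Sum>w\<in>A. if to_nat v < to_nat w then g w v else 0)"
    by (rule sum.swap)
  also have "(\<Sum>v\<in>A. \<Sum>w\<in>A. if to_nat v < to_nat w then g v w else 0) + \<dots> =
      (\<Sum>v\<in>A. \<Sum>w\<in>A. if to_nat v < to_nat w then g v w + g w v else 0)"
    unfolding sum.distrib[symmetric] by (intro sum.cong refl) simp
  also have "\<dots> = 0"
    using assms by (intro sum.neutral ballI) auto
  finally show ?thesis .
qed

lemma koszul_diff_koszul_diff: "koszul_diff (koszul_diff f) T = 0"
proof -
  define g where "g v w = const_poly (ksign v T) * (var v *
      (const_poly (ksign w (insert v T)) * (var w * f (insert w (insert v T)))))" for v w
  have "koszul_diff (koszul_diff f) T = (\<Sum>v\<in>-T. \<Sum>w\<in>-T - {v}. g v w)"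
    unfolding koszul_diff_def sum_distrib_left g_def
    by (intro sum.cong) auto
  also have "\<dots> = 0"
  proof (rule sum_pairs_cancel)
    fix v w assume vw: "v \<in> -T" "w \<in> -T" "v \<noteq> w"
    have cp: "const_poly a * (x * (const_poly b * y)) = const_poly (a * b) * (x * y)"
      for a b :: 'b and x y :: "('a, 'b) polynomial"
    proof -
      have "const_poly (a * b) = const_poly a * (const_poly b :: ('a, 'b) polynomial)"
        by (simp add: const_poly_def mult_single)
      then show ?thesis by (simp add: algebra_simps)
    qed
    have "g v w + g w v = const_poly (ksign v T * ksign w (insert v T)) * (var v * (var w * f (insert v (insert w T))))
      + const_poly (ksign w T * ksign v (insert w T)) * (var v * (var w * f (insert v (insert w T))))"
      unfolding g_def cp by (simp add: insert_commute mult.left_commute)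
    also have "\<dots> = const_poly (ksign v T * ksign w (insert v T) + ksign w T * ksign v (insert w T))
        * (var v * (var w * f (insert v (insert w T))))"
      by (simp add: const_poly_def single_add distrib_right)
    also have "\<dots> = 0" using vw by (simp add: ksign_swap const_poly_def)
    finally show "g v w + g w v = 0" .
  qed
  finally show ?thesis .
qed

section \<open>Contracting homotopy and exactness\<close>

definition least_vertex :: "'v::finite set \<Rightarrow> 'v" where
  "least_vertex W = arg_min_on to_nat W"

lemma least_vertex:
  assumes "W \<noteq> {}"
  shows "least_vertex W \<in> W" "w \<in> W \<Longrightarrow> w = least_vertex W \<or> to_nat (least_vertex W) < to_nat w"
proof -
  show "least_vertex W \<in> W"
    unfolding least_vertex_def using assms by (intro arg_min_if_finite) auto
  assume "w \<in> W"
  then have "\<not> to_nat w < to_nat (least_vertex W)"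
    unfolding least_vertex_def using arg_min_if_finite(2)[of W to_nat] assms by auto
  then show "w = least_vertex W \<or> to_nat (least_vertex W) < to_nat w"
    by (metis linorder_neqE_nat to_nat_split)
qed

definition koszul_homotopy :: "('v::finite set \<Rightarrow> ('v, 'k::field) polynomial) \<Rightarrow> 'v set \<Rightarrow> ('v, 'k) polynomial" where
  "koszul_homotopy f S = Poly_Mapping.Abs_poly_mapping (\<lambda>b.
     let m = least_vertex (Poly_Mapping.keys b \<union> S)
     in if m \<in> S then Poly_Mapping.lookup (f (S - {m})) (b + Poly_Mapping.single m 1) else 0)"

lemma lookup_koszul_homotopy:
  "Poly_Mapping.lookup (koszul_homotopy f S) b =
     (let m = least_vertex (Poly_Mapping.keys b \<union> S)
      in if m \<in> S then Poly_Mapping.lookup (f (S - {m})) (b + Poly_Mapping.single m 1) else 0)"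
proof -
  let ?h = "\<lambda>b. let m = least_vertex (Poly_Mapping.keys b \<union> S)
     in if m \<in> S then Poly_Mapping.lookup (f (S - {m})) (b + Poly_Mapping.single m 1) else 0"
  \<comment> \<open>The support is finite: it is covered by the preimages of the supports of
    finitely many coefficients under injective shifts, one for each vertex \<open>m\<close>.\<close>
  have "{b. ?h b \<noteq> 0} \<subseteq>
    (\<Union>m. (\<lambda>b. b + Poly_Mapping.single m 1) -` {b. Poly_Mapping.lookup (f (S - {m})) b \<noteq> 0})"
    by (auto simp: Let_def split: if_splits)
  moreover have "finite (\<Union>m. (\<lambda>b. b + Poly_Mapping.single m 1) -` {b. Poly_Mapping.lookup (f (S - {m})) b \<noteq> 0})"
    by (intro finite_UN_I finite_vimageI) (auto simp: inj_def)
  ultimately have "finite {b. ?h b \<noteq> 0}" by (rule finite_subset)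
  then show ?thesis unfolding koszul_homotopy_def by simp
qed

text \<open>
  The chains of the Koszul complex in a fixed multidegree form the augmented chain complex of the simplex
  on the support of the multidegree; \<^const>\<open>koszul_homotopy\<close> is the cone construction with the least
  vertex of the support as apex. A condition on the differential is imposed only on the faces below \<open>T\<close>,
  so that the lemma applies to chains which are cycles in one homological degree.
\<close>

lemma koszul_diff_homotopy:
  fixes f :: "'v::finite set \<Rightarrow> ('v, 'k::field) polynomial"
  assumes ne: "Poly_Mapping.keys b \<union> T \<noteq> {}" and cyc: "\<And>m. m \<in> T \<Longrightarrow> koszul_diff f (T - {m}) = 0"
  shows "Poly_Mapping.lookup (koszul_diff (koszul_homotopy f) T) b = Poly_Mapping.lookup (f T) b"
proof -
  define m where "m = least_vertex (Poly_Mapping.keys b \<union> T)"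
  have least: "w = m \<or> to_nat m < to_nat w" if "w \<in> Poly_Mapping.keys b \<union> T" for w
    using least_vertex(2)[OF ne that] by (simp add: m_def)
  have coeff_h: "(if Poly_Mapping.lookup b v = 0 then 0
        else Poly_Mapping.lookup (koszul_homotopy f (insert v T)) (b - Poly_Mapping.single v 1)) =
      (if Poly_Mapping.lookup b v = 0 then 0 else if m \<in> insert v T
        then Poly_Mapping.lookup (f (insert v T - {m})) (b - Poly_Mapping.single v 1 + Poly_Mapping.single m 1)
        else 0)" for v
  proof (cases "Poly_Mapping.lookup b v = 0")
    case False
    then have "Poly_Mapping.keys (b - Poly_Mapping.single v 1) \<union> insert v T = Poly_Mapping.keys b \<union> T"
      by (auto simp: in_keys_iff lookup_minus lookup_single when_def split: if_splits)
    then show ?thesis using False unfolding lookup_koszul_homotopy by (simp add: Let_def m_def)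
  qed simp
  show ?thesis
  proof (cases "m \<in> T")
    case False
    then have mb: "Poly_Mapping.lookup b m \<noteq> 0"
      using least_vertex(1)[OF ne] by (auto simp: m_def in_keys_iff)
    have "{t \<in> T. to_nat t < to_nat m} = {}"
      using least by fastforce
    then have s: "ksign m T = (1 :: 'k)" unfolding ksign_def by (simp only: card.empty power_0)
    have e: "b - Poly_Mapping.single m 1 + Poly_Mapping.single m 1 = b"
      using mb by (intro poly_mapping_eqI) (auto simp: lookup_add lookup_minus lookup_single when_def)
    \<comment> \<open>With the apex outside \<open>T\<close>, only v = m makes
      \<open>insert v T\<close> contain the apex. Its sign is 1 because \<open>m\<close> precedes
      all of \<open>T\<close>.\<close>
    have "Poly_Mapping.lookup (koszul_diff (koszul_homotopy f) T) b =
        (\<Sum>v\<in>-T. if v = m then Poly_Mapping.lookup (f T) b else 0)"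
      unfolding lookup_koszul_diff coeff_h
    proof (intro sum.cong refl)
      fix v assume "v \<in> -T"
      then show "ksign v T * (if Poly_Mapping.lookup b v = 0 then 0 else if m \<in> insert v T
        then Poly_Mapping.lookup (f (insert v T - {m})) (b - Poly_Mapping.single v 1 + Poly_Mapping.single m 1)
        else 0) = (if v = m then Poly_Mapping.lookup (f T) b else 0)"
        using False mb s e by (auto simp: insert_Diff_if)
    qed
    also have "\<dots> = Poly_Mapping.lookup (f T) b" using False by simp
    finally show ?thesis .
  next
    case True
    \<comment> \<open>The cycle condition at this face in multidegree b + m has the wanted
      coefficient of \<open>f T\<close> as its term for \<open>m\<close>. The remaining terms are
      those of the differential of the homotopy with opposite sign, since \<open>m\<close> lies in
      \<open>T\<close> and precedes each vertex involved.\<close>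
    define U where "U = T - {m}"
    have T: "T = insert m U" "m \<notin> U" using True by (auto simp: U_def)
    have "{t \<in> U. to_nat t < to_nat m} = {}"
      using least T by fastforce
    then have s: "ksign m U = (1 :: 'k)" unfolding ksign_def by (simp only: card.empty power_0)
    have "0 = Poly_Mapping.lookup (koszul_diff f U) (b + Poly_Mapping.single m 1)"
      using cyc[OF True] by (simp add: U_def)
    also have "\<dots> = (\<Sum>v\<in>insert m (-T). ksign v U * (if Poly_Mapping.lookup (b + Poly_Mapping.single m 1) v = 0 then 0
        else Poly_Mapping.lookup (f (insert v U)) (b + Poly_Mapping.single m 1 - Poly_Mapping.single v 1)))"
      unfolding lookup_koszul_diff using T by (intro sum.cong) auto
    also have "\<dots> = Poly_Mapping.lookup (f T) b +
      (\<Sum>v\<in>-T. ksign v U * (if Poly_Mapping.lookup (b + Poly_Mapping.single m 1) v = 0 then 0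
        else Poly_Mapping.lookup (f (insert v U)) (b + Poly_Mapping.single m 1 - Poly_Mapping.single v 1)))"
      using True s T by (subst sum.insert) (auto simp: lookup_add)
    also have "(\<Sum>v\<in>-T. ksign v U * (if Poly_Mapping.lookup (b + Poly_Mapping.single m 1) v = 0 then 0
        else Poly_Mapping.lookup (f (insert v U)) (b + Poly_Mapping.single m 1 - Poly_Mapping.single v 1)))
      = (\<Sum>v\<in>-T. - (ksign v T * (if Poly_Mapping.lookup b v = 0 then 0 else if m \<in> insert v T
        then Poly_Mapping.lookup (f (insert v T - {m})) (b - Poly_Mapping.single v 1 + Poly_Mapping.single m 1)
        else 0)))"
    proof (intro sum.cong refl)
      fix v assume v: "v \<in> -T"
      then have vm: "v \<noteq> m" using True by blast
      show "ksign v U * (if Poly_Mapping.lookup (b + Poly_Mapping.single m 1) v = 0 then 0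
        else Poly_Mapping.lookup (f (insert v U)) (b + Poly_Mapping.single m 1 - Poly_Mapping.single v 1))
        = - (ksign v T * (if Poly_Mapping.lookup b v = 0 then 0 else if m \<in> insert v T
        then Poly_Mapping.lookup (f (insert v T - {m})) (b - Poly_Mapping.single v 1 + Poly_Mapping.single m 1)
        else 0))"
      proof (cases "Poly_Mapping.lookup b v = 0")
        case True
        then show ?thesis using vm by (simp add: lookup_add lookup_single)
      next
        case False
        then have "to_nat m < to_nat v" using least[of v] vm by (simp add: in_keys_iff)
        then have sg: "ksign v T = - (ksign v U :: 'k)" using T by (simp add: ksign_insert_less)
        have "b + Poly_Mapping.single m 1 - Poly_Mapping.single v 1 = b - Poly_Mapping.single v 1 + Poly_Mapping.single m 1"
          using False vm by (intro poly_mapping_eqI) (auto simp: lookup_add lookup_minus lookup_single when_def)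
        moreover have "insert v T - {m} = insert v U" using T vm by auto
        ultimately show ?thesis using sg False vm \<open>m \<in> T\<close> by (simp add: lookup_add lookup_single)
      qed
    qed
    finally have "Poly_Mapping.lookup (f T) b = (\<Sum>v\<in>-T. ksign v T * (if Poly_Mapping.lookup b v = 0 then 0 else if m \<in> insert v T
        then Poly_Mapping.lookup (f (insert v T - {m})) (b - Poly_Mapping.single v 1 + Poly_Mapping.single m 1)
        else 0))"
      by (simp add: sum_negf)
    then show ?thesis unfolding lookup_koszul_diff coeff_h by simp
  qed
qed

text \<open>The homotopy has no apex when both the face and the monomial are empty; this is the
  place where the homology K sits, so there the constant term must vanish by assumption.\<close>

lemma koszul_diff_exact:
  assumes "T \<noteq> {} \<or> Poly_Mapping.lookup (f T) 0 = 0" "\<And>m. m \<in> T \<Longrightarrow> koszul_diff f (T - {m}) = 0"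
  shows "koszul_diff (koszul_homotopy f) T = f T"
proof (rule poly_mapping_eqI)
  fix b
  show "Poly_Mapping.lookup (koszul_diff (koszul_homotopy f) T) b = Poly_Mapping.lookup (f T) b"
  proof (cases "Poly_Mapping.keys b \<union> T = {}")
    case True
    then have "b = 0" "T = {}" by (auto intro!: poly_mapping_eqI simp: in_keys_iff)
    then show ?thesis using assms(1) by (simp add: lookup_koszul_diff)
  next
    case False
    then show ?thesis using koszul_diff_homotopy assms(2) by blast
  qed
qed

text \<open>Basis elements of an \<open>augmented_complex\<close> are numbered, so the faces of each
  cardinality are enumerated by an arbitrary bijection, with \<open>face_index\<close> as its
  inverse.\<close>

definition nth_face :: "nat \<Rightarrow> nat \<Rightarrow> 'v::finite set" where
  "nth_face i = (SOME h. bij_betw h {..<card {S :: 'v set. card S = i}} {S. card S = i})"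

definition face_index :: "'v::finite set \<Rightarrow> nat" where
  "face_index S = inv_into {..<card {S' :: 'v set. card S' = card S}} (nth_face (card S)) S"

lemma nth_face_bij: "bij_betw (nth_face i) {..<card {S :: 'v::finite set. card S = i}} {S :: 'v set. card S = i}"
proof -
  have "\<exists>h. bij_betw h {..<card {S :: 'v set. card S = i}} {S :: 'v set. card S = i}"
    using ex_bij_betw_nat_finite[of "{S :: 'v set. card S = i}"] by (simp add: atLeast0LessThan)
  then show ?thesis unfolding nth_face_def by (rule someI_ex)
qed

lemma card_nth_face: "a < card {S :: 'v::finite set. card S = i} \<Longrightarrow> card (nth_face i a :: 'v set) = i"
  using nth_face_bij[where 'v='v, of i] by (auto simp: bij_betw_def)

lemma face_index_nth_face:
  "a < card {S :: 'v::finite set. card S = i} \<Longrightarrow> face_index (nth_face i a :: 'v set) = a"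
  unfolding face_index_def card_nth_face
  using nth_face_bij[where 'v='v, of i] by (simp add: bij_betw_def card_nth_face)

lemma face_index_less: "card S = i \<Longrightarrow> face_index S < card {S' :: 'v set. card S' = i}" for S :: "'v::finite set"
  using bij_betw_inv_into[OF nth_face_bij[where 'v='v, of i]]
  by (auto simp: face_index_def bij_betw_def)

lemma nth_face_face_index: "card S = i \<Longrightarrow> nth_face i (face_index S) = S" for S :: "'v::finite set"
  using bij_betw_inv_into_right[OF nth_face_bij[where 'v='v, of i]]
  by (auto simp: face_index_def)

text \<open>At most one \<open>v\<close> contributes to a matrix entry; the sum avoids having to
  name it. Each e_v has degree 1, hence the basis elements of stage i have degree i.\<close>

definition koszul :: "('v::finite, 'k::field, 'k) augmented_complex" where
  "koszul = \<lparr>rank = (\<lambda>i. card {S :: 'v set. card S = i}), gdeg = (\<lambda>i a. int i),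
     mat = (\<lambda>i a b. \<Sum>v\<in>-nth_face i a. if nth_face (Suc i) b = insert v (nth_face i a)
       then const_poly (ksign v (nth_face i a)) * var v else 0),
     aug = (\<lambda>a. 1)\<rparr>"

lemma rank_koszul: "rank (koszul :: ('v::finite, 'k::field, 'k) augmented_complex) i = card {S :: 'v set. card S = i}"
  by (simp add: koszul_def)

lemma koszul_diff_map:
  fixes f :: "nat \<Rightarrow> ('v::finite, 'k::field) polynomial"
  assumes a: "a < rank (koszul :: ('v, 'k, 'k) augmented_complex) i"
  shows "diff_map koszul i f a = koszul_diff (\<lambda>S. f (face_index S)) (nth_face i a)"
proof -
  let ?T = "nth_face i a :: 'v set"
  let ?r = "card {S :: 'v set. card S = Suc i}"
  have T: "card ?T = i" using a by (simp add: rank_koszul card_nth_face)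
  have "diff_map koszul i f a = (\<Sum>b<?r. \<Sum>v\<in>-?T. if nth_face (Suc i) b = insert v ?T
      then const_poly (ksign v ?T) * var v * f b else 0)"
    unfolding mat_vec_def rank_koszul
    by (simp add: koszul_def sum_distrib_right if_distrib[of "\<lambda>x. x * _"] cong: if_cong)
  also have "\<dots> = (\<Sum>v\<in>-?T. \<Sum>b<?r. if b = face_index (insert v ?T)
      then const_poly (ksign v ?T) * var v * f b else 0)"
  proof (subst sum.swap, intro sum.cong refl)
    fix v b assume v: "v \<in> -?T" and b: "b \<in> {..<?r}"
    have "card (insert v ?T) = Suc i" using v T by simp
    then have "nth_face (Suc i) b = insert v ?T \<longleftrightarrow> b = face_index (insert v ?T)"
      using b face_index_nth_face[where 'v='v, of b "Suc i"] nth_face_face_index[of "insert v ?T" "Suc i"] by auto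
    then show "(if nth_face (Suc i) b = insert v ?T then const_poly (ksign v ?T) * var v * f b else 0) =
      (if b = face_index (insert v ?T) then const_poly (ksign v ?T) * var v * f b else 0)" by simp
  qed
  also have "\<dots> = koszul_diff (\<lambda>S. f (face_index S)) ?T"
    unfolding koszul_diff_def
  proof (intro sum.cong refl)
    fix v assume v: "v \<in> -?T"
    then have "face_index (insert v ?T) < ?r" using T by (intro face_index_less) simp
    then show "(\<Sum>b<?r. if b = face_index (insert v ?T) then const_poly (ksign v ?T) * var v * f b else 0)
      = const_poly (ksign v ?T) * (var v * f (face_index (insert v ?T)))"
      by (simp add: mult.assoc)
  qed
  finally show ?thesis .
qed

text \<open>Cycles bound by the contracting homotopy and boundaries are cycles since the
  differential squares to zero. At stage 0 the image consists of the polynomials without constant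
  term, the kernel of the augmentation.\<close>

lemma koszul_resolution: "residue_resolution (koszul :: ('v::finite, 'k::field, 'k) augmented_complex)"
proof -
  let ?K = "koszul :: ('v, 'k, 'k) augmented_complex"
  have r0: "rank ?K 0 = 1"
  proof -
    have "{S :: 'v set. card S = 0} = {{}}" by auto
    then show ?thesis by (simp add: rank_koszul)
  qed
  have nth0: "nth_face 0 0 = ({} :: 'v set)"
    using card_nth_face[where 'v='v, of 0 0] r0 by (simp add: rank_koszul)
  have aug: "aug_map ?K f = Poly_Mapping.lookup (f 0) 0" for f
    unfolding aug_map_def r0 by (simp add: koszul_def)
  have cyc: "is_cycle ?K (Suc n) f \<longleftrightarrow> (\<forall>T. card T = n \<longrightarrow> koszul_diff (\<lambda>S. f (face_index S)) T = 0)" for n f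
  proof
    assume c: "is_cycle ?K (Suc n) f"
    show "\<forall>T. card T = n \<longrightarrow> koszul_diff (\<lambda>S. f (face_index S)) T = 0"
    proof (intro allI impI)
      fix T :: "'v set" assume T: "card T = n"
      have i: "face_index T < rank ?K n" unfolding rank_koszul using T by (rule face_index_less)
      then have "diff_map ?K n f (face_index T) = 0" using c by simp
      then show "koszul_diff (\<lambda>S. f (face_index S)) T = 0"
        unfolding koszul_diff_map[OF i] nth_face_face_index[OF T] .
    qed
  next
    assume "\<forall>T. card T = n \<longrightarrow> koszul_diff (\<lambda>S. f (face_index S)) T = 0"
    then show "is_cycle ?K (Suc n) f"
      unfolding is_cycle.simps using koszul_diff_map card_nth_face rank_koszul by metis
  qed
  have bd: "(\<exists>g. \<forall>a<rank ?K n. f a = diff_map ?K n g a) \<longleftrightarrow>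
     (\<exists>g. \<forall>T. card T = n \<longrightarrow> f (face_index T) = koszul_diff g T)" for n f
  proof
    assume "\<exists>g. \<forall>a<rank ?K n. f a = diff_map ?K n g a"
    then obtain g where g: "\<forall>a<rank ?K n. f a = diff_map ?K n g a" by blast
    have "f (face_index T) = koszul_diff (\<lambda>S. g (face_index S)) T" if T: "card T = n" for T
    proof -
      have i: "face_index T < rank ?K n" unfolding rank_koszul using T by (rule face_index_less)
      then show ?thesis using g koszul_diff_map[OF i] nth_face_face_index[OF T] by metis
    qed
    then show "\<exists>g. \<forall>T. card T = n \<longrightarrow> f (face_index T) = koszul_diff g T" by blast
  next
    assume "\<exists>g. \<forall>T. card T = n \<longrightarrow> f (face_index T) = koszul_diff g T"
    then obtain g where g: "\<And>T. card T = n \<Longrightarrow> f (face_index T) = koszul_diff g T" by blast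
    have "f a = diff_map ?K n (\<lambda>b. g (nth_face (Suc n) b)) a" if a: "a < rank ?K n" for a
    proof -
      have "card (nth_face n a :: 'v set) = n" using a by (simp add: rank_koszul card_nth_face)
      moreover from this have "koszul_diff (\<lambda>S. g (nth_face (Suc n) (face_index S))) (nth_face n a) = koszul_diff g (nth_face n a)"
        by (intro koszul_diff_cong) (simp add: nth_face_face_index)
      ultimately show ?thesis
        using g[of "nth_face n a"] a unfolding koszul_diff_map[OF a]
        by (simp add: face_index_nth_face rank_koszul)
    qed
    then show "\<exists>g. \<forall>a<rank ?K n. f a = diff_map ?K n g a" by blast
  qed
  show ?thesis
    unfolding residue_resolution_alt
  proof (intro conjI allI impI)
    fix n
    show "hmap ?K ?K (Suc n) n (mat ?K n)"
      unfolding hmap_def hvec_def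
      by (auto simp: koszul_def intro!: homogeneous_sum homogeneous_mult_eq[OF const_poly_homogeneous var_homogeneous])
  next
    fix a assume "gdeg ?K 0 a \<noteq> 0"
    then show "aug ?K a = 0" by (simp add: koszul_def)
  next
    fix x :: 'k
    have "aug_map ?K (\<lambda>_. const_poly x) = x" by (simp add: aug const_poly_def)
    then show "\<exists>f. aug_map ?K f = x" by blast
  next
    fix n and f :: "nat \<Rightarrow> ('v, 'k) polynomial"
    show "is_cycle ?K n f \<longleftrightarrow> (\<exists>g. \<forall>a<rank ?K n. f a = diff_map ?K n g a)"
    proof (cases n)
      case 0
      have i0: "face_index ({} :: 'v set) = 0"
        using face_index_nth_face[where 'v='v, of 0 0] nth0 r0 by (simp add: rank_koszul)
      have "Poly_Mapping.lookup (f 0) 0 = 0 \<longleftrightarrow> (\<exists>g. f 0 = koszul_diff g ({} :: 'v set))"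
      proof
        assume "Poly_Mapping.lookup (f 0) 0 = 0"
        then have "koszul_diff (koszul_homotopy (\<lambda>S. f (face_index S))) ({} :: 'v set) = f 0"
          using koszul_diff_exact[of "{}" "\<lambda>S. f (face_index S)"] i0 by simp
        then show "\<exists>g. f 0 = koszul_diff g ({} :: 'v set)" by metis
      next
        assume "\<exists>g. f 0 = koszul_diff g ({} :: 'v set)"
        then show "Poly_Mapping.lookup (f 0) 0 = 0" by (auto simp: lookup_koszul_diff)
      qed
      then show ?thesis unfolding bd 0 by (simp add: aug i0)
    next
      case (Suc k)
      show ?thesis
        unfolding Suc cyc bd
      proof
        assume c: "\<forall>T. card T = k \<longrightarrow> koszul_diff (\<lambda>S. f (face_index S)) T = 0"
        have "f (face_index T) = koszul_diff (koszul_homotopy (\<lambda>S. f (face_index S))) T" if T: "card T = Suc k" for T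
        proof (rule koszul_diff_exact[symmetric])
          show "T \<noteq> {} \<or> Poly_Mapping.lookup (f (face_index T)) 0 = 0" using T by auto
          show "koszul_diff (\<lambda>S. f (face_index S)) (T - {m}) = 0" if "m \<in> T" for m
            using c T that by simp
        qed
        then show "\<exists>g. \<forall>T. card T = Suc k \<longrightarrow> f (face_index T) = koszul_diff g T" by blast
      next
        assume "\<exists>g. \<forall>T. card T = Suc k \<longrightarrow> f (face_index T) = koszul_diff g T"
        then obtain g where g: "\<And>T. card T = Suc k \<Longrightarrow> f (face_index T) = koszul_diff g T" by blast
        show "\<forall>T. card T = k \<longrightarrow> koszul_diff (\<lambda>S. f (face_index S)) T = 0"
        proof (intro allI impI)
          fix T :: "'v set" assume T: "card T = k"
          have "koszul_diff (\<lambda>S. f (face_index S)) T = koszul_diff (koszul_diff g) T"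
            by (rule koszul_diff_cong, rule g) (use T in simp)
          then show "koszul_diff (\<lambda>S. f (face_index S)) T = 0"
            by (simp add: koszul_diff_koszul_diff)
        qed
      qed
    qed
  qed
qed


section \<open>The linear strand\<close>

text \<open>The chain x_G e_A of a pair (G, A).\<close>

definition incidence_chain :: "'v::finite set \<times> 'v set \<Rightarrow> 'v set \<Rightarrow> ('v, 'k::field) polynomial" where
  "incidence_chain x S = (if S = snd x then Poly_Mapping.single (sqfree (fst x)) 1 else 0)"

definition incidence_vec :: "nat \<Rightarrow> 'v::finite set \<times> 'v set \<Rightarrow> nat \<Rightarrow> ('v, 'k::field) polynomial" where
  "incidence_vec i x a = (if a < card {S :: 'v set. card S = i} then incidence_chain x (nth_face i a) else 0)"

lemma incidence_vec_face_index: "card S = i \<Longrightarrow> incidence_vec i x (face_index S) = incidence_chain x S"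
  by (simp add: incidence_vec_def face_index_less nth_face_face_index)

lemma sqfree_add_single: "v \<notin> G \<Longrightarrow> Poly_Mapping.single v 1 + sqfree G = sqfree (insert v G)"
  by (rule poly_mapping_eqI) (auto simp: lookup_add lookup_single when_def)

lemma sqfree_eq_iff: "sqfree F = sqfree G \<longleftrightarrow> F = G"
proof
  assume "sqfree F = sqfree G"
  then have "Poly_Mapping.lookup (sqfree F) v = Poly_Mapping.lookup (sqfree G) v" for v by simp
  then have "v \<in> F \<longleftrightarrow> v \<in> G" for v by (metis lookup_sqfree zero_neq_one)
  then show "F = G" by blast
qed simp

lemma koszul_diff_incidence_chain:
  fixes x :: "'v::finite set \<times> 'v set"
  assumes x: "fst x \<inter> snd x = {}"
  shows "koszul_diff (incidence_chain x) T = (\<Sum>v\<in>-T. if insert v T = snd x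
    then Poly_Mapping.single (sqfree (insert v (fst x))) (ksign v T :: 'k::field) else 0)"
  unfolding koszul_diff_def
proof (intro sum.cong refl)
  fix v assume "v \<in> -T"
  show "const_poly (ksign v T) * (var v * incidence_chain x (insert v T)) =
    (if insert v T = snd x then Poly_Mapping.single (sqfree (insert v (fst x))) (ksign v T :: 'k) else 0)"
  proof (cases "insert v T = snd x")
    case True
    then have "v \<notin> fst x" using x by blast
    then have "Poly_Mapping.single v 1 + sqfree (fst x) = sqfree (insert v (fst x))"
      by (rule sqfree_add_single)
    then show ?thesis
      using True by (simp add: incidence_chain_def var_def const_poly_def mult_single)
  qed (simp add: incidence_chain_def)
qed

lemma lookup_koszul_diff_incidence_chain_self:
  fixes x :: "'v::finite set \<times> 'v set"
  assumes x: "fst x \<inter> snd x = {}" and w: "w \<in> snd x"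
  shows "Poly_Mapping.lookup (koszul_diff (incidence_chain x) (snd x - {w})) (sqfree (insert w (fst x)))
    = (ksign w (snd x - {w}) :: 'k::field)"
proof -
  let ?T = "snd x - {w}"
  have "Poly_Mapping.lookup (koszul_diff (incidence_chain x) ?T) (sqfree (insert w (fst x)))
      = (\<Sum>v\<in>-?T. if v = w then (ksign w ?T :: 'k) else 0)"
    unfolding koszul_diff_incidence_chain[OF x] lookup_sum
  proof (intro sum.cong refl)
    fix v assume "v \<in> -?T"
    then have "insert v ?T = snd x \<longleftrightarrow> v = w" using w by auto
    then show "Poly_Mapping.lookup (if insert v ?T = snd x then Poly_Mapping.single (sqfree (insert v (fst x))) (ksign v ?T) else 0)
       (sqfree (insert w (fst x))) = (if v = w then (ksign w ?T :: 'k) else 0)"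
      by simp
  qed
  also have "\<dots> = ksign w ?T" by simp
  finally show ?thesis .
qed

lemma lookup_koszul_diff_incidence_chain_nonzero:
  fixes x :: "'v::finite set \<times> 'v set"
  assumes x: "fst x \<inter> snd x = {}"
    and nz: "Poly_Mapping.lookup (koszul_diff (incidence_chain x) T :: ('v, 'k::field) polynomial) (sqfree F) \<noteq> 0"
  shows "\<exists>v\<in>snd x. T = snd x - {v} \<and> F = insert v (fst x)"
proof -
  obtain v where v: "v \<in> -T" "Poly_Mapping.lookup (if insert v T = snd x
    then Poly_Mapping.single (sqfree (insert v (fst x))) (ksign v T :: 'k) else 0) (sqfree F) \<noteq> 0"
    using nz unfolding koszul_diff_incidence_chain[OF x] lookup_sum by (meson sum.not_neutral_contains_not_neutral)
  then have "insert v T = snd x" by (auto split: if_splits)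
  moreover from this have "sqfree F = sqfree (insert v (fst x))"
    using v(2) by (auto simp: lookup_single when_def split: if_splits)
  then have "F = insert v (fst x)" by (simp add: sqfree_eq_iff)
  ultimately show ?thesis using v(1) by blast
qed

section \<open>Koszul chains and the facet ideal in degrees D and D + 1\<close>

context
  fixes \<Delta> :: "'v::finite set set" and D :: nat
  assumes card_facet: "\<And>F. F \<in> facets \<Delta> \<Longrightarrow> card F = Suc D"
begin

text \<open>Every monomial of the ideal is divisible by a facet monomial, of degree D + 1. For
  coefficients of degree D, congruence modulo the ideal is therefore equality.\<close>

lemma facet_ideal_low_degree:
  fixes p :: "('v, 'k::field) polynomial"
  assumes "p \<in> facet_ideal \<Delta>" "p \<in> homogeneous (int D)"
  shows "p = 0"
proof (rule ccontr)
  assume "p \<noteq> 0"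
  then obtain t where t: "Poly_Mapping.lookup p t \<noteq> 0"
    by (metis poly_mapping_eqI lookup_zero)
  then obtain F where F: "F \<in> facets \<Delta>" "\<forall>v\<in>F. Poly_Mapping.lookup t v \<noteq> 0"
    using facet_ideal_lookup[OF assms(1)] by blast
  have "int (card F) \<le> mdeg t"
    unfolding mdeg_sqfree[symmetric] mdeg_alt of_nat_le_iff
    using F(2) by (intro sum_mono) (auto simp: Suc_le_eq)
  moreover have "mdeg t = int D" using assms(2) t by (auto simp: homogeneous_iff)
  ultimately show False using card_facet[OF F(1)] by simp
qed

text \<open>A monomial divisible by a facet monomial of the same degree is equal to it.\<close>

lemma facet_ideal_generator_degree:
  fixes p :: "('v, 'k::field) polynomial"
  assumes "p \<in> facet_ideal \<Delta>" "p \<in> homogeneous (int (Suc D))" "Poly_Mapping.lookup p t \<noteq> 0"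
  shows "\<exists>F\<in>facets \<Delta>. t = sqfree F"
proof -
  obtain F where F: "F \<in> facets \<Delta>" "\<forall>v\<in>F. Poly_Mapping.lookup t v \<noteq> 0"
    using facet_ideal_lookup[OF assms(1,3)] by blast
  have le: "Poly_Mapping.lookup (sqfree F) v \<le> Poly_Mapping.lookup t v" for v
    using F(2) by (auto simp: Suc_le_eq)
  have "mdeg t = mdeg (sqfree F)"
    using assms(2,3) card_facet[OF F(1)] by (auto simp: homogeneous_iff)
  then have "(\<Sum>v\<in>UNIV. Poly_Mapping.lookup (sqfree F) v) = (\<Sum>v\<in>UNIV. Poly_Mapping.lookup t v)"
    unfolding mdeg_alt by linarith
  then have "Poly_Mapping.lookup (sqfree F) v = Poly_Mapping.lookup t v" for v
    using sum_mono_inv[of "Poly_Mapping.lookup (sqfree F)" UNIV "Poly_Mapping.lookup t" v] le by simp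
  then have "t = sqfree F" by (intro poly_mapping_eqI) simp
  then show ?thesis using F(1) by blast
qed

text \<open>Consider the differential at S - {w} in the multidegree of x_F times w. Its term for
  \<open>w\<close> is nonzero and the total is zero, so another vertex v contributes; the monomial
  belonging to that term has degree D + 1 and is again a facet monomial.\<close>

lemma facet_cycle_exchange:
  fixes y :: "'v set \<Rightarrow> ('v, 'k::field) polynomial"
  assumes I: "\<And>S. card S = n \<Longrightarrow> y S \<in> facet_ideal \<Delta>" "\<And>S. card S = n \<Longrightarrow> y S \<in> homogeneous (int (Suc D))"
    and cyc: "\<And>T. koszul_diff y T = 0"
    and S: "card S = n" and F: "F \<in> facets \<Delta>" and nz: "Poly_Mapping.lookup (y S) (sqfree F) \<noteq> 0" and w: "w \<in> S"
  shows "w \<notin> F" "\<exists>v\<in>F. card (insert v (S - {w})) = n \<and> insert w (F - {v}) \<in> facets \<Delta> \<and>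
    Poly_Mapping.lookup (y (insert v (S - {w}))) (sqfree (insert w (F - {v}))) \<noteq> 0"
proof -
  define T where "T = S - {w}"
  define b where "b = sqfree F + Poly_Mapping.single w 1"
  have T: "S = insert w T" "w \<notin> T" using w by (auto simp: T_def)
  have cT: "card (insert v T) = n" if "v \<notin> T" for v using S T that by simp
  have bw: "b - Poly_Mapping.single w 1 = sqfree F" "Poly_Mapping.lookup b w \<noteq> 0"
    by (simp_all add: b_def lookup_add)
  define g where "g v = ksign v T * (if Poly_Mapping.lookup b v = 0 then 0
    else Poly_Mapping.lookup (y (insert v T)) (b - Poly_Mapping.single v 1))" for v
  have "0 = (\<Sum>v\<in>-T. g v)"
    using cyc[of T] unfolding g_def lookup_koszul_diff[symmetric] by simp
  also have "\<dots> = g w + (\<Sum>v\<in>-T - {w}. g v)"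
    using T(2) by (simp add: sum.remove)
  finally have "g w + (\<Sum>v\<in>-T - {w}. g v) = 0" by simp
  moreover have "g w \<noteq> 0" unfolding g_def bw(1) using bw(2) nz T(1) by (simp add: ksign_nonzero)
  ultimately have "(\<Sum>v\<in>-T - {w}. g v) \<noteq> 0" by force
  then obtain v where v: "v \<in> -T - {w}" "g v \<noteq> 0" by (meson sum.not_neutral_contains_not_neutral)
  then have bv: "Poly_Mapping.lookup b v \<noteq> 0" and
    nzv: "Poly_Mapping.lookup (y (insert v T)) (b - Poly_Mapping.single v 1) \<noteq> 0"
    unfolding g_def by (auto split: if_splits)
  have vF: "v \<in> F" using bv v(1) by (auto simp: b_def lookup_add lookup_single when_def split: if_splits)
  have c: "card (insert v T) = n" using cT v(1) by blast
  obtain F' where F': "F' \<in> facets \<Delta>" "b - Poly_Mapping.single v 1 = sqfree F'"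
    using facet_ideal_generator_degree[OF I(1)[OF c] I(2)[OF c] nzv] by blast
  \<comment> \<open>Dividing by v \<noteq> w leaves the exponent of \<open>w\<close> untouched. It
    would be 2 if \<open>w\<close> were in \<open>F\<close>, but facet monomials are
    squarefree.\<close>
  have "Poly_Mapping.lookup (b - Poly_Mapping.single v 1) w = (if w \<in> F then 2 else 1)"
    using v(1) by (auto simp: b_def lookup_minus lookup_add lookup_single when_def)
  then show wF: "w \<notin> F" unfolding F'(2) by (auto split: if_splits)
  have e: "b - Poly_Mapping.single v 1 = sqfree (insert w (F - {v}))"
    using wF vF by (intro poly_mapping_eqI) (auto simp: b_def lookup_minus lookup_add lookup_single when_def)
  then have "F' = insert w (F - {v})" using F'(2) by (simp add: sqfree_eq_iff)
  then show "\<exists>v\<in>F. card (insert v (S - {w})) = n \<and> insert w (F - {v}) \<in> facets \<Delta> \<and>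
    Poly_Mapping.lookup (y (insert v (S - {w}))) (sqfree (insert w (F - {v}))) \<noteq> 0"
    using vF c F'(1) nzv unfolding T_def[symmetric] e by blast
qed

text \<open>
  The hypothesis on \<open>nz\<close> abstracts what is known about the nonvanishing of the coefficient of
  \<open>x\<^sub>F e\<^sub>S\<close> in a Koszul cycle with values in the facet ideal.
\<close>

lemma graded_betti_linear_strand:
  fixes X :: "('v set \<times> 'v set) set"
  assumes X: "\<And>G A. (G, A) \<in> X \<Longrightarrow> card G = D \<and> card A = Suc n \<and> G \<inter> A = {} \<and> (\<forall>w\<in>A. insert w G \<in> facets \<Delta>)"
    and unique: "\<And>G A G' A' w w'. (G, A) \<in> X \<Longrightarrow> (G', A') \<in> X \<Longrightarrow> w \<in> A \<Longrightarrow> w' \<in> A' \<Longrightarrow>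
      A - {w} = A' - {w'} \<Longrightarrow> insert w G = insert w' G' \<Longrightarrow> (G, A) = (G', A')"
    and hit: "\<And>nz S F. nz S F \<Longrightarrow>
      (\<And>S F. nz S F \<Longrightarrow> card S = n \<and> F \<in> facets \<Delta> \<and> S \<inter> F = {} \<and>
        (\<forall>w\<in>S. \<exists>v\<in>F. nz (insert v (S - {w})) (insert w (F - {v})))) \<Longrightarrow>
      \<exists>G A. (G, A) \<in> X \<and> (\<forall>w\<in>A. nz (A - {w}) (insert w G))"
  shows "graded_betti (quotient_ring (facet_ideal \<Delta> :: ('v, 'k::field) polynomial set)) (Suc n) (int (Suc n) + int D) = card X"
proof -
  let ?I = "facet_ideal \<Delta> :: ('v, 'k) polynomial set"
  let ?M = "quotient_ring ?I"
  let ?K = "koszul :: ('v, 'k, 'k) augmented_complex"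
  let ?j = "int (Suc n) + int D"
  let ?C = "tensor_chains ?K ?M (Suc n) ?j"
  let ?Z = "tensor_cycles ?K ?M (Suc n) ?j"
  let ?B = "tensor_boundaries ?K ?M (Suc n) ?j"
  interpret cs: vector_space "cscale :: 'k \<Rightarrow> (nat \<Rightarrow> ('v, 'k) polynomial) \<Rightarrow> _"
    by (rule vector_space_const_poly)
  note ideal = facet_ideal_def[of \<Delta>]
  have K: "residue_resolution ?K" by (rule koszul_resolution)
  have gdeg: "gdeg ?K i a = int i" for i a by (simp add: koszul_def)
  have hv: "hvec ?K i e f \<longleftrightarrow> (\<forall>a<rank ?K i. f a \<in> homogeneous (e - int i))" for i e f
    by (simp add: hvec_def gdeg)
  define b :: "'v set \<times> 'v set \<Rightarrow> nat \<Rightarrow> ('v, 'k) polynomial" where "b = incidence_vec (Suc n)"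
  define \<delta> :: "(nat \<Rightarrow> ('v, 'k) polynomial) \<Rightarrow> 'v set \<Rightarrow> ('v, 'k) polynomial" where
    "\<delta> z = koszul_diff (\<lambda>S. z (face_index S))" for z
  have \<delta>: "diff_map ?K n z (face_index T) = \<delta> z T" if T: "card T = n" for z T
  proof -
    have i: "face_index T < rank ?K n" unfolding rank_koszul using T by (rule face_index_less)
    show ?thesis unfolding \<delta>_def koszul_diff_map[OF i] nth_face_face_index[OF T] ..
  qed
  have all_faces: "(\<forall>a<rank ?K n. P (diff_map ?K n z a)) \<longleftrightarrow> (\<forall>T. card T = n \<longrightarrow> P (\<delta> z T))" for P z
  proof
    assume "\<forall>a<rank ?K n. P (diff_map ?K n z a)"
    then show "\<forall>T. card T = n \<longrightarrow> P (\<delta> z T)" using \<delta> face_index_less rank_koszul by metis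
  next
    assume "\<forall>T. card T = n \<longrightarrow> P (\<delta> z T)"
    then show "\<forall>a<rank ?K n. P (diff_map ?K n z a)"
      using \<delta> face_index_nth_face card_nth_face rank_koszul by metis
  qed
  have Z: "z \<in> ?Z \<longleftrightarrow> z \<in> ?C \<and> (\<forall>T. card T = n \<longrightarrow> \<delta> z T \<in> ?I)" for z
    unfolding tensor_cycles_quotient_ring[OF ideal] all_faces[of "\<lambda>p. p \<in> ?I"] ..
  \<comment> \<open>If \<open>z\<close> is a boundary modulo I, the discrepancy has coefficients of
    degree D and is zero, so \<delta> kills \<open>z\<close>. Conversely, a chain killed by \<delta>
    has a homogeneous preimage by exactness of the Koszul complex.\<close>
  have B: "z \<in> ?B \<longleftrightarrow> z \<in> ?C \<and> (\<forall>T. card T = n \<longrightarrow> \<delta> z T = 0)" for z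
  proof -
    have "z \<in> ?B \<longleftrightarrow> (\<forall>a<rank ?K n. diff_map ?K n z a = 0)" if zC: "z \<in> ?C"
    proof
      assume "z \<in> ?B"
      then obtain w where w: "w \<in> tensor_chains ?K ?M (Suc (Suc n)) ?j"
        "\<forall>a<rank ?K (Suc n). z a - diff_map ?K (Suc n) w a \<in> ?I"
        unfolding tensor_boundaries_quotient_ring[OF ideal] by blast
      have "hvec ?K (Suc n) ?j z" "hvec ?K (Suc n) ?j (diff_map ?K (Suc n) w)"
        using zC w(1) hvec_mat_vec[OF resolution_hmap[OF K]] unfolding tensor_chains_quotient_ring by blast+
      then have "\<forall>a<rank ?K (Suc n). z a - diff_map ?K (Suc n) w a \<in> homogeneous (int D)"
        unfolding hv by (simp add: homogeneous_diff)
      then have e: "z a = diff_map ?K (Suc n) w a" if "a < rank ?K (Suc n)" for a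
        using w(2) that facet_ideal_low_degree by fastforce
      show "\<forall>a<rank ?K n. diff_map ?K n z a = 0"
      proof (intro allI impI)
        fix a assume a: "a < rank ?K n"
        have "diff_map ?K n z a = diff_map ?K n (diff_map ?K (Suc n) w) a"
          using e by (intro mat_vec_cong) auto
        then show "diff_map ?K n z a = 0" using diff_map_diff_map[OF K a] by simp
      qed
    next
      assume "\<forall>a<rank ?K n. diff_map ?K n z a = 0"
      then have c: "is_cycle ?K (Suc n) z" by simp
      have "hvec ?K (Suc n) ?j z" using zC unfolding tensor_chains_quotient_ring by blast
      then obtain g where g: "hvec ?K (Suc (Suc n)) ?j g" "\<forall>a<rank ?K (Suc n). z a = diff_map ?K (Suc n) g a"
        using resolution_lift[OF K c] by blast
      define w where "w a = (if a < rank ?K (Suc (Suc n)) then g a else 0)" for a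
      have "w \<in> tensor_chains ?K ?M (Suc (Suc n)) ?j"
        using g(1) unfolding tensor_chains_quotient_ring hvec_def w_def by simp
      moreover have "z a - diff_map ?K (Suc n) w a \<in> ?I" if "a < rank ?K (Suc n)" for a
      proof -
        have "diff_map ?K (Suc n) w a = diff_map ?K (Suc n) g a"
          by (intro mat_vec_cong) (auto simp: w_def)
        then show ?thesis using g(2) that zero_in_ideal[OF ideal] by simp
      qed
      ultimately show "z \<in> ?B" using zC unfolding tensor_boundaries_quotient_ring[OF ideal] by blast
    qed
    moreover have "z \<in> ?B \<Longrightarrow> z \<in> ?C" unfolding tensor_boundaries_quotient_ring[OF ideal] by blast
    ultimately show ?thesis unfolding all_faces[of "\<lambda>p. p = 0", symmetric] by blast
  qed
  have \<delta>b: "\<delta> (b x) T = koszul_diff (incidence_chain x) T" if "card T = n" for x T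
    unfolding \<delta>_def b_def using that by (intro koszul_diff_cong) (simp add: incidence_vec_face_index)
  have \<delta>_lin: "\<delta> (\<lambda>a. z a - (\<Sum>x\<in>Y. cscale (u x) (b x)) a) T = \<delta> z T - (\<Sum>x\<in>Y. const_poly (u x) * \<delta> (b x) T)"
    for z Y u T
  proof -
    have "(\<Sum>x\<in>Y. cscale (u x) (b x)) a = (\<Sum>x\<in>Y. const_poly (u x) * b x a)" for a
      by (induction Y rule: infinite_finite_induct) auto
    then show ?thesis
      unfolding \<delta>_def by (simp add: koszul_diff_diff koszul_diff_sum koszul_diff_scale)
  qed
  have disj: "fst x \<inter> snd x = {}" if "x \<in> X" for x using X[of "fst x" "snd x"] that by simp
  \<comment> \<open>Evaluation at one term of the differential of \<open>x\<close> acts as a dual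
    basis vector up to sign: by \<open>unique\<close>, no other pair in \<open>X\<close> has this
    term.\<close>
  have coeff: "Poly_Mapping.lookup (\<delta> (b x') (snd x - {w})) (sqfree (insert w (fst x)))
      = (if x' = x then ksign w (snd x - {w}) else 0)"
    if x: "x \<in> X" "x' \<in> X" and w: "w \<in> snd x" for x x' w
  proof -
    have c: "card (snd x - {w}) = n" using X[of "fst x" "snd x"] x w by simp
    show ?thesis
    proof (cases "x' = x")
      case True
      then show ?thesis using lookup_koszul_diff_incidence_chain_self[OF disj[OF x(1)] w] \<delta>b[OF c] by simp
    next
      case False
      have "Poly_Mapping.lookup (\<delta> (b x') (snd x - {w})) (sqfree (insert w (fst x))) = 0"
      proof (rule ccontr)
        assume "Poly_Mapping.lookup (\<delta> (b x') (snd x - {w})) (sqfree (insert w (fst x))) \<noteq> 0"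
        then obtain v where "v \<in> snd x'" "snd x - {w} = snd x' - {v}" "insert w (fst x) = insert v (fst x')"
          using lookup_koszul_diff_incidence_chain_nonzero[OF disj[OF x(2)]] \<delta>b[OF c] by metis
        then have "x = x'"
          using unique[of "fst x" "snd x" "fst x'" "snd x'" w v] x w by simp
        with False show False by simp
      qed
      with False show ?thesis by simp
    qed
  qed
  have bZ: "b x \<in> ?Z" if x: "x \<in> X" for x
    unfolding Z
  proof (intro conjI allI impI)
    have x': "card (fst x) = D" "\<forall>w\<in>snd x. insert w (fst x) \<in> facets \<Delta>"
      using X[of "fst x" "snd x"] x by auto
    show "b x \<in> ?C"
      unfolding tensor_chains_quotient_ring hv using x'(1)
      by (auto simp: b_def incidence_vec_def incidence_chain_def rank_koszul intro!: homogeneous_single)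
    fix T :: "'v set" assume T: "card T = n"
    show "\<delta> (b x) T \<in> ?I"
      unfolding \<delta>b[OF T] koszul_diff_incidence_chain[OF disj[OF x]] ideal
    proof (rule ideal_generated_sum, fold ideal)
      fix v
      have "Poly_Mapping.single (sqfree (insert v (fst x))) c \<in> ?I" if "v \<in> snd x" for c
      proof -
        have "const_poly c * Poly_Mapping.single (sqfree (insert v (fst x))) 1 \<in> ?I"
          using that x'(2) by (intro mult_in_ideal[OF ideal] facet_ideal_sqfree) blast
        then show ?thesis by (simp add: const_poly_def mult_single)
      qed
      then show "(if insert v T = snd x then Poly_Mapping.single (sqfree (insert v (fst x))) (ksign v T) else 0) \<in> ?I"
        using zero_in_ideal[OF ideal] by auto
    qed
  qed
  have ne: "\<exists>w. w \<in> snd x" if "x \<in> X" for x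
    using X[of "fst x" "snd x"] that by (metis card.empty ex_in_conv old.nat.distinct(2) prod.collapse)
  have inj: "inj_on b X"
  proof (rule inj_onI)
    fix x x' assume x: "x \<in> X" "x' \<in> X" "b x = b x'"
    obtain w where w: "w \<in> snd x" using ne x(1) by blast
    have "ksign w (snd x - {w}) = (if x' = x then ksign w (snd x - {w}) else (0 :: 'k))"
      using coeff[OF x(1) x(1) w] coeff[OF x(1) x(2) w] x(3) by simp
    moreover have "ksign w (snd x - {w}) \<noteq> (0 :: 'k)" by (rule ksign_nonzero)
    ultimately show "x = x'" by (auto split: if_splits)
  qed
  have "quotient_basis cscale ?Z ?B (b ` X)"
    unfolding quotient_basis_def
  proof (intro conjI allI impI ballI)
    show "b ` X \<subseteq> ?Z" using bZ by blast
  next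
    fix Y' u s assume Y': "finite Y' \<and> Y' \<subseteq> b ` X \<and> (\<Sum>s\<in>Y'. cscale (u s) s) \<in> ?B" and s: "s \<in> Y'"
    then obtain Y where Y: "Y \<subseteq> X" "Y' = b ` Y" by (meson subset_imageE)
    then obtain x where x: "x \<in> Y" "s = b x" using s by blast
    obtain w where w: "w \<in> snd x" using ne x(1) Y(1) by blast
    have c: "card (snd x - {w}) = n" using X[of "fst x" "snd x"] x(1) Y(1) w by auto
    have sum: "(\<Sum>s\<in>Y'. cscale (u s) s) = (\<Sum>x\<in>Y. cscale (u (b x)) (b x))"
      unfolding Y(2) using inj_on_subset[OF inj Y(1)] by (simp add: sum.reindex)
    have "(\<Sum>x\<in>Y. cscale (u (b x)) (b x)) \<in> ?B"
      using Y'[THEN conjunct2, THEN conjunct2] unfolding sum .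
    then have "- (\<Sum>x\<in>Y. cscale (u (b x)) (b x)) \<in> ?B"
      by (rule cs.subspace_neg[OF subspace_boundaries[OF ideal]])
    moreover have "- (\<Sum>x\<in>Y. cscale (u (b x)) (b x)) = (\<lambda>a. 0 - (\<Sum>x\<in>Y. cscale (u (b x)) (b x)) a)"
      by (simp add: fun_eq_iff)
    ultimately have "(\<lambda>a. 0 - (\<Sum>x\<in>Y. cscale (u (b x)) (b x)) a) \<in> ?B" by (simp only:)
    then have "0 = \<delta> (\<lambda>a. 0 - (\<Sum>x\<in>Y. cscale (u (b x)) (b x)) a) (snd x - {w})"
      using c B by simp
    also have "\<dots> = - (\<Sum>y\<in>Y. const_poly (u (b y)) * \<delta> (b y) (snd x - {w}))"
      unfolding \<delta>_lin by (simp add: \<delta>_def koszul_diff_def)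
    finally have "0 = Poly_Mapping.lookup (\<Sum>y\<in>Y. const_poly (u (b y)) * \<delta> (b y) (snd x - {w})) (sqfree (insert w (fst x)))"
      by simp
    also have "\<dots> = (\<Sum>y\<in>Y. u (b y) * (if y = x then ksign w (snd x - {w}) else 0))"
      unfolding lookup_sum
    proof (rule sum.cong[OF refl])
      fix y assume "y \<in> Y"
      then have "x \<in> X" "y \<in> X" using x(1) Y(1) by blast+
      then show "Poly_Mapping.lookup (const_poly (u (b y)) * \<delta> (b y) (snd x - {w})) (sqfree (insert w (fst x)))
        = u (b y) * (if y = x then ksign w (snd x - {w}) else 0)"
        unfolding lookup_const_mult by (simp only: coeff[OF _ _ w])
    qed
    also have "\<dots> = u (b x) * ksign w (snd x - {w})"
      using x(1) by (simp add: if_distrib[of "(*) _"] cong: if_cong)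
    finally show "u s = 0" using x(2) by (simp add: ksign_nonzero)
  next
    fix z assume z: "z \<in> ?Z"
    define p where "p x = (SOME w. w \<in> snd x)" for x :: "'v set \<times> 'v set"
    have p: "p x \<in> snd x" if "x \<in> X" for x unfolding p_def using ne[OF that] by (rule someI_ex)
    \<comment> \<open>By \<open>coeff\<close>, this choice makes the corrected cycle
      \<open>z'\<close> lose its image at the place selected by \<open>p x\<close>, for all
      \<open>x\<close> simultaneously.\<close>
    define u where "u x = Poly_Mapping.lookup (\<delta> z (snd x - {p x})) (sqfree (insert (p x) (fst x)))
      / ksign (p x) (snd x - {p x})" for x
    define z' where "z' = z - (\<Sum>x\<in>X. cscale (u x) (b x))"
    have z'alt: "z' = (\<lambda>a. z a - (\<Sum>x\<in>X. cscale (u x) (b x)) a)" by (simp add: z'_def fun_diff_def)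
    have z': "z' \<in> ?Z"
      unfolding z'_def using z bZ
      by (intro cs.subspace_diff cs.subspace_sum cs.subspace_scale subspace_cycles[OF ideal]) auto
    have "hvec ?K n ?j (diff_map ?K n z')"
      using z' hvec_mat_vec[OF resolution_hmap[OF K]] unfolding Z tensor_chains_quotient_ring by blast
    then have "\<forall>a<rank ?K n. diff_map ?K n z' a \<in> homogeneous (int (Suc D))"
      unfolding hv by (simp add: algebra_simps)
    then have hom: "\<delta> z' T \<in> homogeneous (int (Suc D))" if "card T = n" for T
      using that all_faces[of "\<lambda>p. p \<in> homogeneous (int (Suc D))"] by blast
    have inI: "\<delta> z' T \<in> ?I" if "card T = n" for T using z' that unfolding Z by blast
    have cyc: "koszul_diff (\<delta> z') T = 0" for T unfolding \<delta>_def by (rule koszul_diff_koszul_diff)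
    \<comment> \<open>The image \<delta> z' is a Koszul cycle with values in the facet ideal, so its
      nonzero places are closed under exchange and \<open>hit\<close> applies to them.\<close>
    define nz where "nz S F \<longleftrightarrow> card S = n \<and> F \<in> facets \<Delta> \<and> Poly_Mapping.lookup (\<delta> z' S) (sqfree F) \<noteq> 0" for S F
    have closed: "card S = n \<and> F \<in> facets \<Delta> \<and> S \<inter> F = {} \<and>
        (\<forall>w\<in>S. \<exists>v\<in>F. nz (insert v (S - {w})) (insert w (F - {v})))" if "nz S F" for S F
      using facet_cycle_exchange[of n "\<delta> z'" S F, OF inI hom cyc] that unfolding nz_def by blast
    have zero: "Poly_Mapping.lookup (\<delta> z' (snd x - {p x})) (sqfree (insert (p x) (fst x))) = 0" if x: "x \<in> X" for x
    proof -
      have "Poly_Mapping.lookup (\<Sum>y\<in>X. const_poly (u y) * \<delta> (b y) (snd x - {p x})) (sqfree (insert (p x) (fst x)))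
        = (\<Sum>y\<in>X. u y * (if y = x then ksign (p x) (snd x - {p x}) else 0))"
        unfolding lookup_sum using x p by (intro sum.cong refl) (simp add: coeff)
      also have "\<dots> = u x * ksign (p x) (snd x - {p x})"
        using x by (simp add: if_distrib[of "(*) _"] cong: if_cong)
      also have "\<dots> = Poly_Mapping.lookup (\<delta> z (snd x - {p x})) (sqfree (insert (p x) (fst x)))"
        by (simp add: u_def ksign_nonzero)
      finally show ?thesis unfolding z'alt \<delta>_lin by (simp add: lookup_minus)
    qed
    have nnz: "\<not> nz S F" for S F
    proof
      assume "nz S F"
      then obtain G A where GA: "(G, A) \<in> X" "\<forall>w\<in>A. nz (A - {w}) (insert w G)"
        using hit[of nz S F] closed by blast
      then have "nz (A - {p (G, A)}) (insert (p (G, A)) G)" using p[OF GA(1)] by simp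
      then show False using zero[OF GA(1)] unfolding nz_def by simp
    qed
    have "\<delta> z' T = 0" if T: "card T = n" for T
    proof (rule poly_mapping_eqI, rule ccontr)
      fix t assume "Poly_Mapping.lookup (\<delta> z' T) t \<noteq> Poly_Mapping.lookup 0 t"
      then have t: "Poly_Mapping.lookup (\<delta> z' T) t \<noteq> 0" by simp
      then obtain F where "F \<in> facets \<Delta>" "t = sqfree F"
        using facet_ideal_generator_degree[OF inI[OF T] hom[OF T]] by blast
      then have "nz T F" unfolding nz_def using T t by simp
      with nnz show False by blast
    qed
    then have "z' \<in> ?B" using z' unfolding B Z by blast
    moreover have "z' = z - (\<Sum>s\<in>b ` X. cscale (u (the_inv_into X b s)) s)"
      unfolding z'_def using inj by (simp add: sum.reindex the_inv_into_f_f)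
    ultimately show "\<exists>T u. finite T \<and> T \<subseteq> b ` X \<and> z - (\<Sum>s\<in>T. cscale (u s) s) \<in> ?B"
      by (intro exI[of _ "b ` X"] exI[of _ "\<lambda>s. u (the_inv_into X b s)"]) auto
  qed
  then have "graded_betti ?M (Suc n) ?j = card (b ` X)"
    by (intro graded_betti_eq_card[OF ideal K]) auto
  then show ?thesis using card_image[OF inj] by simp
qed

end


section \<open>Stars in trees\<close>

lemma facets_card_eq: "pure \<Delta> \<Longrightarrow> F \<in> facets \<Delta> \<Longrightarrow> G \<in> facets \<Delta> \<Longrightarrow> card F = card G"
proof -
  assume "pure \<Delta>" "F \<in> facets \<Delta>" "G \<in> facets \<Delta>"
  then have "face_dim F = face_dim G" unfolding pure_def by blast
  then show "card F = card G" by (simp add: face_dim_def)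
qed

text \<open>Singletons are faces and there is at least one vertex, so the empty face is not maximal.
  The dimension is thus nonnegative and can be written as a natural number.\<close>

lemma pure_facets:
  fixes \<Delta> :: "'v::finite set set"
  assumes \<Delta>: "simplicial_complex UNIV \<Delta>" and p: "pure \<Delta>"
  obtains D where "complex_dim \<Delta> = int D" "\<And>F. F \<in> facets \<Delta> \<Longrightarrow> card F = Suc D"
proof -
  have ne: "F \<noteq> {}" if "F \<in> facets \<Delta>" for F
    using that \<Delta> unfolding facets_def simplicial_complex_def by auto
  obtain v :: 'v where "{v} \<in> \<Delta>" using \<Delta> unfolding simplicial_complex_def by auto
  then obtain M where M: "M \<in> \<Delta>" "\<forall>G\<in>\<Delta>. M \<subseteq> G \<longrightarrow> M = G"
    using finite_has_maximal2[of \<Delta> "{v}"] by auto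
  then have MF: "M \<in> facets \<Delta>" unfolding facets_def by blast
  then obtain D where D: "card M = Suc D"
    using ne card_gt_0_iff[of M] by (metis finite gr0_implies_Suc)
  have all: "card F = Suc D" if "F \<in> facets \<Delta>" for F
    using facets_card_eq[OF p that MF] D by simp
  then have "face_dim ` facets \<Delta> = {int D}"
    using MF by (auto simp: face_dim_def)
  then have "complex_dim \<Delta> = int D" by (simp add: complex_dim_def)
  with all that show ?thesis by blast
qed

text \<open>Facets form an antichain, so the faces below any nonempty set of facets form a
  subcomplex with exactly these facets, and the leaf property of trees becomes a statement about
  sets of facets.\<close>

lemma tree_leaf:
  fixes \<Delta> :: "'v::finite set set"
  assumes t: "tree \<Delta>" and \<F>: "\<F> \<subseteq> facets \<Delta>" "\<F> \<noteq> {}"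
  obtains F where "F \<in> \<F>"
    "\<F> = {F} \<or> (\<exists>G\<in>\<F>. G \<noteq> F \<and> (\<forall>H\<in>\<F>. H \<noteq> F \<longrightarrow> F \<inter> H \<subseteq> G))"
proof -
  define \<Gamma> where "\<Gamma> = {S. \<exists>F\<in>\<F>. S \<subseteq> F}"
  have f: "facets \<Gamma> = \<F>"
  proof
    show "facets \<Gamma> \<subseteq> \<F>" unfolding facets_def \<Gamma>_def by auto
    show "\<F> \<subseteq> facets \<Gamma>"
    proof
      fix F assume F: "F \<in> \<F>"
      have "G = F" if "G \<subseteq> H" "H \<in> \<F>" "F \<subseteq> G" for G H
      proof -
        have "H = F" using that F \<F>(1) unfolding facets_def by blast
        then show ?thesis using that by blast
      qed
      then show "F \<in> facets \<Gamma>" using F unfolding facets_def \<Gamma>_def by blast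
    qed
  qed
  have "simplicial_complex (\<Union>\<F>) \<Gamma>"
    unfolding simplicial_complex_def \<Gamma>_def by auto
  then have "subcomplex \<Gamma> \<Delta>" unfolding subcomplex_def using f \<F>(1) by blast
  moreover have "\<Gamma> \<noteq> {}" using \<F>(2) unfolding \<Gamma>_def by blast
  ultimately obtain F where "leaf \<Gamma> F" using t unfolding tree_def by blast
  then have F: "F \<in> \<F>" and l: "\<F> = {F} \<or> (\<exists>G\<in>\<F>. G \<noteq> F \<and> (\<forall>H\<in>\<F>. H \<noteq> F \<longrightarrow> F \<inter> H \<subseteq> F \<inter> G))"
    unfolding leaf_def f by (rule conjunct1, rule conjunct2)
  from l have "\<F> = {F} \<or> (\<exists>G\<in>\<F>. G \<noteq> F \<and> (\<forall>H\<in>\<F>. H \<noteq> F \<longrightarrow> F \<inter> H \<subseteq> G))"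
    by simp
  with F show ?thesis by (rule that)
qed

text \<open>Three such facets are complements in \<open>U\<close> of distinct points a, b, c. If the
  first were a leaf with the third as its partner, then c would lie in the first two but not in the
  third.\<close>

lemma tree_no_three_facets:
  fixes \<Delta> :: "'v::finite set set"
  assumes t: "tree \<Delta>" and c: "\<And>F. F \<in> facets \<Delta> \<Longrightarrow> card F = Suc D" and U: "card U = Suc (Suc D)"
    and F: "F1 \<in> facets \<Delta>" "F2 \<in> facets \<Delta>" "F3 \<in> facets \<Delta>"
    and sub: "F1 \<subseteq> U" "F2 \<subseteq> U" "F3 \<subseteq> U" and dist: "F1 \<noteq> F2" "F1 \<noteq> F3" "F2 \<noteq> F3"
  shows False
proof -
  have compl: "\<exists>a\<in>U. F = U - {a}" if "F \<in> {F1, F2, F3}" for F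
  proof -
    have FU: "F \<subseteq> U" "card F = Suc D" using that F sub c by auto
    then have "card (U - F) = 1" using U by (simp add: card_Diff_subset)
    then obtain a where "U - F = {a}" by (auto simp: card_1_singleton_iff)
    then show ?thesis using FU(1) by blast
  qed
  obtain L where L: "L \<in> {F1, F2, F3}" and
    leaf: "{F1, F2, F3} = {L} \<or> (\<exists>G\<in>{F1, F2, F3}. G \<noteq> L \<and> (\<forall>H\<in>{F1, F2, F3}. H \<noteq> L \<longrightarrow> L \<inter> H \<subseteq> G))"
    using tree_leaf[OF t, of "{F1, F2, F3}"] F by blast
  have "{F1, F2, F3} \<noteq> {L}" using dist by blast
  then obtain G where G: "G \<in> {F1, F2, F3}" "G \<noteq> L" "\<forall>H\<in>{F1, F2, F3}. H \<noteq> L \<longrightarrow> L \<inter> H \<subseteq> G"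
    using leaf by blast
  have "card {F1, F2, F3} = 3" using dist by simp
  then have "card ({F1, F2, F3} - {L, G}) = 1" using L G(1,2) by (subst card_Diff_subset) auto
  then obtain H where "{F1, F2, F3} - {L, G} = {H}" by (auto simp: card_1_singleton_iff)
  then have "H \<in> {F1, F2, F3} - {L, G}" by simp
  then have H: "H \<in> {F1, F2, F3}" "H \<noteq> L" "H \<noteq> G" by simp_all
  obtain a where a: "L = U - {a}" using compl[OF L] by blast
  obtain b where b: "H = U - {b}" using compl[OF H(1)] by blast
  obtain c where c: "c \<in> U" "G = U - {c}" using compl[OF G(1)] by blast
  have "c \<noteq> a" "c \<noteq> b" using G(2) H(3) a b c(2) by auto
  then have "c \<in> L \<inter> H" using a b c(1) by simp
  moreover have "L \<inter> H \<subseteq> G" using G(3)[rule_format, OF H(1,2)] .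
  ultimately show False using c(2) by blast
qed

text \<open>The index set of the basis for i \<ge> 2. The facets through \<open>G\<close> correspond
  to the vertices completing it, so the fibre over \<open>G\<close> has m(G) choose i
  elements.\<close>

definition star_pairs :: "'v set set \<Rightarrow> nat \<Rightarrow> ('v set \<times> 'v set) set" where
  "star_pairs \<Delta> i = (SIGMA G:adjacent_faces \<Delta>. {A. card A = i \<and> A \<inter> G = {} \<and> (\<forall>w\<in>A. insert w G \<in> facets \<Delta>)})"

context
  fixes \<Delta> :: "'v::finite set set" and D :: nat
  assumes complex: "simplicial_complex UNIV \<Delta>" and tree: "tree \<Delta>" and dim: "complex_dim \<Delta> = int D"
    and card_facet: "\<And>F. F \<in> facets \<Delta> \<Longrightarrow> card F = Suc D"
begin

lemma card_adjacent_face: "G \<in> adjacent_faces \<Delta> \<Longrightarrow> card G = D"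
  by (simp add: adjacent_faces_def face_dim_def dim)

lemma card_star_pairs: "card (star_pairs \<Delta> i) = (\<Sum>G\<in>adjacent_faces \<Delta>. facet_mult \<Delta> G choose i)"
proof -
  have "card {A. card A = i \<and> A \<inter> G = {} \<and> (\<forall>w\<in>A. insert w G \<in> facets \<Delta>)} = facet_mult \<Delta> G choose i"
    if G: "G \<in> adjacent_faces \<Delta>" for G
  proof -
    define L where "L = {w. w \<notin> G \<and> insert w G \<in> facets \<Delta>}"
    have "(\<lambda>w. insert w G) ` L = {F \<in> facets \<Delta>. G \<subseteq> F}"
    proof (intro equalityI subsetI)
      fix F assume "F \<in> {F \<in> facets \<Delta>. G \<subseteq> F}"
      then have F: "F \<in> facets \<Delta>" "G \<subseteq> F" by auto
      then have "card (F - G) = 1"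
        using card_facet card_adjacent_face[OF G] by (simp add: card_Diff_subset)
      then obtain w where "F - G = {w}" by (auto simp: card_1_singleton_iff)
      then have "F = insert w G" "w \<notin> G" using F(2) by auto
      then show "F \<in> (\<lambda>w. insert w G) ` L" using F(1) unfolding L_def by blast
    qed (auto simp: L_def)
    moreover have "inj_on (\<lambda>w. insert w G) L" unfolding L_def inj_on_def by auto
    ultimately have "card L = facet_mult \<Delta> G" unfolding facet_mult_def by (metis card_image)
    moreover have "{A. card A = i \<and> A \<inter> G = {} \<and> (\<forall>w\<in>A. insert w G \<in> facets \<Delta>)} = {A. A \<subseteq> L \<and> card A = i}"
      unfolding L_def by blast
    ultimately show ?thesis using n_subsets[of L i] by simp
  qed
  then show ?thesis unfolding star_pairs_def by (subst card_SigmaI) auto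
qed

lemma star_pairs_incidence_unique:
  assumes "(G, A) \<in> star_pairs \<Delta> i" "(G', A') \<in> star_pairs \<Delta> i" and i: "i \<ge> 2"
    and w: "w \<in> A" "w' \<in> A'" and eq: "A - {w} = A' - {w'}" "insert w G = insert w' G'"
  shows "(G, A) = (G', A')"
proof -
  have x: "card G = D" "card A = i" "A \<inter> G = {}" "\<forall>w\<in>A. insert w G \<in> facets \<Delta>"
    and x': "A' \<inter> G' = {}" "\<forall>w\<in>A'. insert w G' \<in> facets \<Delta>"
    using assms(1,2) card_adjacent_face unfolding star_pairs_def by auto
  show ?thesis
  proof (cases "w = w'")
    case True
    have "w \<notin> G" "w \<notin> G'" using w x(3) x'(1) True by auto
    then have "G = insert w G - {w}" "G' = insert w G' - {w}" by simp_all
    moreover have "A = insert w (A - {w})" "A' = insert w (A' - {w})"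
      using w True by (simp_all add: insert_absorb)
    ultimately have "A = A'" "G = G'" using eq True by metis+
    then show ?thesis by simp
  next
    case False
    \<comment> \<open>Here i \<ge> 2 provides a vertex a common to both sets. For w \<noteq> w' the
      facets G \<union> {w}, G \<union> {a} and G' \<union> {a} are distinct and lie in the D + 2
      vertices G \<union> {a, w}.\<close>
    have "card (A - {w}) \<noteq> 0" using x(2) i w(1) by simp
    then have "A - {w} \<noteq> {}" by (metis card.empty)
    then obtain a where a: "a \<in> A" "a \<noteq> w" by blast
    then have a': "a \<in> A'" "a \<noteq> w'" using eq(1) by blast+
    have aG: "a \<notin> G" "a \<notin> G'" "w \<notin> G" using a(1) a'(1) x(3) x'(1) w(1) by auto
    have wG': "w \<in> G'" using eq(2) False by blast
    have False
    proof (rule tree_no_three_facets[OF tree card_facet])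
      show "card (insert a (insert w G)) = Suc (Suc D)" using a aG x(1) by simp
      show "insert w G \<in> facets \<Delta>" "insert a G \<in> facets \<Delta>" "insert a G' \<in> facets \<Delta>"
        using w x(4) a a' x'(2) by auto
      show "insert w G \<subseteq> insert a (insert w G)" "insert a G \<subseteq> insert a (insert w G)" by auto
      show "insert a G' \<subseteq> insert a (insert w G)" using eq(2) by auto
      show "insert w G \<noteq> insert a G" "insert w G \<noteq> insert a G'" using a(2) aG by auto
      show "insert a G \<noteq> insert a G'" using wG' aG a(2) by auto
    qed
    then show ?thesis ..
  qed
qed

text \<open>
  The facets in the support of a cycle with squarefree multidegree \<open>W\<close> form a subcomplex. Exchanging a
  vertex of a leaf of it always removes the same vertex, so the leaf lies in a star filling \<open>W\<close>.
\<close>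

lemma star_pairs_hit:
  assumes nz: "nz S F"
    and closed: "\<And>S F. nz S F \<Longrightarrow> card S = i \<and> F \<in> facets \<Delta> \<and> S \<inter> F = {} \<and>
      (\<forall>w\<in>S. \<exists>v\<in>F. nz (insert v (S - {w})) (insert w (F - {v})))"
    and i: "i \<ge> 1"
  shows "\<exists>G A. (G, A) \<in> star_pairs \<Delta> (Suc i) \<and> (\<forall>w\<in>A. nz (A - {w}) (insert w G))"
proof -
  \<comment> \<open>An exchange moves one vertex in each direction between the face and the facet,
    so their union stays fixed and the face is recovered as the complement of the facet in
    \<open>W\<close>.\<close>
  define W where "W = S \<union> F"
  define \<F> where "\<F> = {F \<in> facets \<Delta>. F \<subseteq> W \<and> nz (W - F) F}"
  have "W - F = S" using closed[OF nz] unfolding W_def by blast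
  then have "F \<in> \<F>" using nz closed[OF nz] unfolding \<F>_def W_def by auto
  then obtain L where L: "L \<in> \<F>"
    "\<F> = {L} \<or> (\<exists>G\<in>\<F>. G \<noteq> L \<and> (\<forall>H\<in>\<F>. H \<noteq> L \<longrightarrow> L \<inter> H \<subseteq> G))"
    using tree_leaf[OF tree, of \<F>] unfolding \<F>_def by blast
  then have Lnz: "nz (W - L) L" and LW: "L \<subseteq> W" and Lf: "L \<in> facets \<Delta>" unfolding \<F>_def by auto
  have nbr: "\<exists>v\<in>L. nz (insert v (W - L - {w})) (insert w (L - {v})) \<and> insert w (L - {v}) \<in> \<F>"
    if w: "w \<in> W - L" for w
  proof -
    obtain v where v: "v \<in> L" "nz (insert v (W - L - {w})) (insert w (L - {v}))"
      using closed[OF Lnz] w by blast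
    have "insert v (W - L - {w}) = W - insert w (L - {v})" using v(1) w LW by blast
    then have "insert w (L - {v}) \<in> \<F>"
      using v closed[OF v(2)] w LW unfolding \<F>_def by auto
    then show ?thesis using v by blast
  qed
  have cWL: "card (W - L) = i" using closed[OF Lnz] by blast
  then have "W - L \<noteq> {}" using i by (metis card.empty not_one_le_zero)
  \<comment> \<open>An exchange at \<open>w1\<close> produces a second facet, so the leaf has a
    partner \<open>M\<close>; later the same vertex shows that \<open>G\<close> lies in two
    facets.\<close>
  then obtain w1 where w1: "w1 \<in> W - L" by blast
  obtain v1 where v1: "v1 \<in> L" "insert w1 (L - {v1}) \<in> \<F>" using nbr[OF w1] by blast
  then have "\<F> \<noteq> {L}" using w1 by auto
  then obtain M where M: "M \<in> \<F>" "M \<noteq> L" "\<forall>H\<in>\<F>. H \<noteq> L \<longrightarrow> L \<inter> H \<subseteq> M" using L(2) by blast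
  have "\<not> L \<subseteq> M"
  proof
    assume "L \<subseteq> M"
    moreover have "card M = card L" using M(1) Lf card_facet unfolding \<F>_def by simp
    ultimately have "L = M" by (intro card_subset_eq) auto
    then show False using M(2) by simp
  qed
  \<comment> \<open>An exchange removing v from the leaf leaves L - {v} in the intersection with the
    new facet, hence inside \<open>M\<close>. Since \<open>g\<close> is not in \<open>M\<close>, the
    vertex removed can only be \<open>g\<close>, whatever vertex comes in.\<close>
  then obtain g where g: "g \<in> L" "g \<notin> M" by blast
  have vg: "nz (insert g (W - L - {w})) (insert w (L - {g})) \<and> insert w (L - {g}) \<in> \<F>" if w: "w \<in> W - L" for w
  proof -
    obtain v where v: "v \<in> L" "nz (insert v (W - L - {w})) (insert w (L - {v}))" "insert w (L - {v}) \<in> \<F>"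
      using nbr[OF w] by blast
    have "insert w (L - {v}) \<noteq> L" using w by blast
    then have "L \<inter> insert w (L - {v}) \<subseteq> M" using M(3)[rule_format, OF v(3)] by simp
    then have "v = g" using g by blast
    then show ?thesis using v by simp
  qed
  define G where "G = L - {g}"
  define A where "A = insert g (W - L)"
  have AG: "A \<inter> G = {}" unfolding A_def G_def by blast
  have cG: "card G = D" unfolding G_def using g card_facet[OF Lf] by simp
  have cA: "card A = Suc i" unfolding A_def using g cWL by simp
  have fac: "insert w G \<in> facets \<Delta>" if "w \<in> A" for w
  proof (cases "w = g")
    case True
    then show ?thesis using g Lf by (simp add: G_def insert_absorb)
  next
    case False
    then show ?thesis using vg[of w] that unfolding \<F>_def A_def G_def by auto
  qed
  have "G \<in> adjacent_faces \<Delta>"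
    unfolding adjacent_faces_def
  proof (intro CollectI conjI)
    have "L \<in> \<Delta>" using Lf unfolding facets_def by blast
    then show "G \<in> \<Delta>" using complex unfolding simplicial_complex_def G_def by blast
    show "face_dim G = complex_dim \<Delta> - 1" using cG by (simp add: face_dim_def dim)
    have "{insert g G, insert w1 G} \<subseteq> {F \<in> facets \<Delta>. G \<subseteq> F}"
      using fac w1 unfolding A_def by auto
    moreover have "insert g G \<noteq> insert w1 G" using w1 g unfolding G_def by auto
    then have "card {insert g G, insert w1 G} = 2" by simp
    ultimately show "facet_mult \<Delta> G \<ge> 2" unfolding facet_mult_def by (metis card_mono finite)
  qed
  then have "(G, A) \<in> star_pairs \<Delta> (Suc i)"
    using cA AG fac unfolding star_pairs_def by auto
  moreover have "nz (A - {w}) (insert w G)" if "w \<in> A" for w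
  proof (cases "w = g")
    case True
    have "A - {g} = W - L" "insert g G = L" using g unfolding A_def G_def by auto
    then show ?thesis using Lnz True by simp
  next
    case False
    then have w: "w \<in> W - L" using that unfolding A_def by blast
    have "A - {w} = insert g (W - L - {w})" using False unfolding A_def by blast
    then show ?thesis using vg[OF w] unfolding G_def by simp
  qed
  ultimately show ?thesis by blast
qed

end


theorem proposition3p3:
  fixes \<Delta> :: "'v::finite set set"
    and I :: "('v, 'k::field) polynomial set"
    and d :: int
    and m :: nat
  assumes "simplicial_complex UNIV \<Delta>"
    and "complex_dim \<Delta> = d"
    and "pure \<Delta>"
    and "tree \<Delta>"
    and "connected_in_codim_1 \<Delta>"
    and "card (facets \<Delta>) = m"
    and "I = facet_ideal \<Delta>"
  shows "graded_betti (quotient_ring I) 1 (1 + d) = m \<and>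
    (\<forall>i\<ge>2. graded_betti (quotient_ring I) i (int i + d) =
       (\<Sum>G\<in>adjacent_faces \<Delta>. facet_mult \<Delta> G choose i))"
proof (intro conjI allI impI)
  obtain D where dim: "complex_dim \<Delta> = int D" and card_facet: "\<And>F. F \<in> facets \<Delta> \<Longrightarrow> card F = Suc D"
    using pure_facets[OF assms(1,3)] by blast
  have d: "d = int D" using assms(2) dim by simp
  show "graded_betti (quotient_ring I) 1 (1 + d) = m"
  proof -
    \<comment> \<open>For i = 1 an arbitrary vertex of each facet serves as the singleton
      \<open>A\<close>, its complement in the facet as \<open>G\<close>.\<close>
    define v where "v F = (SOME v. v \<in> F)" for F :: "'v set"
    have v: "v F \<in> F" if "F \<in> facets \<Delta>" for F
    proof -
      have "F \<noteq> {}" using card_facet[OF that] by auto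
      then show ?thesis unfolding v_def by (rule some_in_eq[THEN iffD2])
    qed
    define X where "X = (\<lambda>F. (F - {v F}, {v F})) ` facets \<Delta>"
    have X: "card G = D \<and> card A = Suc 0 \<and> G \<inter> A = {} \<and> (\<forall>w\<in>A. insert w G \<in> facets \<Delta>)"
      and star: "insert w G \<in> facets \<Delta> \<and> (G, A) = (insert w G - {v (insert w G)}, {v (insert w G)})"
      if "(G, A) \<in> X" "w \<in> A" for G A w
    proof -
      obtain F where F: "F \<in> facets \<Delta>" "G = F - {v F}" "A = {v F}" using \<open>(G, A) \<in> X\<close> unfolding X_def by blast
      have "insert w G = F" using that(2) F(2,3) v[OF F(1)] by auto
      then show "insert w G \<in> facets \<Delta> \<and> (G, A) = (insert w G - {v (insert w G)}, {v (insert w G)})"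
        using F by simp
      show "card G = D \<and> card A = Suc 0 \<and> G \<inter> A = {} \<and> (\<forall>w\<in>A. insert w G \<in> facets \<Delta>)"
        using F v[OF F(1)] card_facet[OF F(1)] by (simp add: insert_absorb)
    qed
    have ne: "\<exists>w. w \<in> A" if "(G, A) \<in> X" for G A using that unfolding X_def by blast
    have "graded_betti (quotient_ring (facet_ideal \<Delta> :: ('v, 'k) polynomial set)) (Suc 0) (int (Suc 0) + int D) = card X"
    proof (rule graded_betti_linear_strand[OF card_facet])
      show "card G = D \<and> card A = Suc 0 \<and> G \<inter> A = {} \<and> (\<forall>w\<in>A. insert w G \<in> facets \<Delta>)" if "(G, A) \<in> X" for G A
        using X ne that by blast
    next
      fix G A G' A' w w'
      assume "(G, A) \<in> X" "(G', A') \<in> X" "w \<in> A" "w' \<in> A'" "insert w G = insert w' G'"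
      then show "(G, A) = (G', A')" using star by metis
    next
      fix nz S F assume SF: "nz S F" and closed: "\<And>S F. nz S F \<Longrightarrow> card S = 0 \<and> F \<in> facets \<Delta> \<and> S \<inter> F = {} \<and>
        (\<forall>w\<in>S. \<exists>v\<in>F. nz (insert v (S - {w})) (insert w (F - {v})))"
      \<comment> \<open>In homological degree 1 the differential lands in the empty face, so the
        pair attached to the facet \<open>F\<close> itself is hit without any leaf argument.\<close>
      have "S = {}" and F: "F \<in> facets \<Delta>" using closed[OF SF] by simp_all
      then have nz: "nz {} F" using SF by simp
      have "(F - {v F}, {v F}) \<in> X" using F unfolding X_def by blast
      moreover have "\<forall>w\<in>{v F}. nz ({v F} - {w}) (insert w (F - {v F}))"
        using nz v[OF F] by (simp add: insert_absorb)
      ultimately show "\<exists>G A. (G, A) \<in> X \<and> (\<forall>w\<in>A. nz (A - {w}) (insert w G))" by blast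
    qed
    moreover have "card X = m"
    proof -
      have "inj_on (\<lambda>F. (F - {v F}, {v F})) (facets \<Delta>)"
      proof (rule inj_onI)
        fix F F' assume F: "F \<in> facets \<Delta>" "F' \<in> facets \<Delta>" and e: "(F - {v F}, {v F}) = (F' - {v F'}, {v F'})"
        have "F = insert (v F) (F - {v F})" "F' = insert (v F') (F' - {v F'})"
          using v F by auto
        then show "F = F'" using e by (metis prod.inject singleton_inject)
      qed
      then show ?thesis unfolding X_def using assms(6) by (simp add: card_image)
    qed
    ultimately show ?thesis using assms(7) d by simp
  qed
  fix i :: nat assume i: "2 \<le> i"
  \<comment> \<open>The differential lands in faces of cardinality n = i - 1; i \<ge> 2 ensures that
    these are nonempty, which the leaf argument uses.\<close>
  then obtain n where n: "i = Suc n" "n \<ge> 1" by (cases i) auto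
  note tree = assms(1,4) dim card_facet
  have "graded_betti (quotient_ring (facet_ideal \<Delta> :: ('v, 'k) polynomial set)) (Suc n) (int (Suc n) + int D)
      = card (star_pairs \<Delta> i)"
  proof (rule graded_betti_linear_strand[OF card_facet])
    fix G A assume "(G, A) \<in> star_pairs \<Delta> i"
    then show "card G = D \<and> card A = Suc n \<and> G \<inter> A = {} \<and> (\<forall>w\<in>A. insert w G \<in> facets \<Delta>)"
      using card_adjacent_face[OF tree] n(1) unfolding star_pairs_def by auto
  next
    fix G A G' A' w w'
    assume "(G, A) \<in> star_pairs \<Delta> i" "(G', A') \<in> star_pairs \<Delta> i" "w \<in> A" "w' \<in> A'"
      "A - {w} = A' - {w'}" "insert w G = insert w' G'"
    then show "(G, A) = (G', A')"
      by - (rule star_pairs_incidence_unique[OF assms(1,4) dim], (rule card_facet | assumption | rule i)+)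
  next
    fix nz S F assume SF: "nz S F" and closed: "\<And>S F. nz S F \<Longrightarrow> card S = n \<and> F \<in> facets \<Delta> \<and> S \<inter> F = {} \<and>
      (\<forall>w\<in>S. \<exists>v\<in>F. nz (insert v (S - {w})) (insert w (F - {v})))"
    show "\<exists>G A. (G, A) \<in> star_pairs \<Delta> i \<and> (\<forall>w\<in>A. nz (A - {w}) (insert w G))"
      unfolding n(1)
      by (rule star_pairs_hit[OF assms(1,4) dim]) (rule card_facet SF closed n(2) | assumption)+
  qed
  then show "graded_betti (quotient_ring I) i (int i + d) = (\<Sum>G\<in>adjacent_faces \<Delta>. facet_mult \<Delta> G choose i)"
    using card_star_pairs[OF tree] n(1) assms(7) d by simp
qed

end
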